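(* There is a universal constant $C>0$ such that the following holds. Let $u\in C(Q_2)$ be a non-negative function which is a viscosity supersolution of $P^-_{\lambda,\Lambda}(D^2u)-u_t\le\phi(|Du|)$ in $Q_2$ and a viscosity subsolution of $P^+_{\lambda,\Lambda}(D^2u)-u_t\ge-\phi(|Du|)$ in $Q_2$. If $(x_0,t_0)\in Q_2$ is such that $u(x_0,t_0)>0$, and if $\rho>0$ satisfies $Q_{2\rho}(x_0,t_0)\cup A^+_\rho(x_0,t_0)\subset Q_2$ and $$\rho\le\alpha_0:=\frac{u(x_0,t_0)}{C\big(\phi(u(x_0,t_0))+u(x_0,t_0)\big)},$$ then $$u(x_0,t_0)\le C\inf_{(x,t)\in A^+_\rho(x_0,t_0)}u(x,t).$$
   Context: Points of space-time are $(x,t)\in\mathbb{R}^n\times\mathbb{R}$; $|\cdot|$ is the Euclidean norm and $|x|_\infty=\max_i|x_i|$. Parabolic cubes are $Q_\rho(x_0,t_0)=\{x\in\mathbb{R}^n:|x-x_0|_\infty<\rho\}\times(t_0-\rho^2,t_0]$, and $Q_\rho=Q_\rho(0,0)$. $Du$, $D^2u$ are the gradient and Hessian in $x$, $u_t$ is the time derivative. Fixed constants $0<\lambda\le\Lambda$. For a real symmetric $n\times n$ matrix $M$ with eigenvalues $e_i$: $P^-_{\lambda,\Lambda}(M)=\lambda\sum_{e_i>0}e_i+\Lambda\sum_{e_i<0}e_i$ and $P^+_{\lambda,\Lambda}(M)=\Lambda\sum_{e_i>0}e_i+\lambda\sum_{e_i<0}e_i$. Standing assumptions on the nonlinearity: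 $\phi:[0,\infty)\to[0,\infty)$ has the form $\phi(t)=\eta(t)t$ and (P1) $\phi$ is increasing, locally Lipschitz continuous in $(0,\infty)$, and $\phi(t)\ge t$ for every $t\ge0$; moreover $\eta:(0,\infty)\to[1,\infty)$ is nonincreasing on $(0,1)$ and nondecreasing on $[1,\infty)$; (P2) $\lim_{t\to\infty}\frac{t\eta'(t)}{\eta(t)}\log(\eta(t))=0$; (P3) there is a constant $\Lambda_0$ such that $\eta(st)\le\Lambda_0\eta(s)\eta(t)$ for all $s,t\in(0,\infty)$. A constant is universal if it depends only on $\lambda,\Lambda$, the nonlinearity $\phi$ and the dimension $n$. Viscosity solutions: a lower semicontinuous $u:Q_r(x_0,t_0)\to\mathbb{R}$ is a viscosity supersolution of $P^-_{\lambda,\Lambda}(D^2u)-u_t\le\phi(|Du|)$ in $Q_r(x_0,t_0)$ if, whenever $(x,t)\in Q_r(x_0,t_0)$ and $\psi\in C^2(Q_r(x_0,t_0))$ satisfy $\psi\le u$ and $\psi(x,t)=u(x,t)$, one has $P^-_{\lambda,\Lambda}(D^2\psi(x,t))-\psi_t(x,t)\le\phi(|D\psi(x,t)|)$. An upper semicontinuous $u$ is a viscosity subsolution of $P^+_{\lambda,\Lambda}(D^2u)-u_t\ge-\phi(|Du|)$ in $Q_r(x_0,t_0)$ if, whenever $(x,t)\in Q_r(x_0,t_0)$ and $\psi\in C^2(Q_r(x_0,t_0))$ satisfy $\psi\ge u$ and $\psi(x,t)=u(x,t)$, one has $P^+_{\lambda,\Lambda}(D^2\psi(x,t))-\psi_t(x,t)\ge-\phi(|D\psi(x,t)|)$.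 The constant $c_n$: $0<c_n\le1$ is a fixed constant depending only on $n$, namely the one appearing in the following known backward-in-time intrinsic Harnack inequality: there is a universal constant $C'>0$ such that every positive $u\in C(Q_2)$ that is a viscosity supersolution of $P^-_{\lambda,\Lambda}(D^2u)-u_t\le\phi(|Du|)$ and a viscosity subsolution of $P^+_{\lambda,\Lambda}(D^2u)-u_t\ge-\phi(|Du|)$ in $Q_2$ satisfies $\sup_{(x,t)\in A_1^-}u(a_0x,a_0^2t)\le C'u(0,0)$ for $a_0\le\frac{u(0,0)}{C'(\phi(u(0,0))+u(0,0))}$, where $A_1^-=\{(x,t):|x|_\infty\le\frac{c_n}{2},\ -1+\frac{c_n^2}{4}\le t\le-1+\frac{c_n^2}{2}\}$. With this $c_n$, $$A^+_\rho(x_0,t_0)=\Big\{(x,t):|x-x_0|_\infty<\frac{\rho c_n}{2},\ \rho^2-\frac{(\rho c_n)^2}{2}<t-t_0\le\rho^2-\frac{(\rho c_n)^2}{4}\Big\}.$$ *)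

theory Defs
  imports "HOL-Analysis.Analysis"
begin

text \<open>Space-time points are pairs \<open>(x, t)\<close> in \<open>(real ^ 'n) \<times> real\<close>; \<open>infnorm\<close> is the maximum norm
  and \<open>norm\<close> the Euclidean norm on \<open>real ^ 'n\<close>.\<close>

definition parabolic_cube :: "real \<Rightarrow> (real ^ 'n) \<Rightarrow> real \<Rightarrow> ((real ^ 'n) \<times> real) set" where
  "parabolic_cube \<rho> x0 t0 = {(x, t). infnorm (x - x0) < \<rho> \<and> t0 - \<rho>\<^sup>2 < t \<and> t \<le> t0}"

definition A_plus :: "real \<Rightarrow> real \<Rightarrow> (real ^ 'n) \<Rightarrow> real \<Rightarrow> ((real ^ 'n) \<times> real) set" where
  "A_plus c \<rho> x0 t0 = {(x, t). infnorm (x - x0) < \<rho> * c / 2 \<and>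
      \<rho>\<^sup>2 - (\<rho> * c)\<^sup>2 / 2 < t - t0 \<and> t - t0 \<le> \<rho>\<^sup>2 - (\<rho> * c)\<^sup>2 / 4}"

definition A_minus_1 :: "real \<Rightarrow> ((real ^ 'n) \<times> real) set" where
  "A_minus_1 c = {(x, t). infnorm x \<le> c / 2 \<and> - 1 + c\<^sup>2 / 4 \<le> t \<and> t \<le> - 1 + c\<^sup>2 / 2}"


text \<open>The Pucci operators sum the eigenvalues with multiplicity. They are only applied to symmetric
  matrices, for which the multiplicity of an eigenvalue is the dimension of its eigenspace.\<close>

definition eigenspace :: "real ^ 'n ^ 'n \<Rightarrow> real \<Rightarrow> (real ^ 'n) set" where
  "eigenspace M e = {v. M *v v = e *\<^sub>R v}"

definition eigenvalues :: "real ^ 'n ^ 'n \<Rightarrow> real set" where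
  "eigenvalues M = {e. \<exists>v. v \<noteq> 0 \<and> M *v v = e *\<^sub>R v}"

definition pucci_minus :: "real \<Rightarrow> real \<Rightarrow> real ^ 'n ^ 'n \<Rightarrow> real" where
  "pucci_minus l L M =
     l * (\<Sum>e \<in> {e \<in> eigenvalues M. e > 0}. real (dim (eigenspace M e)) * e) +
     L * (\<Sum>e \<in> {e \<in> eigenvalues M. e < 0}. real (dim (eigenspace M e)) * e)"

definition pucci_plus :: "real \<Rightarrow> real \<Rightarrow> real ^ 'n ^ 'n \<Rightarrow> real" where
  "pucci_plus l L M =
     L * (\<Sum>e \<in> {e \<in> eigenvalues M. e > 0}. real (dim (eigenspace M e)) * e) +
     l * (\<Sum>e \<in> {e \<in> eigenvalues M. e < 0}. real (dim (eigenspace M e)) * e)"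


text \<open>The conditions (P1), (P2), (P3). Since \<open>\<phi>\<close> is locally Lipschitz in \<open>{0<..}\<close>, the derivative of
  \<open>\<eta>\<close> exists almost everywhere (Rademacher) and the limit in (P2) is taken off a null set \<open>N\<close>.\<close>

definition nonlinearity :: "(real \<Rightarrow> real) \<Rightarrow> bool" where
  "nonlinearity \<phi> \<longleftrightarrow> (\<exists>\<eta> :: real \<Rightarrow> real.
     (\<forall>t\<ge>0. \<phi> t = \<eta> t * t) \<and>
     strict_mono_on {0..} \<phi> \<and>
     (\<forall>t>0. \<exists>r>0. \<exists>L. L-lipschitz_on (ball t r \<inter> {0<..}) \<phi>) \<and>
     (\<forall>t\<ge>0. t \<le> \<phi> t) \<and>
     (\<forall>t>0. 1 \<le> \<eta> t) \<and>
     antimono_on {0<..<1} \<eta> \<and>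
     mono_on {1..} \<eta> \<and>
     (\<exists>N. negligible N \<and> (\<forall>t. t > 0 \<and> t \<notin> N \<longrightarrow> \<eta> differentiable (at t)) \<and>
        ((\<lambda>t. t * deriv \<eta> t / \<eta> t * ln (\<eta> t)) \<longlongrightarrow> 0) (inf at_top (principal (- N)))) \<and>
     (\<exists>\<Lambda>0. \<forall>s>0. \<forall>t>0. \<eta> (s * t) \<le> \<Lambda>0 * \<eta> s * \<eta> t))"


text \<open>Parabolic cubes contain their top, so derivatives are taken within the set: at the top the time
  derivative is one-sided. On a convex set with nonempty interior these derivatives are unique.\<close>

definition C2_on :: "'a::euclidean_space set \<Rightarrow> ('a \<Rightarrow> real) \<Rightarrow> bool" where
  "C2_on S \<psi> \<longleftrightarrow> (\<exists>(\<psi>' :: 'a \<Rightarrow> 'a \<Rightarrow>\<^sub>L real) (\<psi>'' :: 'a \<Rightarrow> 'a \<Rightarrow>\<^sub>L 'a \<Rightarrow>\<^sub>L real).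
     (\<forall>z\<in>S. (\<psi> has_derivative blinfun_apply (\<psi>' z)) (at z within S)) \<and>
     (\<forall>z\<in>S. (\<psi>' has_derivative blinfun_apply (\<psi>'' z)) (at z within S)) \<and>
     continuous_on S \<psi>'')"

definition space_partial ::
  "((real ^ 'n) \<times> real) set \<Rightarrow> 'n \<Rightarrow> ((real ^ 'n) \<times> real \<Rightarrow> real) \<Rightarrow> (real ^ 'n) \<times> real \<Rightarrow> real" where
  "space_partial S i \<psi> z = frechet_derivative \<psi> (at z within S) (axis i 1, 0)"

definition time_deriv ::
  "((real ^ 'n) \<times> real) set \<Rightarrow> ((real ^ 'n) \<times> real \<Rightarrow> real) \<Rightarrow> (real ^ 'n) \<times> real \<Rightarrow> real" where
  "time_deriv S \<psi> z = frechet_derivative \<psi> (at z within S) (0, 1)"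

definition space_grad ::
  "((real ^ 'n) \<times> real) set \<Rightarrow> ((real ^ 'n) \<times> real \<Rightarrow> real) \<Rightarrow> (real ^ 'n) \<times> real \<Rightarrow> real ^ 'n" where
  "space_grad S \<psi> z = (\<chi> i. space_partial S i \<psi> z)"

definition space_hessian ::
  "((real ^ 'n) \<times> real) set \<Rightarrow> ((real ^ 'n) \<times> real \<Rightarrow> real) \<Rightarrow> (real ^ 'n) \<times> real \<Rightarrow> real ^ 'n ^ 'n" where
  "space_hessian S \<psi> z = (\<chi> i j. space_partial S i (space_partial S j \<psi>) z)"


definition lower_semicont_on :: "'a::topological_space set \<Rightarrow> ('a \<Rightarrow> real) \<Rightarrow> bool" where
  "lower_semicont_on S u \<longleftrightarrow> (\<forall>z\<in>S. \<forall>a. a < u z \<longrightarrow> (\<forall>\<^sub>F w in at z within S. a < u w))"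

definition upper_semicont_on :: "'a::topological_space set \<Rightarrow> ('a \<Rightarrow> real) \<Rightarrow> bool" where
  "upper_semicont_on S u \<longleftrightarrow> (\<forall>z\<in>S. \<forall>a. u z < a \<longrightarrow> (\<forall>\<^sub>F w in at z within S. u w < a))"

text \<open>Viscosity supersolutions of \<open>P\<^sup>-(D\<^sup>2u) - u\<^sub>t \<le> \<phi>(|Du|)\<close> and subsolutions of
  \<open>P\<^sup>+(D\<^sup>2u) - u\<^sub>t \<ge> - \<phi>(|Du|)\<close> in a parabolic cube \<open>Q\<close>.\<close>

definition viscosity_supersolution ::
  "real \<Rightarrow> real \<Rightarrow> (real \<Rightarrow> real) \<Rightarrow> ((real ^ 'n) \<times> real) set \<Rightarrow> ((real ^ 'n) \<times> real \<Rightarrow> real) \<Rightarrow> bool" where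
  "viscosity_supersolution l L \<phi> Q u \<longleftrightarrow> lower_semicont_on Q u \<and>
     (\<forall>z\<in>Q. \<forall>\<psi>. C2_on Q \<psi> \<and> (\<forall>w\<in>Q. \<psi> w \<le> u w) \<and> \<psi> z = u z \<longrightarrow>
        pucci_minus l L (space_hessian Q \<psi> z) - time_deriv Q \<psi> z \<le> \<phi> (norm (space_grad Q \<psi> z)))"

definition viscosity_subsolution ::
  "real \<Rightarrow> real \<Rightarrow> (real \<Rightarrow> real) \<Rightarrow> ((real ^ 'n) \<times> real) set \<Rightarrow> ((real ^ 'n) \<times> real \<Rightarrow> real) \<Rightarrow> bool" where
  "viscosity_subsolution l L \<phi> Q u \<longleftrightarrow> upper_semicont_on Q u \<and>
     (\<forall>z\<in>Q. \<forall>\<psi>. C2_on Q \<psi> \<and> (\<forall>w\<in>Q. \<psi> w \<ge> u w) \<and> \<psi> z = u z \<longrightarrow>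
        pucci_plus l L (space_hessian Q \<psi> z) - time_deriv Q \<psi> z \<ge> - \<phi> (norm (space_grad Q \<psi> z)))"


text \<open>\<open>backward_harnack_const TYPE('n) c\<close> says that \<open>c\<close> is an admissible value of the dimensional
  constant \<open>c\<^sub>n\<close>, \<open>n = CARD('n)\<close>: the backward-in-time intrinsic Harnack inequality holds with this
  \<open>c\<close> for all ellipticity constants and all nonlinearities, with a constant \<open>C'\<close> that may depend on
  these.\<close>

definition backward_harnack_const :: "'n::finite itself \<Rightarrow> real \<Rightarrow> bool" where
  "backward_harnack_const _ c \<longleftrightarrow> 0 < c \<and> c \<le> 1 \<and>
     (\<forall>l L \<phi>. 0 < l \<and> l \<le> L \<and> nonlinearity \<phi> \<longrightarrow>
       (\<exists>C'>0. \<forall>u :: (real ^ 'n) \<times> real \<Rightarrow> real.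
          continuous_on (parabolic_cube 2 0 0) u \<and>
          (\<forall>z \<in> parabolic_cube 2 0 0. u z > 0) \<and>
          viscosity_supersolution l L \<phi> (parabolic_cube 2 0 0) u \<and>
          viscosity_subsolution l L \<phi> (parabolic_cube 2 0 0) u \<longrightarrow>
          (\<forall>a0. 0 < a0 \<and> a0 \<le> u (0, 0) / (C' * (\<phi> (u (0, 0)) + u (0, 0))) \<longrightarrow>
             (SUP (x, t) \<in> A_minus_1 c. u (a0 *\<^sub>R x, a0\<^sup>2 * t)) \<le> C' * u (0, 0))))"

end

theory Submission
  imports Defs "HOL-Complex_Analysis.Great_Picard"
begin

text \<open>A point \<open>(x\<^sub>1, t\<^sub>1)\<close> of \<open>A\<^sup>+\<close> is joined to \<open>(x\<^sub>0, t\<^sub>0)\<close> by a universal number \<open>N\<close> of equal steps on a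
  segment. In each step, the backward inequality is applied to a rescaling \<open>u / \<mu> + \<delta>\<close> of \<open>u\<close> in a cube
  of side comparable to \<open>\<rho>\<close>, where \<open>\<mu>\<close> is a lower bound for \<open>u\<close> at the earlier point. The normalization
  makes the intrinsic scale of the backward inequality universal, so that a step of relative size
  \<open>2 / \<surd>N\<close> is admissible and costs a fixed factor. The rescaled function satisfies the equation for
  the same \<open>\<phi>\<close> if \<open>r \<eta>(\<mu> / r)\<close> is small, and this follows from \<open>\<rho> \<le> \<alpha>\<^sub>0\<close>: by (P2), \<open>\<eta>\<close> grows so slowly
  that \<open>\<eta>(t \<eta>(t))\<close> is comparable to \<open>\<eta>(t)\<close>.

  Since \<open>\<phi>\<close> may jump at \<open>0\<close>, the restriction of \<open>u\<close> to earlier times need not be a viscosity solution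
  at the new top, where test functions are only one-sided. Therefore the function is first modified
  shortly before the top by a double obstacle problem for the heat equation.\<close>

section \<open>Pucci operators\<close>

text \<open>The jump at \<open>0\<close> can occur because \<open>\<eta>\<close> may blow up like
  \<open>1 / t\<close>, as for \<open>\<phi> t = 1 + t\<close> on \<open>(0, 1)\<close>. The usual
  passage to a new top adds a small penalty in time and lets it tend to \<open>0\<close>. This
  perturbs the gradient of the test function, and if that gradient vanishes, only the limit of
  \<open>\<phi>\<close> at \<open>0\<close> from the right survives. The obstacle problem needs no
  limit in \<open>\<phi>\<close>: off the obstacles the heat equation gives the Pucci inequality
  with right-hand side \<open>0\<close>, and on them the separation \<open>b\<close> depends on time
  alone, so that gradients agree exactly. The price is that \<open>1\<close> must lie between the
  ellipticity constants.

  Straight segments suit the parabolic scaling: \<open>N\<close> steps of parabolic radius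
  \<open>\<rho> / sqrt N\<close> use up the time \<open>\<rho>\<^sup>2\<close> in total, so each
  step has the same normalized duration as the whole segment, while its normalized displacement in
  space shrinks by \<open>sqrt N\<close>. Every step thus lands in the same set
  \<open>A_minus_1 c\<close>.\<close>

lemma symmetric_matrix_inner:
  fixes M :: "real ^ 'n ^ 'n"
  assumes "transpose M = M"
  shows "(M *v x) \<bullet> y = x \<bullet> (M *v y)"
  by (metis assms dot_lmul_matrix transpose_matrix_vector)

section \<open>The spectral theorem for symmetric matrices\<close>

lemma quadratic_nonneg_linear_zero:
  fixes a c :: real
  assumes "\<And>t. 0 \<le> 2 * t * a + t\<^sup>2 * c"
  shows "a = 0"
proof (rule ccontr)
  assume "a \<noteq> 0"
  \<comment> \<open>At \<open>t = - a / k\<close> the quadratic equals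
    \<open>a\<^sup>2 * (c - 2 * k) / k\<^sup>2\<close>, which is negative for
    \<open>a \<noteq> 0\<close> as soon as \<open>k\<close> is positive and exceeds
    \<open>c / 2\<close>.\<close>
  define k where "k = \<bar>c\<bar> + 1"
  have k: "k > 0" "c - 2 * k < 0" by (auto simp: k_def)
  have "0 \<le> (2 * (- a / k) * a + (- a / k)\<^sup>2 * c) * k\<^sup>2"
    using assms[of "- a / k"] by simp
  also have "\<dots> = a\<^sup>2 * (c - 2 * k)"
    using k(1) by (simp add: field_simps power2_eq_square)
  finally show False
    using \<open>a \<noteq> 0\<close> k(2) by (simp add: zero_le_mult_iff)
qed

text \<open>Rayleigh quotient: \<open>v\<close> maximizes \<open>x \<bullet> f x\<close> on the unit
  sphere of \<open>S\<close>. The residual \<open>w = e *\<^sub>R v - f v\<close> lies in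
  \<open>S\<close> by invariance, and moving \<open>v\<close> along it yields a nonnegative
  quadratic with linear coefficient \<open>2 * (w \<bullet> w)\<close>, which must vanish.\<close>

lemma self_adjoint_eigenvector:
  fixes f :: "'a::euclidean_space \<Rightarrow> 'a"
  assumes lin: "linear f" and sym: "\<And>x y. f x \<bullet> y = x \<bullet> f y"
    and S: "subspace S" "f ` S \<subseteq> S" "S \<noteq> {0}"
  obtains v e where "v \<in> S" "norm v = 1" "f v = e *\<^sub>R v"
proof -
  let ?K = "S \<inter> sphere 0 1"
  obtain x where x: "x \<in> S" "x \<noteq> 0" using S subspace_0 by blast
  have "(1 / norm x) *\<^sub>R x \<in> ?K" using x S by (auto simp: subspace_scale)
  then have ne: "?K \<noteq> {}" by blast
  have "compact ?K" by (simp add: S(1) closed_Int_compact closed_subspace)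
  moreover have "continuous_on ?K (\<lambda>x. x \<bullet> f x)"
    by (intro continuous_intros linear_continuous_on linear_conv_bounded_linear[THEN iffD1] lin)
  ultimately obtain v where v: "v \<in> ?K" and vmax: "\<And>y. y \<in> ?K \<Longrightarrow> y \<bullet> f y \<le> v \<bullet> f v"
    using ne continuous_attains_sup by (metis (no_types, lifting))
  define e where "e = v \<bullet> f v"
  have le: "w \<bullet> f w \<le> e * (w \<bullet> w)" if "w \<in> S" for w
  proof (cases "w = 0")
    case False
    let ?y = "(1 / norm w) *\<^sub>R w"
    have "?y \<in> ?K" using False that S by (auto simp: subspace_scale)
    from vmax[OF this] have "(w \<bullet> f w) / (norm w)\<^sup>2 \<le> e"
      by (simp add: e_def linear_scale[OF lin] power2_eq_square)
    then show ?thesis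
      using False by (simp add: field_simps power2_norm_eq_inner)
  qed (simp add: lin linear_0)
  define w where "w = e *\<^sub>R v - f v"
  have vS: "v \<in> S" and nv: "v \<bullet> v = 1" using v by (auto simp: norm_eq_1)
  have wS: "w \<in> S" unfolding w_def using vS S by (auto intro!: subspace_diff subspace_scale)
  have "0 \<le> 2 * t * (w \<bullet> w) + t\<^sup>2 * (e * (w \<bullet> w) - w \<bullet> f w)" for t
  proof -
    have "v + t *\<^sub>R w \<in> S" using vS wS S by (auto intro!: subspace_add subspace_scale)
    from le[OF this]
    have "0 \<le> e * ((v + t *\<^sub>R w) \<bullet> (v + t *\<^sub>R w)) - (v + t *\<^sub>R w) \<bullet> f (v + t *\<^sub>R w)" by simp
    also have "\<dots> = 2 * t * ((e *\<^sub>R v - f v) \<bullet> w) + t\<^sup>2 * (e * (w \<bullet> w) - w \<bullet> f w)"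
      using nv sym[of v w]
      by (simp add: linear_add[OF lin] linear_scale[OF lin] inner_add_left inner_add_right
          inner_diff_left inner_commute algebra_simps power2_eq_square e_def)
    finally show ?thesis by (simp add: w_def)
  qed
  then have "w \<bullet> w = 0" by (rule quadratic_nonneg_linear_zero)
  then have "f v = e *\<^sub>R v" by (simp add: w_def)
  then show thesis using that vS v by auto
qed

text \<open>One eigenvector is split off. Self-adjointness makes its orthogonal complement in
  \<open>S\<close> invariant again, which is why the induction ranges over invariant
  subspaces.\<close>

lemma self_adjoint_eigenbasis:
  fixes f :: "'a::euclidean_space \<Rightarrow> 'a"
  assumes lin: "linear f" and sym: "\<And>x y. f x \<bullet> y = x \<bullet> f y"
  shows "subspace S \<Longrightarrow> f ` S \<subseteq> S \<Longrightarrow>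
    \<exists>B. B \<subseteq> S \<and> pairwise orthogonal B \<and> (\<forall>b\<in>B. norm b = 1) \<and> span B = S \<and> (\<forall>b\<in>B. \<exists>e. f b = e *\<^sub>R b)"
proof (induction "dim S" arbitrary: S rule: less_induct)
  case less
  show ?case
  proof (cases "S = {0}")
    case True
    then show ?thesis by (intro exI[of _ "{}"]) auto
  next
    case False
    obtain v e where v: "v \<in> S" "norm v = 1" "f v = e *\<^sub>R v"
      using self_adjoint_eigenvector[OF lin sym less.prems False] by blast
    define T where "T = {x \<in> S. x \<bullet> v = 0}"
    have T: "subspace T"
      using less.prems(1) by (auto simp: T_def subspace_def inner_add_left)
    have fT: "f ` T \<subseteq> T"
      using less.prems(2) v(3) sym by (auto simp: T_def)
    have "v \<notin> T" using v(2) by (auto simp: T_def)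
    then have "T \<subset> S" using v(1) unfolding T_def by blast
    then have "dim T < dim S"
      using T less.prems(1) by (metis dim_psubset span_eq_iff)
    then obtain B where B: "B \<subseteq> T" "pairwise orthogonal B" "\<forall>b\<in>B. norm b = 1" "span B = T"
      "\<forall>b\<in>B. \<exists>e. f b = e *\<^sub>R b"
      using less.hyps T fT by blast
    have "S \<subseteq> span (insert v B)"
    proof
      fix x assume x: "x \<in> S"
      have "x - (x \<bullet> v) *\<^sub>R v \<in> T"
        using x v less.prems(1)
        by (auto simp: T_def inner_diff_left norm_eq_1 intro!: subspace_diff subspace_scale)
      then have "x - (x \<bullet> v) *\<^sub>R v \<in> span (insert v B)"
        using B(4) span_mono[of B "insert v B"] by blast
      then have "(x - (x \<bullet> v) *\<^sub>R v) + (x \<bullet> v) *\<^sub>R v \<in> span (insert v B)"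
        by (rule span_add[OF _ span_scale[OF span_base]]) simp
      then show "x \<in> span (insert v B)" by (simp only: diff_add_cancel)
    qed
    moreover have "insert v B \<subseteq> S" using v(1) B(1) by (auto simp: T_def)
    ultimately have "span (insert v B) = S"
      using less.prems(1) by (simp add: span_minimal subset_antisym)
    moreover have "pairwise orthogonal (insert v B)"
      using B(1,2) by (auto simp: pairwise_insert T_def orthogonal_def inner_commute)
    ultimately show ?thesis
      using v B \<open>insert v B \<subseteq> S\<close> by (intro exI[of _ "insert v B"]) auto
  qed
qed

lemma trace_orthonormal_basis:
  fixes M :: "real ^ 'n ^ 'n"
  assumes B: "pairwise orthogonal B" "\<And>b. b \<in> B \<Longrightarrow> norm b = 1" "span B = UNIV" "finite B"
  shows "trace M = (\<Sum>b\<in>B. b \<bullet> (M *v b))"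
proof -
  have "trace M = (\<Sum>i\<in>UNIV. axis i 1 \<bullet> (M *v axis i 1))"
    by (simp add: trace_def matrix_vector_mult_basis inner_axis' column_def)
  also have "\<dots> = (\<Sum>i\<in>UNIV. (\<Sum>b\<in>B. (axis i 1 \<bullet> b) *\<^sub>R b) \<bullet> (M *v axis i 1))"
    using orthonormal_basis_expand[of B] B by simp
  also have "\<dots> = (\<Sum>i\<in>UNIV. \<Sum>b\<in>B. b $ i * (b \<bullet> (M *v axis i 1)))"
    by (simp add: inner_sum_left inner_axis')
  also have "\<dots> = (\<Sum>b\<in>B. \<Sum>i\<in>UNIV. b $ i * (b \<bullet> (M *v axis i 1)))"
    by (rule sum.swap)
  also have "\<dots> = (\<Sum>b\<in>B. b \<bullet> (M *v (\<Sum>i\<in>UNIV. b $ i *\<^sub>R axis i 1)))"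
    by (simp add: linear_sum[OF matrix_vector_mul_linear] inner_sum_right matrix_vector_mult_scaleR)
  also have "\<dots> = (\<Sum>b\<in>B. b \<bullet> (M *v b))"
    using basis_expansion[where 'a=real and 'n='n] unfolding scalar_mult_eq_scaleR by metis
  finally show ?thesis .
qed

text \<open>Eigenvectors to different eigenvalues are orthogonal, so each eigenspace is spanned by
  the members of an orthonormal eigenbasis that it contains. This regroups the trace into the form
  in which the Pucci operators are defined, a sum over the set of eigenvalues weighted by
  dimensions.\<close>

lemma symmetric_matrix_trace:
  fixes M :: "real ^ 'n ^ 'n"
  assumes M: "transpose M = M"
  shows "finite (eigenvalues M)"
    and "trace M = (\<Sum>e\<in>eigenvalues M. real (dim (eigenspace M e)) * e)"
proof -
  obtain B where B: "pairwise orthogonal B" "\<And>b. b \<in> B \<Longrightarrow> norm b = 1" "span B = UNIV"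
    and eb: "\<forall>b\<in>B. \<exists>e. M *v b = e *\<^sub>R b"
    using self_adjoint_eigenbasis[of "(*v) M" UNIV] symmetric_matrix_inner[OF M] by auto
  obtain lam where lam: "\<And>b. b \<in> B \<Longrightarrow> M *v b = lam b *\<^sub>R b" using eb by metis
  have nz: "0 \<notin> B" using B(2) by force
  have ind: "independent B" using B(1) nz pairwise_orthogonal_independent by blast
  have fin: "finite B" using ind by (simp add: independent_imp_finite)
  have expand: "(\<Sum>b\<in>B. (x \<bullet> b) *\<^sub>R b) = x" for x
    using orthonormal_basis_expand[of B x] B fin by simp
  have orth: "v \<bullet> b = 0" if "M *v v = e *\<^sub>R v" "b \<in> B" "lam b \<noteq> e" for v e b
  proof -
    have "e * (v \<bullet> b) = lam b * (v \<bullet> b)"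
      using symmetric_matrix_inner[OF M, of v b] that lam[of b] by simp
    then show ?thesis using that by simp
  qed
  have ev: "eigenvalues M = lam ` B"
  proof
    show "eigenvalues M \<subseteq> lam ` B"
    proof
      fix e assume "e \<in> eigenvalues M"
      then obtain v where v: "v \<noteq> 0" "M *v v = e *\<^sub>R v" by (auto simp: eigenvalues_def)
      then obtain b where "b \<in> B" "v \<bullet> b \<noteq> 0"
        using expand[of v] by (metis (no_types, lifting) scale_eq_0_iff sum.neutral)
      then show "e \<in> lam ` B" using orth[OF v(2)] by blast
    qed
    show "lam ` B \<subseteq> eigenvalues M"
    proof
      fix e assume "e \<in> lam ` B"
      then obtain b where "b \<in> B" "e = lam b" by blast
      then have "b \<noteq> 0" "M *v b = e *\<^sub>R b" using lam nz by auto
      then show "e \<in> eigenvalues M" unfolding eigenvalues_def by blast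
    qed
  qed
  show "finite (eigenvalues M)" using ev fin by simp
  have dim: "dim (eigenspace M e) = card {b \<in> B. lam b = e}" for e
  proof -
    have "eigenspace M e = span {b \<in> B. lam b = e}"
    proof
      show "eigenspace M e \<subseteq> span {b \<in> B. lam b = e}"
      proof
        fix v assume "v \<in> eigenspace M e"
        then have v: "M *v v = e *\<^sub>R v" by (simp add: eigenspace_def)
        have "v = (\<Sum>b\<in>B. (v \<bullet> b) *\<^sub>R b)" using expand by simp
        also have "\<dots> = (\<Sum>b\<in>{b \<in> B. lam b = e}. (v \<bullet> b) *\<^sub>R b)"
          using orth[OF v] fin by (intro sum.mono_neutral_right) auto
        also have "\<dots> \<in> span {b \<in> B. lam b = e}"
          by (intro span_sum span_scale span_base)
        finally show "v \<in> span {b \<in> B. lam b = e}" .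
      qed
      have "subspace (eigenspace M e)"
        by (auto simp: subspace_def eigenspace_def matrix_vector_right_distrib scaleR_right_distrib
            matrix_vector_mult_scaleR)
      then show "span {b \<in> B. lam b = e} \<subseteq> eigenspace M e"
        using lam by (intro span_minimal) (auto simp: eigenspace_def)
    qed
    moreover have "independent {b \<in> B. lam b = e}"
      using ind by (rule independent_mono) auto
    ultimately show ?thesis by (simp add: dim_eq_card_independent)
  qed
  have "trace M = (\<Sum>b\<in>B. lam b)"
    using trace_orthonormal_basis[OF B(1,2,3) fin, of M] lam B(2) by (simp add: norm_eq_1)
  also have "\<dots> = (\<Sum>e\<in>lam ` B. \<Sum>b\<in>{b \<in> B. lam b = e}. lam b)"
    by (rule sum.image_gen[OF fin])
  also have "\<dots> = (\<Sum>e\<in>eigenvalues M. real (dim (eigenspace M e)) * e)"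
    unfolding ev dim by (intro sum.cong refl) simp
  finally show "trace M = (\<Sum>e\<in>eigenvalues M. real (dim (eigenspace M e)) * e)" .
qed

section \<open>Homogeneity, duality and monotonicity of the Pucci operators\<close>

lemma eigenspace_scale:
  fixes M :: "real ^ 'n ^ 'n"
  assumes "c \<noteq> 0"
  shows "eigenspace (c *\<^sub>R M) (c * e) = eigenspace M e"
proof -
  have "c *\<^sub>R (M *v v) = (c * e) *\<^sub>R v \<longleftrightarrow> M *v v = e *\<^sub>R v" for v
    using assms by (metis scaleR_left_imp_eq scaleR_scaleR)
  then show ?thesis
    by (simp add: eigenspace_def scaleR_matrix_vector_assoc)
qed

lemma eigenvalues_scale:
  fixes M :: "real ^ 'n ^ 'n"
  assumes "c \<noteq> 0"
  shows "eigenvalues (c *\<^sub>R M) = (*) c ` eigenvalues M"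
proof -
  have eq: "e \<in> eigenvalues N \<longleftrightarrow> eigenspace N e - {0} \<noteq> {}" for e and N :: "real ^ 'n ^ 'n"
    by (auto simp: eigenvalues_def eigenspace_def)
  have "e \<in> eigenvalues (c *\<^sub>R M) \<longleftrightarrow> e / c \<in> eigenvalues M" for e
    using eigenspace_scale[OF assms, of M "e / c"] assms by (simp add: eq)
  moreover have "e / c \<in> eigenvalues M \<longleftrightarrow> e \<in> (*) c ` eigenvalues M" for e
    using assms by (auto simp: image_iff intro: bexI[of _ "e / c"])
  ultimately show ?thesis by blast
qed

lemma eigen_sum_scale:
  fixes M :: "real ^ 'n ^ 'n"
  assumes "c \<noteq> 0"
  shows "(\<Sum>e\<in>{e \<in> eigenvalues (c *\<^sub>R M). P e}. real (dim (eigenspace (c *\<^sub>R M) e)) * e) =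
    c * (\<Sum>e\<in>{e \<in> eigenvalues M. P (c * e)}. real (dim (eigenspace M e)) * e)"
proof -
  have eq: "{e \<in> eigenvalues (c *\<^sub>R M). P e} = (*) c ` {e \<in> eigenvalues M. P (c * e)}"
    unfolding eigenvalues_scale[OF assms] by blast
  have inj: "inj_on ((*) c) {e \<in> eigenvalues M. P (c * e)}"
    using assms by (auto simp: inj_on_def)
  show ?thesis
    unfolding eq sum.reindex[OF inj] o_def eigenspace_scale[OF assms] sum_distrib_left
    by (intro sum.cong refl) simp
qed

lemma pucci_minus_scale:
  assumes "c > 0"
  shows "pucci_minus l L (c *\<^sub>R M) = c * pucci_minus l L M"
proof -
  have "c * e > 0 \<longleftrightarrow> e > 0" "c * e < 0 \<longleftrightarrow> e < 0" for e
    using assms by (auto simp: zero_less_mult_iff mult_less_0_iff)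
  then have
    "(\<Sum>e\<in>{e \<in> eigenvalues (c *\<^sub>R M). e > 0}. real (dim (eigenspace (c *\<^sub>R M) e)) * e) =
      c * (\<Sum>e\<in>{e \<in> eigenvalues M. e > 0}. real (dim (eigenspace M e)) * e)"
    "(\<Sum>e\<in>{e \<in> eigenvalues (c *\<^sub>R M). e < 0}. real (dim (eigenspace (c *\<^sub>R M) e)) * e) =
      c * (\<Sum>e\<in>{e \<in> eigenvalues M. e < 0}. real (dim (eigenspace M e)) * e)"
    using eigen_sum_scale[of c M "\<lambda>e. e > 0"] eigen_sum_scale[of c M "\<lambda>e. e < 0"] assms by simp_all
  then show ?thesis unfolding pucci_minus_def by (simp only: distrib_left mult.left_commute)
qed

text \<open>This duality lets a subsolution \<open>u\<close> be treated as the supersolution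
  \<open>- u\<close>, so that most arguments are given for supersolutions only.\<close>

lemma pucci_plus_uminus: "pucci_plus l L M = - pucci_minus l L (- M)"
proof -
  have M: "- M = (- 1) *\<^sub>R M" by simp
  have
    "(\<Sum>e\<in>{e \<in> eigenvalues (- M). e > 0}. real (dim (eigenspace (- M) e)) * e) =
      - (\<Sum>e\<in>{e \<in> eigenvalues M. e < 0}. real (dim (eigenspace M e)) * e)"
    "(\<Sum>e\<in>{e \<in> eigenvalues (- M). e < 0}. real (dim (eigenspace (- M) e)) * e) =
      - (\<Sum>e\<in>{e \<in> eigenvalues M. e > 0}. real (dim (eigenspace M e)) * e)"
    unfolding M
    using eigen_sum_scale[of "-1" M "\<lambda>e. e > 0"] eigen_sum_scale[of "-1" M "\<lambda>e. e < 0"] by simp_all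
  then show ?thesis unfolding pucci_plus_def pucci_minus_def by simp
qed

lemma pucci_minus_mono:
  assumes "l' \<le> l" "L \<le> L'"
  shows "pucci_minus l' L' M \<le> pucci_minus l L M"
proof -
  have "0 \<le> (\<Sum>e\<in>{e \<in> eigenvalues M. e > 0}. real (dim (eigenspace M e)) * e)"
    by (intro sum_nonneg) auto
  moreover have "(\<Sum>e\<in>{e \<in> eigenvalues M. e < 0}. real (dim (eigenspace M e)) * e) \<le> 0"
    by (intro sum_nonpos) (auto simp: mult_le_0_iff)
  ultimately show ?thesis
    unfolding pucci_minus_def using assms
    by (intro add_mono mult_right_mono mult_right_mono_neg)
qed

text \<open>With both weights equal to \<open>1\<close> the Pucci operator is the trace; a smaller
  weight on positive eigenvalues and a larger one on negative eigenvalues decreases it. This is how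
  the heat equation yields the Pucci inequalities.\<close>

lemma pucci_minus_le_trace:
  assumes "transpose M = M" "l \<le> 1" "1 \<le> L"
  shows "pucci_minus l L M \<le> trace M"
proof -
  let ?g = "\<lambda>e. real (dim (eigenspace M e)) * e"
  have "pucci_minus l L M \<le> pucci_minus 1 1 M"
    using assms by (intro pucci_minus_mono)
  also have "\<dots> = sum ?g ({e \<in> eigenvalues M. e > 0} \<union> {e \<in> eigenvalues M. e < 0})"
    unfolding pucci_minus_def using symmetric_matrix_trace(1)[OF assms(1)]
    by (subst sum.union_disjoint) auto
  also have "\<dots> = sum ?g (eigenvalues M)"
    using symmetric_matrix_trace(1)[OF assms(1)] by (intro sum.mono_neutral_left) auto
  finally show ?thesis using symmetric_matrix_trace(2)[OF assms(1)] by simp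
qed

section \<open>The nonlinearity\<close>

text \<open>A Lipschitz bound centred at a single point. It holds at points of differentiability,
  survives differences, products and compositions, and suffices for null sets to have null
  images.\<close>

definition calm_at :: "(real \<Rightarrow> real) \<Rightarrow> real \<Rightarrow> bool" where
  "calm_at f t \<longleftrightarrow> (\<exists>B. \<forall>\<^sub>F s in nhds t. \<bar>f s - f t\<bar> \<le> B * \<bar>s - t\<bar>)"

lemma calm_atI: "(\<forall>\<^sub>F s in at t. \<bar>f s - f t\<bar> \<le> B * \<bar>s - t\<bar>) \<Longrightarrow> calm_at f t"
  unfolding calm_at_def eventually_at_filter by (auto elim!: eventually_mono)

lemma calm_at_isCont: "calm_at f t \<Longrightarrow> isCont f t"
proof -
  assume "calm_at f t"
  then obtain B where B: "\<forall>\<^sub>F s in at t. \<bar>f s - f t\<bar> \<le> B * \<bar>s - t\<bar>"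
    unfolding calm_at_def eventually_nhds_conv_at by auto
  have "((\<lambda>s. B * \<bar>s - t\<bar>) \<longlongrightarrow> B * \<bar>t - t\<bar>) (at t)" by (intro tendsto_intros)
  then have "((\<lambda>s. B * \<bar>s - t\<bar>) \<longlongrightarrow> 0) (at t)" by simp
  then have "((\<lambda>s. f s - f t) \<longlongrightarrow> 0) (at t)"
    by (rule Lim_null_comparison[rotated]) (use B in simp)
  then show "isCont f t" unfolding isCont_def using LIM_zero_iff by blast
qed

lemma calm_at_DERIV:
  assumes "DERIV f t :> D"
  shows "calm_at f t"
proof (rule calm_atI)
  have "((\<lambda>s. \<bar>(f s - f t) / (s - t)\<bar>) \<longlongrightarrow> \<bar>D\<bar>) (at t)"
    using assms unfolding has_field_derivative_iff by (rule tendsto_rabs)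
  then have "\<forall>\<^sub>F s in at t. \<bar>(f s - f t) / (s - t)\<bar> < \<bar>D\<bar> + 1"
    by (rule order_tendstoD) simp
  moreover have "\<forall>\<^sub>F s in at t. s \<noteq> t" by (simp add: eventually_at_filter)
  ultimately show "\<forall>\<^sub>F s in at t. \<bar>f s - f t\<bar> \<le> (\<bar>D\<bar> + 1) * \<bar>s - t\<bar>"
    by eventually_elim (simp add: abs_divide field_simps)
qed

lemma calm_at_diff:
  assumes "calm_at f t" "calm_at g t"
  shows "calm_at (\<lambda>s. f s - g s) t"
proof -
  obtain B C where "\<forall>\<^sub>F s in nhds t. \<bar>f s - f t\<bar> \<le> B * \<bar>s - t\<bar>"
    "\<forall>\<^sub>F s in nhds t. \<bar>g s - g t\<bar> \<le> C * \<bar>s - t\<bar>"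
    using assms unfolding calm_at_def by blast
  then have "\<forall>\<^sub>F s in nhds t. \<bar>(f s - g s) - (f t - g t)\<bar> \<le> (B + C) * \<bar>s - t\<bar>"
    by eventually_elim (auto simp: distrib_right)
  then show ?thesis unfolding calm_at_def by blast
qed

lemma calm_at_mult:
  assumes "calm_at f t" "calm_at g t"
  shows "calm_at (\<lambda>s. f s * g s) t"
proof -
  obtain B C where B: "\<forall>\<^sub>F s in nhds t. \<bar>f s - f t\<bar> \<le> B * \<bar>s - t\<bar>"
    and C: "\<forall>\<^sub>F s in nhds t. \<bar>g s - g t\<bar> \<le> C * \<bar>s - t\<bar>"
    using assms unfolding calm_at_def by blast
  have "((\<lambda>s. \<bar>f s\<bar>) \<longlongrightarrow> \<bar>f t\<bar>) (nhds t)"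
    using calm_at_isCont[OF assms(1)] unfolding isCont_def
    by (intro tendsto_rabs) (simp add: tendsto_at_iff_tendsto_nhds)
  then have "\<forall>\<^sub>F s in nhds t. \<bar>f s\<bar> < \<bar>f t\<bar> + 1" by (rule order_tendstoD) simp
  then have "\<forall>\<^sub>F s in nhds t. \<bar>f s * g s - f t * g t\<bar> \<le> ((\<bar>f t\<bar> + 1) * C + \<bar>g t\<bar> * B) * \<bar>s - t\<bar>"
    using B C
  proof eventually_elim
    case (elim s)
    have "f s * g s - f t * g t = f s * (g s - g t) + g t * (f s - f t)" by (simp add: algebra_simps)
    then have "\<bar>f s * g s - f t * g t\<bar> \<le> \<bar>f s\<bar> * \<bar>g s - g t\<bar> + \<bar>g t\<bar> * \<bar>f s - f t\<bar>"
      by (metis abs_mult abs_triangle_ineq)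
    also have "\<dots> \<le> (\<bar>f t\<bar> + 1) * (C * \<bar>s - t\<bar>) + \<bar>g t\<bar> * (B * \<bar>s - t\<bar>)"
      using elim by (intro add_mono mult_mono) auto
    finally show ?case by (simp add: algebra_simps)
  qed
  then show ?thesis unfolding calm_at_def by blast
qed

lemma calm_at_comp:
  assumes g: "calm_at g t" and f: "calm_at f (g t)"
  shows "calm_at (\<lambda>s. f (g s)) t"
proof -
  obtain B C where B: "\<forall>\<^sub>F s in nhds t. \<bar>g s - g t\<bar> \<le> B * \<bar>s - t\<bar>"
    and C: "\<forall>\<^sub>F y in nhds (g t). \<bar>f y - f (g t)\<bar> \<le> C * \<bar>y - g t\<bar>"
    using assms unfolding calm_at_def by blast
  have "(g \<longlongrightarrow> g t) (nhds t)"
    using calm_at_isCont[OF g] by (simp add: isCont_def tendsto_at_iff_tendsto_nhds)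
  then have "\<forall>\<^sub>F s in nhds t. \<bar>f (g s) - f (g t)\<bar> \<le> C * \<bar>g s - g t\<bar>"
    using C unfolding filterlim_iff by blast
  then have "\<forall>\<^sub>F s in nhds t. \<bar>f (g s) - f (g t)\<bar> \<le> (\<bar>C\<bar> * B) * \<bar>s - t\<bar>"
    using B
  proof eventually_elim
    case (elim s)
    have "\<bar>f (g s) - f (g t)\<bar> \<le> \<bar>C\<bar> * \<bar>g s - g t\<bar>"
      using elim(1) by (meson abs_ge_self abs_ge_zero mult_right_mono order_trans)
    also have "\<dots> \<le> \<bar>C\<bar> * (B * \<bar>s - t\<bar>)" using elim(2) by (intro mult_left_mono) auto
    finally show ?case by simp
  qed
  then show ?thesis unfolding calm_at_def by blast
qed

text \<open>Each value strictly between \<open>H a\<close> and \<open>H b\<close> would be taken for the last time at a point of the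
  null set \<open>N\<close>; but calm functions map null sets to null sets.\<close>

lemma nonincreasing_if_derivative_neg_ae:
  fixes H :: "real \<Rightarrow> real"
  assumes ab: "a \<le> b" and calm: "\<And>t. t \<in> {a..b} \<Longrightarrow> calm_at H t"
    and N: "negligible N"
    and D: "\<And>t. t \<in> {a<..<b} - N \<Longrightarrow> \<exists>D<0. DERIV H t :> D"
  shows "H b \<le> H a"
proof (rule ccontr)
  assume "\<not> H b \<le> H a"
  then have lt: "H a < H b" by simp
  have cont: "continuous_on {a..b} H"
    by (intro continuous_at_imp_continuous_on ballI calm_at_isCont calm)
  have "{H a<..<H b} \<subseteq> H ` (N \<inter> {a..b})"
  proof
    fix y assume y: "y \<in> {H a<..<H b}"
    define K where "K = {t \<in> {a..b}. H t \<le> y}"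
    have aK: "a \<in> K" using ab y by (simp add: K_def)
    have "closed K"
      unfolding K_def by (intro continuous_closed_preimage_constant continuous_on_closed_Collect_le cont continuous_on_const closed_atLeastAtMost)
    moreover have bdd: "bdd_above K" by (auto simp: K_def intro: bdd_aboveI[of _ b])
    ultimately have SK: "Sup K \<in> K" using aK closed_contains_Sup by blast
    define t where "t = Sup K"
    have t: "t \<in> {a..b}" "H t \<le> y" using SK by (auto simp: K_def t_def)
    have last: "s \<le> t" if "s \<in> {a..b}" "H s \<le> y" for s
      unfolding t_def using that bdd by (intro cSup_upper) (auto simp: K_def)
    have "continuous_on {t..b} H" using cont by (rule continuous_on_subset) (use t in auto)
    then obtain s where "t \<le> s" "s \<le> b" "H s = y"
      using IVT'[of H t y b] t y by auto
    then have "H t = y" using last[of s] t by auto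
    have tb: "a < t" "t < b" using \<open>H t = y\<close> y t by (auto simp: less_le)
    \<comment> \<open>A negative derivative would push \<open>H\<close> below \<open>y\<close> just
      after \<open>t\<close>, although \<open>t\<close> is the last point of the interval with
      \<open>H t \<le> y\<close>.\<close>
    have "t \<in> N"
    proof (rule ccontr)
      assume "t \<notin> N"
      then obtain D where "D < 0" "DERIV H t :> D" using D tb by force
      then obtain d where d: "d > 0" "\<And>h. 0 < h \<Longrightarrow> h < d \<Longrightarrow> H (t + h) < H t"
        using DERIV_neg_dec_right by blast
      define h where "h = min (d / 2) (b - t)"
      have "0 < h" "h < d" "t + h \<le> b" using d(1) tb by (auto simp: h_def)
      then show False using last[of "t + h"] d(2)[of h] \<open>H t = y\<close> tb by auto
    qed
    then show "y \<in> H ` (N \<inter> {a..b})" using \<open>H t = y\<close> t by blast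
  qed
  moreover have "negligible (H ` (N \<inter> {a..b}))"
  proof (rule negligible_locally_Lipschitz_image)
    show "negligible (N \<inter> {a..b})" using N negligible_subset by blast
    fix t assume "t \<in> N \<inter> {a..b}"
    then obtain B T where "open T" "t \<in> T" "\<forall>s\<in>T. \<bar>H s - H t\<bar> \<le> B * \<bar>s - t\<bar>"
      using calm[of t] unfolding calm_at_def eventually_nhds by blast
    then show "\<exists>T B. open T \<and> t \<in> T \<and> (\<forall>y\<in>(N \<inter> {a..b}) \<inter> T. norm (H y - H t) \<le> B * norm (y - t))"
      by (intro exI[of _ T] exI[of _ B]) auto
  qed simp
  ultimately have "negligible {H a<..<H b}" using negligible_subset by blast
  then show False using lt negligible_interval(2)[of "H a" "H b"] by simp
qed

text \<open>By (P2), the derivative of \<open>(ln \<eta>)\<^sup>2\<close> with respect to \<open>ln t\<close> tends to \<open>0\<close>; the bound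
  \<open>2\<close> is enough to compare \<open>\<eta>(t \<eta>(t))\<close> with \<open>\<eta>(t)\<close>.\<close>

lemma nonlinearity_growth:
  assumes "nonlinearity \<phi>"
  obtains \<eta> \<Lambda> T where "\<And>t. t \<ge> 0 \<Longrightarrow> \<phi> t = \<eta> t * t" "\<And>t. t > 0 \<Longrightarrow> 1 \<le> \<eta> t"
    "antimono_on {0<..<1} \<eta>" "mono_on {1..} \<eta>"
    "\<Lambda> \<ge> 1" "\<And>s t. s > 0 \<Longrightarrow> t > 0 \<Longrightarrow> \<eta> (s * t) \<le> \<Lambda> * \<eta> s * \<eta> t"
    "T \<ge> 1" "\<And>s t. T \<le> s \<Longrightarrow> s \<le> t \<Longrightarrow> (ln (\<eta> t))\<^sup>2 - (ln (\<eta> s))\<^sup>2 \<le> 2 * (ln t - ln s)"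
proof -
  from assms obtain \<eta> where
    eta: "\<forall>t\<ge>0. \<phi> t = \<eta> t * t" and
    lip: "\<forall>t>0. \<exists>r>0. \<exists>L. L-lipschitz_on (ball t r \<inter> {0<..}) \<phi>" and
    ge1: "\<forall>t>0. 1 \<le> \<eta> t" and mon: "antimono_on {0<..<1} \<eta>" "mono_on {1..} \<eta>" and
    P2: "\<exists>N. negligible N \<and> (\<forall>t. t > 0 \<and> t \<notin> N \<longrightarrow> \<eta> differentiable (at t)) \<and>
        ((\<lambda>t. t * deriv \<eta> t / \<eta> t * ln (\<eta> t)) \<longlongrightarrow> 0) (inf at_top (principal (- N)))" and
    P3: "\<exists>\<Lambda>0. \<forall>s>0. \<forall>t>0. \<eta> (s * t) \<le> \<Lambda>0 * \<eta> s * \<eta> t"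
    unfolding nonlinearity_def by (elim exE) (rule that; elim conjE; assumption)
  note eta = eta[rule_format] and lip = lip[rule_format] and ge1 = ge1[rule_format]
  obtain N where N: "negligible N" and diff: "\<And>t. t > 0 \<Longrightarrow> t \<notin> N \<Longrightarrow> \<eta> differentiable (at t)"
    and lim: "((\<lambda>t. t * deriv \<eta> t / \<eta> t * ln (\<eta> t)) \<longlongrightarrow> 0) (inf at_top (principal (- N)))"
    using P2 by (elim exE conjE) simp
  obtain \<Lambda>0 where L0: "\<And>s t. s > 0 \<Longrightarrow> t > 0 \<Longrightarrow> \<eta> (s * t) \<le> \<Lambda>0 * \<eta> s * \<eta> t"
    using P3 by auto
  have "\<forall>\<^sub>F t in inf at_top (principal (- N)). t * deriv \<eta> t / \<eta> t * ln (\<eta> t) < 1"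
    using order_tendstoD(2)[OF lim, of 1] by simp
  then obtain T0 where T0: "\<And>t. t \<ge> T0 \<Longrightarrow> t \<notin> N \<Longrightarrow> t * deriv \<eta> t / \<eta> t * ln (\<eta> t) < 1"
    unfolding eventually_inf_principal eventually_at_top_linorder by auto
  define T where "T = max T0 1"
  \<comment> \<open>The Lipschitz assumption concerns \<open>\<phi>\<close>; it passes to
    \<open>\<eta>\<close> because \<open>\<eta> s = \<phi> s * inverse s\<close> near a positive
    \<open>t\<close>.\<close>
  have calm_eta: "calm_at \<eta> t" if pos: "t > 0" for t
  proof -
    obtain r L where r: "r > 0" "L-lipschitz_on (ball t r \<inter> {0<..}) \<phi>" using lip[OF pos] by blast
    have "\<forall>\<^sub>F s in nhds t. s \<in> ball t r \<inter> {0<..}"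
      using that r(1) by (intro eventually_nhds_in_open) auto
    then have "\<forall>\<^sub>F s in nhds t. \<bar>\<phi> s - \<phi> t\<bar> \<le> L * \<bar>s - t\<bar>"
      by eventually_elim (use r that lipschitz_onD[OF r(2)] in \<open>auto simp: dist_real_def\<close>)
    then have "calm_at \<phi> t" unfolding calm_at_def by blast
    moreover have "calm_at inverse t"
      using that by (intro calm_at_DERIV[OF DERIV_inverse]) auto
    ultimately have "calm_at (\<lambda>s. \<phi> s * inverse s) t" by (rule calm_at_mult)
    then obtain B where B: "\<forall>\<^sub>F s in nhds t. \<bar>\<phi> s * inverse s - \<phi> t * inverse t\<bar> \<le> B * \<bar>s - t\<bar>"
      unfolding calm_at_def by blast
    have "\<forall>\<^sub>F s in nhds t. s \<in> {0<..}" using that by (intro eventually_nhds_in_open) auto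
    with B have "\<forall>\<^sub>F s in nhds t. \<bar>\<eta> s - \<eta> t\<bar> \<le> B * \<bar>s - t\<bar>"
      by eventually_elim (use that eta in \<open>simp add: field_simps\<close>)
    then show ?thesis unfolding calm_at_def by blast
  qed
  have growth: "(ln (\<eta> t))\<^sup>2 - (ln (\<eta> s))\<^sup>2 \<le> 2 * (ln t - ln s)" if st: "T \<le> s" "s \<le> t" for s t
  proof -
    \<comment> \<open>Off \<open>N\<close>, the derivative of \<open>H\<close> is
      \<open>2 / x * (x * deriv \<eta> x / \<eta> x * ln (\<eta> x) - 1)\<close>, which is negative
      beyond \<open>T0\<close>.\<close>
    define H where "H = (\<lambda>t. (ln (\<eta> t))\<^sup>2 - 2 * ln t)"
    have "H t \<le> H s"
    proof (rule nonincreasing_if_derivative_neg_ae[OF st(2) _ N])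
      fix x assume "x \<in> {s..t}"
      then have x: "x > 0" using st by (auto simp: T_def)
      have "DERIV (\<lambda>y. (ln y)\<^sup>2) (\<eta> x) :> 2 * ln (\<eta> x) * (1 / \<eta> x)"
        using ge1[OF x] by (auto intro!: derivative_eq_intros)
      then have "calm_at (\<lambda>s. (ln (\<eta> s))\<^sup>2) x"
        using calm_at_comp[OF calm_eta[OF x]] calm_at_DERIV by blast
      moreover have "calm_at (\<lambda>s. 2 * ln s) x"
        by (rule calm_at_DERIV) (auto intro!: derivative_eq_intros simp: x)
      ultimately show "calm_at H x" unfolding H_def by (rule calm_at_diff)
    next
      fix x assume "x \<in> {s<..<t} - N"
      then have x: "x > 0" "x \<ge> T0" "x \<notin> N" using st by (auto simp: T_def)
      have "DERIV \<eta> x :> deriv \<eta> x"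
        using diff[OF x(1,3)] by (simp add: DERIV_deriv_iff_real_differentiable)
      then have "DERIV H x :> 2 * ln (\<eta> x) * (deriv \<eta> x / \<eta> x) - 2 / x"
        unfolding H_def using x ge1[OF x(1)] by (auto intro!: derivative_eq_intros)
      moreover have "2 * ln (\<eta> x) * (deriv \<eta> x / \<eta> x) - 2 / x = 2 / x * (x * deriv \<eta> x / \<eta> x * ln (\<eta> x) - 1)"
        using x ge1[OF x(1)] by (simp add: field_simps)
      moreover have "\<dots> < 0" using T0[OF x(2,3)] x by (intro mult_pos_neg) auto
      ultimately show "\<exists>D<0. DERIV H x :> D" by metis
    qed
    then show ?thesis by (simp add: H_def)
  qed
  have L1: "\<eta> (s * t) \<le> max \<Lambda>0 1 * \<eta> s * \<eta> t" if "s > 0" "t > 0" for s t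
  proof -
    have "\<Lambda>0 * (\<eta> s * \<eta> t) \<le> max \<Lambda>0 1 * (\<eta> s * \<eta> t)"
      using ge1[OF that(1)] ge1[OF that(2)] by (intro mult_right_mono) auto
    then show ?thesis using L0[OF that] by (simp add: mult.assoc)
  qed
  show thesis
    by (rule that[of \<eta> "max \<Lambda>0 1" T]) (use eta ge1 mon L1 growth in \<open>simp_all add: T_def\<close>)
qed


text \<open>The growth bound makes \<open>ln (\<eta> t)\<close> of order at most
  \<open>sqrt (ln t)\<close>, so \<open>\<eta>\<close> grows more slowly than every positive power
  of \<open>t\<close>. The square of \<open>ln (\<eta> t) - 4\<close> turns this into
  \<open>ln (\<eta> t) \<le> ln t / 4\<close> up to a constant, more than the decay
  \<open>t powr (- 1 / 2)\<close> requires.\<close>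

lemma eta_over_id_small:
  fixes \<eta> :: "real \<Rightarrow> real"
  assumes ge1: "\<And>t. t > 0 \<Longrightarrow> 1 \<le> \<eta> t" and T: "T \<ge> 1"
    and growth: "\<And>s t. T \<le> s \<Longrightarrow> s \<le> t \<Longrightarrow> (ln (\<eta> t))\<^sup>2 - (ln (\<eta> s))\<^sup>2 \<le> 2 * (ln t - ln s)"
  shows "((\<lambda>t. \<eta> t / t) \<longlongrightarrow> 0) at_top"
proof -
  define K where "K = (ln (\<eta> T))\<^sup>2 + 4"
  have le: "\<eta> t / t \<le> exp K * t powr (- 1 / 2)" if "t \<ge> T" for t
  proof -
    have t: "t > 0" "\<eta> t > 0" using that T ge1[of t] by auto
    have "(ln (\<eta> t))\<^sup>2 \<le> (ln (\<eta> T))\<^sup>2 + 2 * (ln t - ln T)" using growth[of T t] that by simp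
    moreover have "ln T \<ge> 0" using T by simp
    moreover have "0 \<le> (ln (\<eta> t) - 4)\<^sup>2" by simp
    ultimately have "8 * ln (\<eta> t) \<le> (ln (\<eta> T))\<^sup>2 + 2 * ln t + 16"
      by (simp add: power2_eq_square algebra_simps)
    moreover have "0 \<le> (ln (\<eta> T))\<^sup>2" "ln t \<ge> 0" using that T by auto
    ultimately have "ln (\<eta> t) - ln t \<le> K - ln t / 2" unfolding K_def by linarith
    then have "exp (ln (\<eta> t) - ln t) \<le> exp (K - ln t / 2)" by simp
    moreover have "exp (K - ln t / 2) = exp K * t powr (- 1 / 2)"
      using t by (simp add: powr_def flip: exp_add)
    ultimately show ?thesis using t by (simp add: exp_diff)
  qed
  have "((\<lambda>t. exp K * t powr (- 1 / 2)) \<longlongrightarrow> 0) at_top"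
    by (intro tendsto_mult_right_zero tendsto_neg_powr filterlim_ident) simp
  then show ?thesis
  proof (rule tendsto_sandwich[of "\<lambda>_. 0", rotated 3])
    show "\<forall>\<^sub>F t in at_top. \<eta> t / t \<le> exp K * t powr (- 1 / 2)"
      using eventually_ge_at_top[of T] by eventually_elim (rule le)
    show "\<forall>\<^sub>F t in at_top. 0 \<le> \<eta> t / t"
      using eventually_gt_at_top[of 0] by eventually_elim (use ge1 in \<open>force intro!: divide_nonneg_pos\<close>)
  qed simp
qed

text \<open>This makes the bound on \<rho> usable, with a constant independent of \<open>m\<close>.
  For \<open>s = 1 / r\<close>, which is at least \<open>C * (\<eta> m + 1)\<close>, the quotient
  \<open>\<eta> (m * s) / s\<close> has to be small. If \<open>m < 1\<close>, monotonicity compares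
  \<open>\<eta> (m * s)\<close> with \<open>\<eta> m\<close> or \<open>\<eta> s\<close>, according
  to the side of \<open>1\<close> on which \<open>m * s\<close> lies. If \<open>m \<ge> 1\<close>,
  write \<open>s = \<eta> m * q\<close>: (P3) and the bound
  \<open>\<eta> (m * \<eta> m) \<le> K * \<eta> m\<close> let the factor \<open>\<eta> m\<close>
  cancel, and \<open>\<eta> q / q\<close> is small.\<close>

lemma nonlinearity_small_scale:
  fixes \<eta> :: "real \<Rightarrow> real"
  assumes ge1: "\<And>t. t > 0 \<Longrightarrow> 1 \<le> \<eta> t"
    and anti: "antimono_on {0<..<1} \<eta>" and mon: "mono_on {1..} \<eta>"
    and L: "\<Lambda> \<ge> 1" "\<And>s t. s > 0 \<Longrightarrow> t > 0 \<Longrightarrow> \<eta> (s * t) \<le> \<Lambda> * \<eta> s * \<eta> t"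
    and T: "T \<ge> 1"
    and growth: "\<And>s t. T \<le> s \<Longrightarrow> s \<le> t \<Longrightarrow> (ln (\<eta> t))\<^sup>2 - (ln (\<eta> s))\<^sup>2 \<le> 2 * (ln t - ln s)"
    and eps: "\<epsilon> > 0"
  obtains C where "C > 0" "\<And>m r. m > 0 \<Longrightarrow> r > 0 \<Longrightarrow> r \<le> 1 / (C * (\<eta> m + 1)) \<Longrightarrow> r * \<eta> (m / r) \<le> \<epsilon>"
proof -
  \<comment> \<open>The entry \<open>exp 1\<close> comes from \<open>(ln (\<eta> t))\<^sup>2 + 2 *
    ln (\<eta> t) \<le> (ln (\<eta> t) + 1)\<^sup>2\<close> for \<open>t \<ge> T\<close>; the other
    one covers \<open>1 \<le> t < T\<close> by monotonicity.\<close>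
  define K where "K = max (exp 1) (\<eta> (T * \<eta> T))"
  have self: "\<eta> (t * \<eta> t) \<le> K * \<eta> t" if "t \<ge> 1" for t
  proof (cases "t \<ge> T")
    case True
    have t: "t > 0" "\<eta> t \<ge> 1" using that ge1[of t] by auto
    have tt: "t \<le> t * \<eta> t" "t * \<eta> t > 0" using t by auto
    have "(ln (\<eta> (t * \<eta> t)))\<^sup>2 \<le> (ln (\<eta> t))\<^sup>2 + 2 * ln (\<eta> t)"
      using growth[OF True tt(1)] t by (simp add: ln_mult)
    also have "\<dots> \<le> (ln (\<eta> t) + 1)\<^sup>2" by (simp add: power2_eq_square algebra_simps)
    finally have "ln (\<eta> (t * \<eta> t)) \<le> ln (\<eta> t) + 1"
      by (rule power2_le_imp_le) (use t in simp)
    then have "exp (ln (\<eta> (t * \<eta> t))) \<le> exp (ln (\<eta> t) + 1)" by simp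
    then have "\<eta> (t * \<eta> t) \<le> exp 1 * \<eta> t"
      using ge1[OF tt(2)] t by (simp add: exp_add mult.commute)
    also have "\<dots> \<le> K * \<eta> t" using t by (intro mult_right_mono) (auto simp: K_def)
    finally show ?thesis .
  next
    case False
    have t: "t > 0" "\<eta> t \<ge> 1" using that ge1[of t] by auto
    have "\<eta> t \<le> \<eta> T" using mon False that by (auto simp: mono_on_def)
    then have "t * \<eta> t \<le> T * \<eta> T" using False t by (intro mult_mono) auto
    moreover have "1 \<le> t * \<eta> t" using that t mult_mono[of 1 t 1 "\<eta> t"] by simp
    ultimately have "\<eta> (t * \<eta> t) \<le> \<eta> (T * \<eta> T)" using mon by (auto simp: mono_on_def)
    also have "\<dots> \<le> K * 1" by (simp add: K_def)
    also have "\<dots> \<le> K * \<eta> t" using t by (intro mult_left_mono) (auto simp: K_def le_max_iff_disj)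
    finally show ?thesis .
  qed
  have K1: "K \<ge> 1" using exp_ge_add_one_self[of 1] by (simp add: K_def le_max_iff_disj)
  define e where "e = \<epsilon> / (\<Lambda> * K)"
  have LK: "\<Lambda> * K \<ge> 1" using L(1) K1 mult_mono[of 1 \<Lambda> 1 K] by simp
  have e: "e > 0" "e \<le> \<epsilon>" using eps LK by (auto simp: e_def field_simps)
  have "\<forall>\<^sub>F t in at_top. \<eta> t / t < e"
    using eta_over_id_small[OF ge1 T growth] e(1) by (rule order_tendstoD(2))
  then obtain S where S: "\<And>t. t \<ge> S \<Longrightarrow> \<eta> t / t < e" unfolding eventually_at_top_linorder by auto
  \<comment> \<open>Beyond \<open>S\<close> the quotient \<open>\<eta> t / t\<close> is below
    \<open>e\<close>; the entry \<open>1\<close> gives \<open>s \<ge> 1\<close>; and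
    \<open>1 / \<epsilon>\<close> serves the case \<open>m * s < 1\<close>, where only
    \<open>\<eta> m \<le> s / C\<close> is available.\<close>
  define C where "C = Max {S, 1, 1 / \<epsilon>}"
  have C: "C \<ge> S" "C \<ge> 1" "C \<ge> 1 / \<epsilon>" by (auto simp: C_def)
  show thesis
  proof (rule that[of C])
    show "C > 0" using C by simp
    fix m r :: real assume m: "m > 0" and r: "r > 0" "r \<le> 1 / (C * (\<eta> m + 1))"
    define s where "s = 1 / r"
    have em: "\<eta> m \<ge> 1" using ge1[OF m] .
    have Ce: "0 < C * (\<eta> m + 1)" using C em by simp
    have "C * (\<eta> m + 1) \<le> s"
      unfolding s_def using r Ce by (simp add: field_simps)
    moreover have "C * \<eta> m \<ge> C" using C em by simp
    moreover have "C * (\<eta> m + 1) = C * \<eta> m + C" by (simp add: distrib_left)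
    ultimately have s: "C * \<eta> m \<le> s" "C \<le> s" "1 \<le> s" "s > 0" using C by linarith+
    have "\<eta> (m * s) / s \<le> \<epsilon>"
    proof (cases "m < 1")
      case True
      show ?thesis
      proof (cases "m * s < 1")
        case ms: True
        have "m \<le> m * s" using m s by simp
        then have "\<eta> (m * s) \<le> \<eta> m" using anti m ms True s by (auto simp: monotone_on_def)
        then have "\<eta> (m * s) / s \<le> \<eta> m / s" using s by (simp add: divide_right_mono)
        also have "\<dots> \<le> 1 / C" using s(1,4) C by (simp add: field_simps)
        also have "\<dots> \<le> \<epsilon>" using C eps by (simp add: field_simps)
        finally show ?thesis .
      next
        case False
        have "m * s \<le> s" using True s by simp
        then have "\<eta> (m * s) \<le> \<eta> s" using mon False s by (auto simp: mono_on_def)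
        then have "\<eta> (m * s) / s \<le> \<eta> s / s" using s by (simp add: divide_right_mono)
        also have "\<dots> < e" using S[of s] C s by simp
        finally show ?thesis using e by simp
      qed
    next
      case False
      define q where "q = s / \<eta> m"
      have q: "q \<ge> C" "q > 0" "s = \<eta> m * q" using s em C by (auto simp: q_def field_simps)
      have "\<eta> (m * s) = \<eta> ((m * \<eta> m) * q)" by (simp add: q mult_ac)
      also have "\<dots> \<le> \<Lambda> * \<eta> (m * \<eta> m) * \<eta> q" using m em q by (intro L) auto
      also have "\<dots> \<le> \<Lambda> * (K * \<eta> m) * \<eta> q"
        using self[of m] False L(1) ge1[OF q(2)] by (intro mult_right_mono mult_left_mono) auto
      finally have "\<eta> (m * s) / s \<le> \<Lambda> * (K * \<eta> m) * \<eta> q / s" using s by (simp add: divide_right_mono)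
      also have "\<dots> = \<Lambda> * K * (\<eta> q / q)" using q em by simp
      also have "\<dots> \<le> \<Lambda> * K * e" using S[of q] q C LK by (intro mult_left_mono) auto
      also have "\<dots> = \<epsilon>" using L(1) K1 by (simp add: e_def)
      finally show ?thesis .
    qed
    then show "r * \<eta> (m / r) \<le> \<epsilon>" by (simp add: s_def mult.commute)
  qed
qed

section \<open>Twice differentiable test functions\<close>

text \<open>\<open>C2_on\<close> with its derivatives exposed, so that sums, products, compositions
  and gluings come with explicit jets.\<close>

definition C2_deriv ::
  "'a::euclidean_space set \<Rightarrow> ('a \<Rightarrow> real) \<Rightarrow> ('a \<Rightarrow> 'a \<Rightarrow>\<^sub>L real) \<Rightarrow> ('a \<Rightarrow> 'a \<Rightarrow>\<^sub>L 'a \<Rightarrow>\<^sub>L real) \<Rightarrow> bool" where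
  "C2_deriv S \<psi> \<psi>' \<psi>'' \<longleftrightarrow>
     (\<forall>z\<in>S. (\<psi> has_derivative blinfun_apply (\<psi>' z)) (at z within S)) \<and>
     (\<forall>z\<in>S. (\<psi>' has_derivative blinfun_apply (\<psi>'' z)) (at z within S)) \<and>
     continuous_on S \<psi>''"

lemma C2_on_iff: "C2_on S \<psi> \<longleftrightarrow> (\<exists>\<psi>' \<psi>''. C2_deriv S \<psi> \<psi>' \<psi>'')"
  by (simp add: C2_on_def C2_deriv_def)

lemma C2_derivD:
  assumes "C2_deriv S \<psi> \<psi>' \<psi>''" "z \<in> S"
  shows "(\<psi> has_derivative blinfun_apply (\<psi>' z)) (at z within S)"
    and "(\<psi>' has_derivative blinfun_apply (\<psi>'' z)) (at z within S)"
  using assms by (auto simp: C2_deriv_def)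

lemma C2_deriv_continuous:
  assumes "C2_deriv S \<psi> \<psi>' \<psi>''"
  shows "continuous_on S \<psi>" "continuous_on S \<psi>'" "continuous_on S \<psi>''"
  using assms unfolding C2_deriv_def continuous_on_eq_continuous_within
  by (blast intro: has_derivative_continuous)+

lemma C2_deriv_subset: "C2_deriv S \<psi> \<psi>' \<psi>'' \<Longrightarrow> T \<subseteq> S \<Longrightarrow> C2_deriv T \<psi> \<psi>' \<psi>''"
  unfolding C2_deriv_def by (meson continuous_on_subset has_derivative_subset subsetD)

lemma C2_deriv_const: "C2_deriv S (\<lambda>_. c) (\<lambda>_. 0) (\<lambda>_. 0)"
  unfolding C2_deriv_def by (auto intro!: derivative_eq_intros)

lemma C2_deriv_inner: "C2_deriv S (\<lambda>z. a \<bullet> z) (\<lambda>_. blinfun_inner_right a) (\<lambda>_. 0)"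
  unfolding C2_deriv_def by (auto intro!: derivative_eq_intros)

lemma C2_deriv_add:
  assumes "C2_deriv S f f' f''" "C2_deriv S g g' g''"
  shows "C2_deriv S (\<lambda>z. f z + g z) (\<lambda>z. f' z + g' z) (\<lambda>z. f'' z + g'' z)"
  using assms unfolding C2_deriv_def
  by (auto intro!: derivative_eq_intros continuous_intros simp: blinfun.add_left)

lemma C2_deriv_cmult:
  assumes "C2_deriv S f f' f''"
  shows "C2_deriv S (\<lambda>z. c * f z) (\<lambda>z. c *\<^sub>R f' z) (\<lambda>z. c *\<^sub>R f'' z)"
  using assms unfolding C2_deriv_def
  by (auto intro!: derivative_eq_intros continuous_intros simp: blinfun.scaleR_left)

lemma C2_deriv_uminus:
  assumes "C2_deriv S f f' f''"
  shows "C2_deriv S (\<lambda>z. - f z) (\<lambda>z. - f' z) (\<lambda>z. - f'' z)"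
  using C2_deriv_cmult[OF assms, of "-1"] by simp

lemma C2_deriv_diff:
  assumes "C2_deriv S f f' f''" "C2_deriv S g g' g''"
  shows "C2_deriv S (\<lambda>z. f z - g z) (\<lambda>z. f' z - g' z) (\<lambda>z. f'' z - g'' z)"
  using C2_deriv_add[OF assms(1) C2_deriv_uminus[OF assms(2)]] by simp

lemma C2_deriv_mult:
  assumes f: "C2_deriv S f f' f''" and g: "C2_deriv S g g' g''"
  shows "C2_deriv S (\<lambda>z. f z * g z) (\<lambda>z. f z *\<^sub>R g' z + g z *\<^sub>R f' z)
    (\<lambda>z. f z *\<^sub>R g'' z + g z *\<^sub>R f'' z + (blinfun_scaleR_left (g' z) o\<^sub>L f' z) + (blinfun_scaleR_left (f' z) o\<^sub>L g' z))"
  unfolding C2_deriv_def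
proof (intro conjI ballI)
  fix z assume z: "z \<in> S"
  note d = C2_derivD[OF f z] C2_derivD[OF g z]
  show "((\<lambda>z. f z * g z) has_derivative (f z *\<^sub>R g' z + g z *\<^sub>R f' z)) (at z within S)"
    by (rule has_derivative_eq_rhs[OF has_derivative_mult[OF d(1,3)]])
      (simp add: fun_eq_iff blinfun.add_left blinfun.scaleR_left mult.commute)
  show "((\<lambda>z. f z *\<^sub>R g' z + g z *\<^sub>R f' z) has_derivative
      (f z *\<^sub>R g'' z + g z *\<^sub>R f'' z + (blinfun_scaleR_left (g' z) o\<^sub>L f' z) + (blinfun_scaleR_left (f' z) o\<^sub>L g' z))) (at z within S)"
    by (rule has_derivative_eq_rhs[OF has_derivative_add[OF
            has_derivative_scaleR[OF d(1,4)] has_derivative_scaleR[OF d(3,2)]]])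
      (simp add: fun_eq_iff blinfun.add_left blinfun.scaleR_left)
next
  have sl: "continuous_on S (\<lambda>z. blinfun_scaleR_left (k z))" if "continuous_on S k"
    for k :: "'a \<Rightarrow> 'a \<Rightarrow>\<^sub>L real"
    by (rule bounded_linear.continuous_on[OF bounded_linear_blinfun_scaleR_left that])
  show "continuous_on S (\<lambda>z. f z *\<^sub>R g'' z + g z *\<^sub>R f'' z + (blinfun_scaleR_left (g' z) o\<^sub>L f' z)
      + (blinfun_scaleR_left (f' z) o\<^sub>L g' z))"
    by (intro continuous_intros sl C2_deriv_continuous[OF f] C2_deriv_continuous[OF g]
        bounded_bilinear.continuous_on[OF bounded_bilinear_blinfun_compose])
qed

lemma C2_deriv_comp:
  assumes g: "C2_deriv S g g' g''"
    and h: "\<And>y. y \<in> g ` S \<Longrightarrow> (h has_real_derivative h' y) (at y)"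
    and h': "\<And>y. y \<in> g ` S \<Longrightarrow> (h' has_real_derivative h'' y) (at y)"
    and h'': "continuous_on (g ` S) h''"
  shows "C2_deriv S (\<lambda>z. h (g z)) (\<lambda>z. h' (g z) *\<^sub>R g' z)
    (\<lambda>z. h' (g z) *\<^sub>R g'' z + h'' (g z) *\<^sub>R (blinfun_scaleR_left (g' z) o\<^sub>L g' z))"
  unfolding C2_deriv_def
proof (intro conjI ballI)
  fix z assume z: "z \<in> S"
  note d = C2_derivD[OF g z]
  have h1: "((\<lambda>z. h (g z)) has_derivative (\<lambda>v. h' (g z) * g' z v)) (at z within S)"
    using has_derivative_compose[OF d(1), of h "(*) (h' (g z))"] h[of "g z"] z
    by (auto simp: has_field_derivative_def)
  then show "((\<lambda>z. h (g z)) has_derivative (h' (g z) *\<^sub>R g' z)) (at z within S)"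
    by (simp add: blinfun.scaleR_left[abs_def])
  have h2: "((\<lambda>z. h' (g z)) has_derivative (\<lambda>v. h'' (g z) * g' z v)) (at z within S)"
    using has_derivative_compose[OF d(1), of h' "(*) (h'' (g z))"] h'[of "g z"] z
    by (auto simp: has_field_derivative_def)
  show "((\<lambda>z. h' (g z) *\<^sub>R g' z) has_derivative
      (h' (g z) *\<^sub>R g'' z + h'' (g z) *\<^sub>R (blinfun_scaleR_left (g' z) o\<^sub>L g' z))) (at z within S)"
    by (rule has_derivative_eq_rhs[OF has_derivative_scaleR[OF h2 d(2)]])
      (simp add: fun_eq_iff blinfun.add_left blinfun.scaleR_left)
next
  have sl: "continuous_on S (\<lambda>z. blinfun_scaleR_left (g' z))"
    by (rule bounded_linear.continuous_on[OF bounded_linear_blinfun_scaleR_left C2_deriv_continuous(2)[OF g]])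
  have "continuous_on (g ` S) h'"
    using h' by (meson DERIV_isCont continuous_at_imp_continuous_on)
  then have "continuous_on S (\<lambda>z. h' (g z))" "continuous_on S (\<lambda>z. h'' (g z))"
    using continuous_on_compose2[OF _ C2_deriv_continuous(1)[OF g]] h'' by blast+
  then show "continuous_on S (\<lambda>z. h' (g z) *\<^sub>R g'' z + h'' (g z) *\<^sub>R (blinfun_scaleR_left (g' z) o\<^sub>L g' z))"
    by (intro continuous_intros sl C2_deriv_continuous[OF g]
        bounded_bilinear.continuous_on[OF bounded_bilinear_blinfun_compose])
qed

lemma C2_deriv_affine:
  fixes A :: "'a::euclidean_space \<Rightarrow>\<^sub>L 'b::euclidean_space"
  assumes f: "C2_deriv T f f' f''" and ST: "(\<lambda>z. A z + b) ` S \<subseteq> T"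
  obtains f2 where "C2_deriv S (\<lambda>z. f (A z + b)) (\<lambda>z. f' (A z + b) o\<^sub>L A) f2"
    "\<And>z u v. f2 z u v = f'' (A z + b) (A u) (A v)"
proof -
  define R :: "('b \<Rightarrow>\<^sub>L real) \<Rightarrow>\<^sub>L ('a \<Rightarrow>\<^sub>L real)" where "R = Blinfun (\<lambda>B. B o\<^sub>L A)"
  have bl: "bounded_linear (\<lambda>B :: 'b \<Rightarrow>\<^sub>L real. B o\<^sub>L A)"
    by (rule bounded_bilinear.bounded_linear_left[OF bounded_bilinear_blinfun_compose])
  then have R: "blinfun_apply R B = B o\<^sub>L A" for B
    by (simp add: R_def bounded_linear_Blinfun_apply)
  define f2 where "f2 = (\<lambda>z. R o\<^sub>L (f'' (A z + b) o\<^sub>L A))"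
  have T: "A z + b \<in> T" if "z \<in> S" for z using that ST by blast
  have dA: "((\<lambda>z. A z + b) has_derivative A) (at z within S)" for z
    by (auto intro!: derivative_eq_intros)
  have "C2_deriv S (\<lambda>z. f (A z + b)) (\<lambda>z. f' (A z + b) o\<^sub>L A) f2"
    unfolding C2_deriv_def
  proof (intro conjI ballI)
    fix z assume z: "z \<in> S"
    note d = C2_derivD[OF f T[OF z]]
    show "((\<lambda>z. f (A z + b)) has_derivative (f' (A z + b) o\<^sub>L A)) (at z within S)"
      by (rule has_derivative_eq_rhs[OF has_derivative_in_compose[OF dA has_derivative_subset[OF d(1) ST]]])
        (simp add: fun_eq_iff)
    have "((\<lambda>z. f' (A z + b)) has_derivative (\<lambda>v. f'' (A z + b) (A v))) (at z within S)"
      using has_derivative_in_compose[OF dA has_derivative_subset[OF d(2) ST]] .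
    from bounded_linear.has_derivative[OF bl this]
    show "((\<lambda>z. f' (A z + b) o\<^sub>L A) has_derivative f2 z) (at z within S)"
      by (rule has_derivative_eq_rhs) (simp add: f2_def R fun_eq_iff)
  next
    have "continuous_on S (\<lambda>z. f'' (A z + b))"
      by (rule continuous_on_compose2[OF C2_deriv_continuous(3)[OF f] _ ST]) (intro continuous_intros)
    then show "continuous_on S f2"
      unfolding f2_def
      by (intro bounded_bilinear.continuous_on[OF bounded_bilinear_blinfun_compose] continuous_intros)
  qed
  moreover have "f2 z u v = f'' (A z + b) (A u) (A v)" for z u v
    by (simp add: f2_def R)
  ultimately show thesis using that by blast
qed

text \<open>Since \<open>U\<close> and \<open>V\<close> are open, near each point the filter within
  \<open>S\<close> is the one within \<open>S \<inter> U\<close> or within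
  \<open>S \<inter> V\<close>. This serves to continue a local test function to the whole
  cube.\<close>

lemma C2_deriv_glue:
  assumes f: "C2_deriv (S \<inter> U) f f' f''" and g: "C2_deriv (S \<inter> V) g g' g''"
    and UV: "open U" "open V" "S \<subseteq> U \<union> V"
    and eq: "\<And>z. z \<in> S \<inter> U \<inter> V \<Longrightarrow> f z = g z \<and> f' z = g' z \<and> f'' z = g'' z"
  shows "C2_deriv S (\<lambda>z. if z \<in> U then f z else g z) (\<lambda>z. if z \<in> U then f' z else g' z)
    (\<lambda>z. if z \<in> U then f'' z else g'' z)"
  unfolding C2_deriv_def
proof (intro conjI ballI)
  fix z assume z: "z \<in> S"
  consider "z \<in> U" | "z \<in> V" "z \<notin> U" using z UV by blast
  then have "((\<lambda>z. if z \<in> U then f z else g z) has_derivative (if z \<in> U then f' z else g' z)) (at z within S) \<and>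
   ((\<lambda>z. if z \<in> U then f' z else g' z) has_derivative (if z \<in> U then f'' z else g'' z)) (at z within S)"
  proof cases
    case 1
    have at: "at z within S = at z within (S \<inter> U)"
      using 1 UV(1) by (intro at_within_nhd[of z U]) auto
    have m: "z \<in> S \<inter> U" using 1 z by simp
    show ?thesis
      unfolding at using 1
      by (intro conjI has_derivative_transform[OF m _ C2_derivD(1)[OF f m, THEN has_derivative_eq_rhs]]
          has_derivative_transform[OF m _ C2_derivD(2)[OF f m, THEN has_derivative_eq_rhs]]) auto
  next
    case 2
    have at: "at z within S = at z within (S \<inter> V)"
      using 2 UV(2) by (intro at_within_nhd[of z V]) auto
    have m: "z \<in> S \<inter> V" using 2 z by simp
    show ?thesis
      unfolding at using 2 eq
      by (intro conjI has_derivative_transform[OF m _ C2_derivD(1)[OF g m, THEN has_derivative_eq_rhs]]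
          has_derivative_transform[OF m _ C2_derivD(2)[OF g m, THEN has_derivative_eq_rhs]]) auto
  qed
  then show "((\<lambda>z. if z \<in> U then f z else g z) has_derivative (if z \<in> U then f' z else g' z)) (at z within S)"
   "((\<lambda>z. if z \<in> U then f' z else g' z) has_derivative (if z \<in> U then f'' z else g'' z)) (at z within S)"
    by blast+
next
  let ?h = "\<lambda>z. if z \<in> U then f'' z else g'' z"
  have "continuous_on (S \<inter> U) ?h"
    using C2_deriv_continuous(3)[OF f] by (rule continuous_on_eq) auto
  moreover have "continuous_on (S \<inter> V) ?h"
    using C2_deriv_continuous(3)[OF g] by (rule continuous_on_eq) (use eq in auto)
  ultimately have "continuous_on ((S \<inter> U) \<union> (S \<inter> V)) ?h"
    using UV by (intro continuous_on_Un_local_open) (auto simp: openin_open)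
  moreover have "(S \<inter> U) \<union> (S \<inter> V) = S" using UV by blast
  ultimately show "continuous_on S ?h" by simp
qed

text \<open>Schwarz's theorem in a one-sided form: only a parallelogram spanned by nonnegative
  multiples of \<open>u\<close> and \<open>v\<close> has to lie in \<open>S\<close>. Two mean value
  steps express the same second difference as \<open>h * h\<close> times the mixed derivative, in
  either order, at points tending to \<open>z\<close>.\<close>

lemma C2_deriv_symmetric:
  fixes u v :: "'a::euclidean_space"
  assumes f: "C2_deriv S f f' f''" and z: "z \<in> S" and h0: "h0 > 0"
    and S: "\<And>s t. 0 \<le> s \<Longrightarrow> s \<le> h0 \<Longrightarrow> 0 \<le> t \<Longrightarrow> t \<le> h0 \<Longrightarrow> z + s *\<^sub>R u + t *\<^sub>R v \<in> S"
  shows "f'' z u v = f'' z v u"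
proof -
  have key: "\<exists>s t. 0 \<le> s \<and> s \<le> h \<and> 0 \<le> t \<and> t \<le> h \<and>
      f (z + h *\<^sub>R u + h *\<^sub>R v) - f (z + h *\<^sub>R u) - f (z + h *\<^sub>R v) + f z =
      h * h * f'' (z + s *\<^sub>R u + t *\<^sub>R v) v u"
    if h: "0 < h" "h \<le> h0"
      and S: "\<And>s t. 0 \<le> s \<Longrightarrow> s \<le> h0 \<Longrightarrow> 0 \<le> t \<Longrightarrow> t \<le> h0 \<Longrightarrow> z + s *\<^sub>R u + t *\<^sub>R v \<in> S"
    for u v h
  proof -
    have d1: "((\<lambda>s. f (z + s *\<^sub>R u + t *\<^sub>R v)) has_derivative (\<lambda>k. f' (z + s *\<^sub>R u + t *\<^sub>R v) (k *\<^sub>R u)))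
        (at s within {0..h})" if "s \<in> {0..h}" "t \<in> {0..h}" for s t
    proof -
      have "((\<lambda>s. z + s *\<^sub>R u + t *\<^sub>R v) has_derivative (\<lambda>k. k *\<^sub>R u)) (at s within {0..h})"
        by (auto intro!: derivative_eq_intros)
      moreover have sub: "(\<lambda>s. z + s *\<^sub>R u + t *\<^sub>R v) ` {0..h} \<subseteq> S" using that h S by auto
      moreover have "z + s *\<^sub>R u + t *\<^sub>R v \<in> S" using sub that by blast
      ultimately show ?thesis
        using has_derivative_in_compose[OF _ has_derivative_subset[OF C2_derivD(1)[OF f]]] by blast
    qed
    have d2: "((\<lambda>t. f' (z + s *\<^sub>R u + t *\<^sub>R v) u) has_derivative (\<lambda>k. f'' (z + s *\<^sub>R u + t *\<^sub>R v) (k *\<^sub>R v) u))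
        (at t within {0..h})" if "s \<in> {0..h}" "t \<in> {0..h}" for s t
    proof -
      have "((\<lambda>t. z + s *\<^sub>R u + t *\<^sub>R v) has_derivative (\<lambda>k. k *\<^sub>R v)) (at t within {0..h})"
        by (auto intro!: derivative_eq_intros)
      moreover have sub: "(\<lambda>t. z + s *\<^sub>R u + t *\<^sub>R v) ` {0..h} \<subseteq> S" using that h S by auto
      moreover have "z + s *\<^sub>R u + t *\<^sub>R v \<in> S" using sub that by blast
      ultimately have "((\<lambda>t. f' (z + s *\<^sub>R u + t *\<^sub>R v)) has_derivative (\<lambda>k. f'' (z + s *\<^sub>R u + t *\<^sub>R v) (k *\<^sub>R v)))
        (at t within {0..h})"
        using has_derivative_in_compose[OF _ has_derivative_subset[OF C2_derivD(2)[OF f]]] by blast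
      from bounded_linear.has_derivative[OF blinfun.bounded_linear_left this]
      show ?thesis .
    qed
    have "\<exists>s\<in>{0<..<h}. (f (z + h *\<^sub>R u + h *\<^sub>R v) - f (z + h *\<^sub>R u + 0 *\<^sub>R v)) -
       (f (z + 0 *\<^sub>R u + h *\<^sub>R v) - f (z + 0 *\<^sub>R u + 0 *\<^sub>R v)) =
       (\<lambda>k. f' (z + s *\<^sub>R u + h *\<^sub>R v) (k *\<^sub>R u) - f' (z + s *\<^sub>R u + 0 *\<^sub>R v) (k *\<^sub>R u)) (h - 0)"
      using h(1) by (intro mvt_simple has_derivative_diff d1) auto
    then obtain s where s: "s \<in> {0<..<h}"
      and e1: "f (z + h *\<^sub>R u + h *\<^sub>R v) - f (z + h *\<^sub>R u) - f (z + h *\<^sub>R v) + f z =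
        h * (f' (z + s *\<^sub>R u + h *\<^sub>R v) u - f' (z + s *\<^sub>R u + 0 *\<^sub>R v) u)"
      by (auto simp: blinfun.scaleR_right algebra_simps)
    have "\<exists>t\<in>{0<..<h}. f' (z + s *\<^sub>R u + h *\<^sub>R v) u - f' (z + s *\<^sub>R u + 0 *\<^sub>R v) u =
       (\<lambda>k. f'' (z + s *\<^sub>R u + t *\<^sub>R v) (k *\<^sub>R v) u) (h - 0)"
      using h(1) s by (intro mvt_simple d2) auto
    then obtain t where t: "t \<in> {0<..<h}"
      and e2: "f' (z + s *\<^sub>R u + h *\<^sub>R v) u - f' (z + s *\<^sub>R u + 0 *\<^sub>R v) u = h * f'' (z + s *\<^sub>R u + t *\<^sub>R v) v u"
      by (auto simp: blinfun.scaleR_right blinfun.scaleR_left)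
    show ?thesis using s t e1 e2 by (intro exI[of _ s] exI[of _ t]) auto
  qed
  have "\<bar>f'' z u v - f'' z v u\<bar> \<le> e" if e: "e > 0" for e
  proof -
    have "continuous_on S (\<lambda>w. f'' w u v)" "continuous_on S (\<lambda>w. f'' w v u)"
      by (intro continuous_intros C2_deriv_continuous(3)[OF f])+
    then obtain d1 d2 where d: "d1 > 0" "d2 > 0"
      and d1: "\<And>w. w \<in> S \<Longrightarrow> dist w z < d1 \<Longrightarrow> dist (f'' w u v) (f'' z u v) < e / 2"
      and d2: "\<And>w. w \<in> S \<Longrightarrow> dist w z < d2 \<Longrightarrow> dist (f'' w v u) (f'' z v u) < e / 2"
      using e z unfolding continuous_on_iff by (metis half_gt_zero)
    define k where "k = norm u + norm v + 1"
    define m where "m = min d1 d2"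
    define h where "h = min h0 (m / (2 * k))"
    have k: "k > 0" by (simp add: k_def add_nonneg_pos)
    have m: "m > 0" using d by (simp add: m_def)
    have h: "0 < h" "h \<le> h0" using h0 m k by (auto simp: h_def)
    have "h \<le> m / (2 * k)" by (simp add: h_def)
    then have "h * k * 2 \<le> m" using k by (simp add: pos_le_divide_eq mult_ac)
    moreover have "h * (norm u + norm v) \<le> h * k" using h by (simp add: k_def)
    ultimately have hd: "h * (norm u + norm v) < min d1 d2" using m by (simp add: m_def)
    have close: "dist (z + s *\<^sub>R u + t *\<^sub>R v) z < min d1 d2" if "0 \<le> s" "s \<le> h" "0 \<le> t" "t \<le> h" for s t
    proof -
      have "dist (z + s *\<^sub>R u + t *\<^sub>R v) z \<le> s * norm u + t * norm v"
        using that norm_triangle_ineq[of "s *\<^sub>R u" "t *\<^sub>R v"] by (simp add: dist_norm)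
      also have "\<dots> \<le> h * (norm u + norm v)"
        using that by (simp add: distrib_left add_mono mult_right_mono)
      finally show ?thesis using hd by simp
    qed
    obtain s t where st: "0 \<le> s" "s \<le> h" "0 \<le> t" "t \<le> h"
      and e1: "f (z + h *\<^sub>R u + h *\<^sub>R v) - f (z + h *\<^sub>R u) - f (z + h *\<^sub>R v) + f z =
        h * h * f'' (z + s *\<^sub>R u + t *\<^sub>R v) v u"
      using key[OF h S] by blast
    have S': "z + s *\<^sub>R v + t *\<^sub>R u \<in> S" if "0 \<le> s" "s \<le> h0" "0 \<le> t" "t \<le> h0" for s t
      using S[of t s] that by (simp add: algebra_simps)
    obtain s' t' where st': "0 \<le> s'" "s' \<le> h" "0 \<le> t'" "t' \<le> h"
      and e2: "f (z + h *\<^sub>R v + h *\<^sub>R u) - f (z + h *\<^sub>R v) - f (z + h *\<^sub>R u) + f z =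
        h * h * f'' (z + s' *\<^sub>R v + t' *\<^sub>R u) u v"
      using key[OF h, of v u] S' by blast
    have "f (z + h *\<^sub>R v + h *\<^sub>R u) = f (z + h *\<^sub>R u + h *\<^sub>R v)" by (simp add: algebra_simps)
    then have "h * h * f'' (z + s *\<^sub>R u + t *\<^sub>R v) v u = h * h * f'' (z + s' *\<^sub>R v + t' *\<^sub>R u) u v"
      using e1 e2 by argo
    then have "f'' (z + s *\<^sub>R u + t *\<^sub>R v) v u = f'' (z + t' *\<^sub>R u + s' *\<^sub>R v) u v"
      using h(1) by (simp add: algebra_simps)
    moreover have "z + s *\<^sub>R u + t *\<^sub>R v \<in> S" "z + t' *\<^sub>R u + s' *\<^sub>R v \<in> S"
      using S st st' h by auto
    ultimately show ?thesis
      using d1[of "z + t' *\<^sub>R u + s' *\<^sub>R v"] d2[of "z + s *\<^sub>R u + t *\<^sub>R v"]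
        close[OF st] close[OF st'(3,4,1,2)]
      unfolding dist_real_def min_less_iff_conj by linarith
  qed
  then have "\<bar>f'' z u v - f'' z v u\<bar> \<le> 0" by (rule field_le_epsilon) simp
  then show ?thesis by simp
qed

section \<open>Spatial gradient and Hessian as parts of the jet\<close>

definition jet_grad :: "(((real ^ 'n) \<times> real) \<Rightarrow>\<^sub>L real) \<Rightarrow> real ^ 'n" where
  "jet_grad f' = (\<chi> i. f' (axis i 1, 0))"

definition jet_hessian :: "(((real ^ 'n) \<times> real) \<Rightarrow>\<^sub>L ((real ^ 'n) \<times> real) \<Rightarrow>\<^sub>L real) \<Rightarrow> real ^ 'n ^ 'n" where
  "jet_hessian f'' = (\<chi> i j. f'' (axis i 1, 0) (axis j 1, 0))"

text \<open>\<open>frechet_derivative\<close> is a choice and is known only where the derivative is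
  unique. The condition on \<open>S\<close> ensures this: in each coordinate direction the set
  contains points at arbitrarily small nonzero distance, on at least one side.\<close>

lemma jets_eq:
  fixes S :: "((real ^ 'n) \<times> real) set"
  assumes f: "C2_deriv S f f' f''" and z: "z \<in> S"
    and S: "\<And>z i e. z \<in> S \<Longrightarrow> i \<in> Basis \<Longrightarrow> e > 0 \<Longrightarrow> \<exists>d. 0 < \<bar>d\<bar> \<and> \<bar>d\<bar> < e \<and> z + d *\<^sub>R i \<in> S"
  shows "space_grad S f z = jet_grad (f' z)" "time_deriv S f z = f' z (0, 1)"
    "space_hessian S f z = jet_hessian (f'' z)"
proof -
  have fd: "frechet_derivative g (at w within S) = g'"
    if "w \<in> S" "(g has_derivative g') (at w within S)" for w g g'
    using frechet_derivative_unique_within[OF _ that(2) S[OF that(1)]] that(2)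
    by (metis differentiable_def frechet_derivative_works)
  have p: "space_partial S i f w = f' w (axis i 1, 0)" if "w \<in> S" for w i
    using fd[OF that C2_derivD(1)[OF f that]] by (simp add: space_partial_def)
  show "space_grad S f z = jet_grad (f' z)"
    by (simp add: space_grad_def jet_grad_def p z)
  show "time_deriv S f z = f' z (0, 1)"
    using fd[OF z C2_derivD(1)[OF f z]] by (simp add: time_deriv_def)
  have "space_partial S i (space_partial S j f) z = f'' z (axis i 1, 0) (axis j 1, 0)" for i j
  proof -
    have "((\<lambda>w. f' w (axis j 1, 0)) has_derivative (\<lambda>v. f'' z v (axis j 1, 0))) (at z within S)"
      using bounded_linear.has_derivative[OF blinfun.bounded_linear_left C2_derivD(2)[OF f z]] .
    then have "(space_partial S j f has_derivative (\<lambda>v. f'' z v (axis j 1, 0))) (at z within S)"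
      by (rule has_derivative_transform[OF z, rotated]) (simp add: p)
    from fd[OF z this] show ?thesis by (simp add: space_partial_def)
  qed
  then show "space_hessian S f z = jet_hessian (f'' z)"
    by (simp add: space_hessian_def jet_hessian_def)
qed

lemma open_infnorm_slab: "open {(x :: real ^ 'n, t :: real). infnorm (x - x0) < R \<and> a < t}"
proof -
  have "{(x :: real ^ 'n, t :: real). infnorm (x - x0) < R \<and> a < t} =
    {p. infnorm (fst p - x0) < R} \<inter> {p. a < snd p}" by auto
  moreover have "open \<dots>"
    by (intro open_Int open_Collect_less continuous_intros)
  ultimately show ?thesis by simp
qed

lemma compact_closed_cylinder:
  "compact {p :: (real ^ 'n) \<times> real. infnorm (fst p) \<le> R \<and> a \<le> snd p \<and> snd p \<le> b}"
proof -
  have "norm x \<le> sqrt (DIM(real ^ 'n)) * R" if "infnorm x \<le> R" for x :: "real ^ 'n"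
  proof -
    have "norm x \<le> sqrt (DIM(real ^ 'n)) * infnorm x" by (rule norm_le_infnorm)
    also have "\<dots> \<le> sqrt (DIM(real ^ 'n)) * R" using that by (intro mult_left_mono) auto
    finally show ?thesis .
  qed
  then have "bounded {x :: real ^ 'n. infnorm x \<le> R}" unfolding bounded_iff by blast
  then have "compact {x :: real ^ 'n. infnorm x \<le> R}"
    unfolding compact_eq_bounded_closed by (auto intro!: closed_Collect_le continuous_intros)
  then have "compact ({x :: real ^ 'n. infnorm x \<le> R} \<times> {a..b})"
    by (intro compact_Times) auto
  moreover have "{p :: (real ^ 'n) \<times> real. infnorm (fst p) \<le> R \<and> a \<le> snd p \<and> snd p \<le> b} =
      {x. infnorm x \<le> R} \<times> {a..b}" by auto
  ultimately show ?thesis by simp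
qed

lemma parabolic_cube_eq:
  "parabolic_cube R x0 t0 = {(x, t). infnorm (x - x0) < R \<and> t0 - R\<^sup>2 < t} \<inter> {p. snd p \<le> t0}"
  by (auto simp: parabolic_cube_def)

lemma parabolic_cube_directions:
  assumes "z \<in> parabolic_cube R x0 t0" "i \<in> Basis" "e > 0"
  shows "\<exists>d. 0 < \<bar>d\<bar> \<and> \<bar>d\<bar> < e \<and> z + d *\<^sub>R i \<in> parabolic_cube R x0 t0"
proof -
  obtain r where r: "r > 0" "ball z r \<subseteq> {(x, t). infnorm (x - x0) < R \<and> t0 - R\<^sup>2 < t}"
    using assms(1) open_infnorm_slab[of x0 R "t0 - R\<^sup>2"] unfolding parabolic_cube_eq open_contains_ball by blast
  \<comment> \<open>Negative, because at the top of the cube only steps back in time stay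
    inside.\<close>
  define d where "d = - min e r / 2"
  have d: "d < 0" "\<bar>d\<bar> < e" "\<bar>d\<bar> < r" using assms(3) r(1) by (auto simp: d_def)
  have "z + d *\<^sub>R i \<in> ball z r" using d assms(2) by (simp add: dist_norm)
  moreover have "snd (z + d *\<^sub>R i) \<le> snd z"
    using assms(2) d(1) by (auto simp: Basis_prod_def mult_le_0_iff)
  ultimately have "z + d *\<^sub>R i \<in> parabolic_cube R x0 t0"
    using r assms(1) unfolding parabolic_cube_eq by auto
  then show ?thesis using d by (intro exI[of _ d]) auto
qed

text \<open>The parallelogram is spanned by spatial directions, so its time coordinate is constant
  and it stays in the cube even at the top.\<close>

lemma jet_hessian_symmetric:
  assumes f: "C2_deriv (parabolic_cube R x0 t0) f f' f''" and z: "z \<in> parabolic_cube R x0 t0"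
  shows "transpose (jet_hessian (f'' z)) = jet_hessian (f'' z)"
proof -
  have "f'' z (axis i 1, 0) (axis j 1, 0) = f'' z (axis j 1, 0) (axis i 1, 0)" for i j
  proof -
    obtain r where r: "r > 0" "ball z r \<subseteq> {(x, t). infnorm (x - x0) < R \<and> t0 - R\<^sup>2 < t}"
      using z open_infnorm_slab[of x0 R "t0 - R\<^sup>2"] unfolding parabolic_cube_eq open_contains_ball by blast
    show ?thesis
    proof (rule C2_deriv_symmetric[OF f z, of "r / 3"])
      fix s t :: real assume st: "0 \<le> s" "s \<le> r / 3" "0 \<le> t" "t \<le> r / 3"
      let ?w = "z + s *\<^sub>R (axis i 1, 0) + t *\<^sub>R (axis j 1, 0)"
      have "dist z ?w = norm (s *\<^sub>R (axis i (1::real), 0::real) + t *\<^sub>R (axis j 1, 0))"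
        by (subst dist_commute) (simp add: dist_norm)
      also have "\<dots> \<le> s + t"
        using st norm_triangle_ineq[of "s *\<^sub>R (axis i (1::real), 0::real)" "t *\<^sub>R (axis j 1, 0)"]
        by (simp add: norm_Pair norm_axis_1)
      also have "\<dots> < r" using st r(1) by simp
      finally have "?w \<in> ball z r" by simp
      then show "?w \<in> parabolic_cube R x0 t0"
        using r z unfolding parabolic_cube_eq by auto
    qed (use r in auto)
  qed
  then show ?thesis by (simp add: vec_eq_iff transpose_def jet_hessian_def)
qed

lemma parabolic_cube_jets:
  fixes f :: "(real ^ 'n) \<times> real \<Rightarrow> real"
  assumes f: "C2_deriv (parabolic_cube R x0 t0) f f' f''" and z: "z \<in> parabolic_cube R x0 t0"
  shows "space_grad (parabolic_cube R x0 t0) f z = jet_grad (f' z)"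
    "time_deriv (parabolic_cube R x0 t0) f z = f' z (0, 1)"
    "space_hessian (parabolic_cube R x0 t0) f z = jet_hessian (f'' z)"
proof -
  have "\<exists>d. 0 < \<bar>d\<bar> \<and> \<bar>d\<bar> < e \<and> w + d *\<^sub>R i \<in> parabolic_cube R x0 t0"
    if "w \<in> parabolic_cube R x0 t0" "i \<in> Basis" "e > 0" for w i e
    using parabolic_cube_directions that by blast
  note * = jets_eq[OF f z this]
  show "space_grad (parabolic_cube R x0 t0) f z = jet_grad (f' z)"
    "time_deriv (parabolic_cube R x0 t0) f z = f' z (0, 1)"
    "space_hessian (parabolic_cube R x0 t0) f z = jet_hessian (f'' z)"
    by (rule *; assumption)+
qed

lemma viscosity_supersolution_iff:
  fixes u :: "(real ^ 'n) \<times> real \<Rightarrow> real" and x0 t0 R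
  defines "Q \<equiv> parabolic_cube R x0 t0"
  shows "viscosity_supersolution l L \<phi> Q u \<longleftrightarrow> lower_semicont_on Q u \<and>
    (\<forall>z\<in>Q. \<forall>\<psi> \<psi>' \<psi>''. C2_deriv Q \<psi> \<psi>' \<psi>'' \<and> (\<forall>w\<in>Q. \<psi> w \<le> u w) \<and> \<psi> z = u z \<longrightarrow>
      pucci_minus l L (jet_hessian (\<psi>'' z)) - blinfun_apply (\<psi>' z) (0, 1) \<le> \<phi> (norm (jet_grad (\<psi>' z))))"
    (is "?L \<longleftrightarrow> ?R")
proof
  assume L: ?L
  show ?R
  proof (intro conjI ballI allI impI)
    show "lower_semicont_on Q u" using L by (simp only: viscosity_supersolution_def)
    fix z \<psi> \<psi>' \<psi>''
    assume z: "z \<in> Q" and A: "C2_deriv Q \<psi> \<psi>' \<psi>'' \<and> (\<forall>w\<in>Q. \<psi> w \<le> u w) \<and> \<psi> z = u z"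
    have C: "C2_deriv Q \<psi> \<psi>' \<psi>''" using A by simp
    have "C2_on Q \<psi> \<and> (\<forall>w\<in>Q. \<psi> w \<le> u w) \<and> \<psi> z = u z" using A unfolding C2_on_iff by blast
    then have "pucci_minus l L (space_hessian Q \<psi> z) - time_deriv Q \<psi> z \<le> \<phi> (norm (space_grad Q \<psi> z))"
      using L z unfolding viscosity_supersolution_def by blast
    then show "pucci_minus l L (jet_hessian (\<psi>'' z)) - blinfun_apply (\<psi>' z) (0, 1) \<le> \<phi> (norm (jet_grad (\<psi>' z)))"
      using parabolic_cube_jets[OF C[unfolded Q_def] z[unfolded Q_def]] unfolding Q_def by simp
  qed
next
  assume R: ?R
  show ?L
    unfolding viscosity_supersolution_def
  proof (intro conjI ballI allI impI)
    show "lower_semicont_on Q u" using R by (rule conjunct1)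
    fix z \<psi>
    assume z: "z \<in> Q" and A: "C2_on Q \<psi> \<and> (\<forall>w\<in>Q. \<psi> w \<le> u w) \<and> \<psi> z = u z"
    then obtain \<psi>' \<psi>'' where C: "C2_deriv Q \<psi> \<psi>' \<psi>''" unfolding C2_on_iff by blast
    have "C2_deriv Q \<psi> \<psi>' \<psi>'' \<and> (\<forall>w\<in>Q. \<psi> w \<le> u w) \<and> \<psi> z = u z" using A C by simp
    then have "pucci_minus l L (jet_hessian (\<psi>'' z)) - blinfun_apply (\<psi>' z) (0, 1) \<le> \<phi> (norm (jet_grad (\<psi>' z)))"
      using R[THEN conjunct2, rule_format, OF z] by simp
    then show "pucci_minus l L (space_hessian Q \<psi> z) - time_deriv Q \<psi> z \<le> \<phi> (norm (space_grad Q \<psi> z))"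
      using parabolic_cube_jets[OF C[unfolded Q_def] z[unfolded Q_def]] unfolding Q_def by simp
  qed
qed

lemma jet_grad_uminus: "jet_grad (- f') = - jet_grad f'"
  by (simp add: jet_grad_def vec_eq_iff blinfun.minus_left)

lemma jet_hessian_uminus: "jet_hessian (- f'') = - jet_hessian f''"
  by (simp add: jet_hessian_def vec_eq_iff blinfun.minus_left)

text \<open>Negation exchanges touching from above and from below, and
  \<open>pucci_plus_uminus\<close> exchanges the two inequalities while the gradient norm, and with
  it \<open>\<phi>\<close>, is unchanged.\<close>

lemma viscosity_subsolution_iff:
  fixes u :: "(real ^ 'n) \<times> real \<Rightarrow> real" and x0 t0 R
  defines "Q \<equiv> parabolic_cube R x0 t0"
  shows "viscosity_subsolution l L \<phi> Q u \<longleftrightarrow> viscosity_supersolution l L \<phi> Q (\<lambda>z. - u z)"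
proof -
  have sc: "upper_semicont_on Q u \<longleftrightarrow> lower_semicont_on Q (\<lambda>z. - u z)"
  proof -
    have "(\<forall>a. u z < a \<longrightarrow> (\<forall>\<^sub>F w in at z within Q. u w < a)) \<longleftrightarrow>
        (\<forall>a. a < - u z \<longrightarrow> (\<forall>\<^sub>F w in at z within Q. a < - u w))" for z
    proof (intro iffI allI impI)
      fix a assume "\<forall>a. u z < a \<longrightarrow> (\<forall>\<^sub>F w in at z within Q. u w < a)" "a < - u z"
      moreover have "u z < - a" using \<open>a < - u z\<close> by simp
      ultimately have "\<forall>\<^sub>F w in at z within Q. u w < - a" by blast
      then show "\<forall>\<^sub>F w in at z within Q. a < - u w" by eventually_elim simp
    next
      fix a assume "\<forall>a. a < - u z \<longrightarrow> (\<forall>\<^sub>F w in at z within Q. a < - u w)" "u z < a"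
      moreover have "- a < - u z" using \<open>u z < a\<close> by simp
      ultimately have "\<forall>\<^sub>F w in at z within Q. - a < - u w" by blast
      then show "\<forall>\<^sub>F w in at z within Q. u w < a" by eventually_elim simp
    qed
    then show ?thesis unfolding upper_semicont_on_def lower_semicont_on_def by simp
  qed
  have neg: "C2_on Q (\<lambda>w. - \<psi> w)" if "C2_on Q \<psi>" for \<psi> :: "(real ^ 'n) \<times> real \<Rightarrow> real"
    using that C2_deriv_uminus unfolding C2_on_iff by blast
  have ineq: "pucci_minus l L (space_hessian Q (\<lambda>w. - \<psi> w) z) - time_deriv Q (\<lambda>w. - \<psi> w) z
        \<le> \<phi> (norm (space_grad Q (\<lambda>w. - \<psi> w) z)) \<longleftrightarrow>
      pucci_plus l L (space_hessian Q \<psi> z) - time_deriv Q \<psi> z \<ge> - \<phi> (norm (space_grad Q \<psi> z))"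
    if z: "z \<in> Q" and C2: "C2_on Q \<psi>" for z and \<psi> :: "(real ^ 'n) \<times> real \<Rightarrow> real"
  proof -
    obtain \<psi>' \<psi>'' where C: "C2_deriv Q \<psi> \<psi>' \<psi>''" using C2 unfolding C2_on_iff by blast
    show ?thesis
      using parabolic_cube_jets[OF C[unfolded Q_def] z[unfolded Q_def]]
        parabolic_cube_jets[OF C2_deriv_uminus[OF C[unfolded Q_def]] z[unfolded Q_def]]
      unfolding Q_def
      by (auto simp: jet_grad_uminus jet_hessian_uminus pucci_plus_uminus blinfun.minus_left)
  qed
  show ?thesis
    unfolding viscosity_subsolution_def viscosity_supersolution_def sc
  proof (intro conj_cong refl ball_cong iffI allI impI)
    fix z \<psi>
    assume z: "z \<in> Q" and A: "C2_on Q \<psi> \<and> (\<forall>w\<in>Q. \<psi> w \<le> - u w) \<and> \<psi> z = - u z"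
      and S: "\<forall>\<psi>. C2_on Q \<psi> \<and> (\<forall>w\<in>Q. \<psi> w \<ge> u w) \<and> \<psi> z = u z \<longrightarrow>
        pucci_plus l L (space_hessian Q \<psi> z) - time_deriv Q \<psi> z \<ge> - \<phi> (norm (space_grad Q \<psi> z))"
    have B: "C2_on Q (\<lambda>w. - \<psi> w)" using neg A by blast
    moreover have "\<forall>w\<in>Q. - \<psi> w \<ge> u w" "- \<psi> z = u z" using A by force+
    ultimately show "pucci_minus l L (space_hessian Q \<psi> z) - time_deriv Q \<psi> z \<le> \<phi> (norm (space_grad Q \<psi> z))"
      using S[rule_format, of "\<lambda>w. - \<psi> w"] ineq[OF z B] by simp
  next
    fix z \<psi>
    assume z: "z \<in> Q" and A: "C2_on Q \<psi> \<and> (\<forall>w\<in>Q. \<psi> w \<ge> u w) \<and> \<psi> z = u z"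
      and S: "\<forall>\<psi>. C2_on Q \<psi> \<and> (\<forall>w\<in>Q. \<psi> w \<le> - u w) \<and> \<psi> z = - u z \<longrightarrow>
        pucci_minus l L (space_hessian Q \<psi> z) - time_deriv Q \<psi> z \<le> \<phi> (norm (space_grad Q \<psi> z))"
    have B: "C2_on Q \<psi>" using A by blast
    moreover have "\<forall>w\<in>Q. - \<psi> w \<le> - u w" "- \<psi> z = - u z" using A by force+
    ultimately show "pucci_plus l L (space_hessian Q \<psi> z) - time_deriv Q \<psi> z \<ge> - \<phi> (norm (space_grad Q \<psi> z))"
      using S[rule_format, of "\<lambda>w. - \<psi> w"] neg[OF B] ineq[OF z B] by simp
  qed
qed

section \<open>Localization and rescaling\<close>

lemma C2_on_const: "C2_on S (\<lambda>_. c)"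
  unfolding C2_on_iff using C2_deriv_const by blast

lemma C2_on_inner: "C2_on S (\<lambda>z. a \<bullet> z)"
  unfolding C2_on_iff using C2_deriv_inner by blast

lemma C2_on_add: "C2_on S f \<Longrightarrow> C2_on S g \<Longrightarrow> C2_on S (\<lambda>z. f z + g z)"
  unfolding C2_on_iff using C2_deriv_add by blast

lemma C2_on_diff: "C2_on S f \<Longrightarrow> C2_on S g \<Longrightarrow> C2_on S (\<lambda>z. f z - g z)"
  unfolding C2_on_iff using C2_deriv_diff by blast

lemma C2_on_mult: "C2_on S f \<Longrightarrow> C2_on S g \<Longrightarrow> C2_on S (\<lambda>z. f z * g z)"
  unfolding C2_on_iff using C2_deriv_mult by blast

lemma C2_on_comp:
  assumes "C2_on S g"
    and "\<And>y. y \<in> g ` S \<Longrightarrow> (h has_real_derivative h' y) (at y)"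
    and "\<And>y. y \<in> g ` S \<Longrightarrow> (h' has_real_derivative h'' y) (at y)"
    and "continuous_on (g ` S) h''"
  shows "C2_on S (\<lambda>z. h (g z))"
proof -
  obtain g' g'' where "C2_deriv S g g' g''" using assms(1) unfolding C2_on_iff by blast
  from C2_deriv_comp[OF this assms(2,3,4)] show ?thesis unfolding C2_on_iff by blast
qed

lemma C2_on_prod:
  assumes "finite I" "\<And>i. i \<in> I \<Longrightarrow> C2_on S (f i)"
  shows "C2_on S (\<lambda>z. \<Prod>i\<in>I. f i z)"
  using assms by (induction I rule: finite_induct) (auto intro: C2_on_const C2_on_mult)

section \<open>Twice differentiable majorants\<close>

lemma at_within_halfline:
  fixes y :: real
  assumes "0 \<le> y"
  shows "at y within {0..y + 1} = at y within {0..}"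
  using assms by (intro at_within_nhd[of y "{..<y + 1}"]) auto

text \<open>\<open>g y\<close> is the average of \<open>f\<close> over \<open>{y..y + 1}\<close>. It
  gains one order of smoothness, and because the window lies to the right of \<open>y\<close> and
  \<open>\<Omega>\<close> is monotone, it stays above \<open>\<Omega>\<close>.\<close>

lemma integral_window_majorant:
  fixes f \<Omega> :: "real \<Rightarrow> real"
  assumes int: "\<And>b. f integrable_on {0..b}" and mono: "mono_on {0..} \<Omega>"
    and le: "\<And>y. y \<ge> 0 \<Longrightarrow> \<Omega> y \<le> f y"
  defines "g \<equiv> \<lambda>y. integral {0..y + 1} f - integral {0..y} f"
  shows "continuous_on {0..} g" "\<And>y. y \<ge> 0 \<Longrightarrow> \<Omega> y \<le> g y"
    "continuous_on {0..} f \<Longrightarrow> y > 0 \<Longrightarrow> DERIV g y :> f (y + 1) - f y"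
proof -
  let ?F = "\<lambda>y. integral {0..y} f"
  have F: "continuous_on {0..} ?F"
    unfolding continuous_on_eq_continuous_within
  proof
    fix y :: real assume "y \<in> {0..}"
    moreover have "continuous (at y within {0..y + 1}) ?F"
      using indefinite_integral_continuous_1[OF int[of "y + 1"]] \<open>y \<in> {0..}\<close>
      unfolding continuous_on_eq_continuous_within by auto
    ultimately show "continuous (at y within {0..}) ?F"
      using at_within_halfline[of y] by simp
  qed
  have F1: "continuous_on {0..} (\<lambda>y. ?F (y + 1))"
    by (rule continuous_on_compose2[OF F]) (auto intro!: continuous_intros)
  show "continuous_on {0..} g"
    unfolding g_def by (intro continuous_on_diff F F1)
  show "\<Omega> y \<le> g y" if y: "y \<ge> 0" for y
  proof -
    have "g y = integral {y..y + 1} f"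
      unfolding g_def using Henstock_Kurzweil_Integration.integral_combine[of 0 y "y + 1" f] int y by simp
    moreover have "integral {y..y + 1} (\<lambda>_. \<Omega> y) \<le> integral {y..y + 1} f"
    proof (rule integral_le)
      show "f integrable_on {y..y + 1}"
        using int[of "y + 1"] by (rule integrable_on_subinterval) (use y in auto)
      fix s assume "s \<in> {y..y + 1}"
      then have "\<Omega> y \<le> \<Omega> s" using mono y by (auto simp: mono_on_def)
      also have "\<dots> \<le> f s" using \<open>s \<in> {y..y + 1}\<close> y by (intro le) auto
      finally show "\<Omega> y \<le> f s" .
    qed auto
    ultimately show ?thesis by simp
  qed
  assume cont: "continuous_on {0..} f" and y: "y > 0"
  have D: "DERIV ?F y :> f y" if y: "y > 0" for y
  proof -
    have "(?F has_real_derivative f y) (at y within {0..y + 1})"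
      using cont y by (intro integral_has_real_derivative) (auto intro: continuous_on_subset)
    moreover have "at y within {0..y + 1} = at y" using y by (intro at_within_interior) auto
    ultimately show ?thesis by simp
  qed
  have "DERIV (\<lambda>y. ?F (y + 1)) y :> f (y + 1)"
    using DERIV_shift[of ?F "f (y + 1)" y 1] D[of "y + 1"] y by simp
  then show "DERIV g y :> f (y + 1) - f y"
    unfolding g_def using D[OF y] by (rule DERIV_diff)
qed

text \<open>Three averages are taken: a monotone function is integrable, its average
  \<open>g0\<close> is continuous, \<open>g1\<close> is once and \<open>g2\<close> twice
  continuously differentiable on the open half-line.\<close>

lemma mono_C2_majorant:
  fixes \<Omega> :: "real \<Rightarrow> real"
  assumes mono: "mono_on {0..} \<Omega>"
  obtains F F1 F2 where "\<And>y. y > 0 \<Longrightarrow> DERIV F y :> F1 y" "\<And>y. y > 0 \<Longrightarrow> DERIV F1 y :> F2 y"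
    "continuous_on {0<..} F2" "\<And>y. y > 0 \<Longrightarrow> \<Omega> y \<le> F y"
proof -
  define W where "W f y = integral {0..y + 1} f - integral {0..y} f" for f :: "real \<Rightarrow> real" and y
  note win = integral_window_majorant[OF _ mono, folded W_def]
  have int0: "\<Omega> integrable_on {0..b}" for b
    by (intro integrable_on_mono_on) (use mono in \<open>auto simp: mono_on_def\<close>)
  have int: "f integrable_on {0..b}" if "continuous_on {0..} f" for f :: "real \<Rightarrow> real" and b
    using that by (intro integrable_continuous_interval) (auto intro: continuous_on_subset)
  define g0 where "g0 = W \<Omega>"
  have g0: "continuous_on {0..} g0" "\<And>y. y \<ge> 0 \<Longrightarrow> \<Omega> y \<le> g0 y"
    unfolding g0_def by (rule win(1,2)[OF int0]; simp)+
  define g1 where "g1 = W g0"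
  have g1: "continuous_on {0..} g1" "\<And>y. y \<ge> 0 \<Longrightarrow> \<Omega> y \<le> g1 y"
    "\<And>y. y > 0 \<Longrightarrow> DERIV g1 y :> g0 (y + 1) - g0 y"
    unfolding g1_def by (rule win[OF int[OF g0(1)]]; use g0 in simp)+
  define g2 where "g2 = W g1"
  have g2: "\<And>y. y \<ge> 0 \<Longrightarrow> \<Omega> y \<le> g2 y" "\<And>y. y > 0 \<Longrightarrow> DERIV g2 y :> g1 (y + 1) - g1 y"
    unfolding g2_def by (rule win(2,3)[OF int[OF g1(1)]]; use g1 in simp)+
  show thesis
  proof (rule that[of g2 "\<lambda>y. g1 (y + 1) - g1 y" "\<lambda>y. (g0 (y + 2) - g0 (y + 1)) - (g0 (y + 1) - g0 y)"])
    fix y :: real assume y: "y > 0"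
    show "DERIV g2 y :> g1 (y + 1) - g1 y" using g2(2)[OF y] .
    have "DERIV (\<lambda>y. g1 (y + 1)) y :> g0 (y + 2) - g0 (y + 1)"
      using DERIV_shift[of g1 "g0 (y + 2) - g0 (y + 1)" y 1] g1(3)[of "y + 1"] y by (simp add: add.assoc)
    then show "DERIV (\<lambda>y. g1 (y + 1) - g1 y) y :> (g0 (y + 2) - g0 (y + 1)) - (g0 (y + 1) - g0 y)"
      using g1(3)[OF y] by (rule DERIV_diff)
    show "\<Omega> y \<le> g2 y" using g2(1) y by simp
  next
    show "continuous_on {0<..} (\<lambda>y. (g0 (y + 2) - g0 (y + 1)) - (g0 (y + 1) - g0 y))"
      by (intro continuous_on_diff; rule continuous_on_compose2[OF g0(1)]) (auto intro!: continuous_intros)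
  qed
qed

text \<open>The weight \<open>D\<close> is positive in the cube and vanishes on its parabolic boundary, so that
  \<open>1 / D\<close> exhausts the cube by compact sets.\<close>

lemma parabolic_cube_C2_majorant:
  fixes u :: "(real ^ 'n) \<times> real \<Rightarrow> real"
  defines "Q \<equiv> parabolic_cube 2 0 0 :: ((real ^ 'n) \<times> real) set"
  assumes u: "continuous_on Q u"
  obtains G where "C2_on Q G" "\<And>z. z \<in> Q \<Longrightarrow> \<bar>u z\<bar> \<le> G z"
proof -
  define D where "D z = (\<Prod>i\<in>UNIV. 4 - (fst z $ i) * (fst z $ i)) * (snd z + 4)" for z :: "(real ^ 'n) \<times> real"
  define box where "box = {z :: (real ^ 'n) \<times> real. infnorm (fst z) \<le> 2 \<and> - 4 \<le> snd z \<and> snd z \<le> 0}"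
  have comp: "\<bar>x $ i\<bar> < a" if "infnorm x < a" for x :: "real ^ 'n" and i a
    using component_le_infnorm_cart[of x i] that by simp
  have inf_lt: "infnorm x < a" if "\<And>i. \<bar>x $ i\<bar> < a" for x :: "real ^ 'n" and a
  proof -
    have "infnorm x = Max (range (\<lambda>i. \<bar>x $ i\<bar>))"
      unfolding infnorm_cart by (subst cSup_eq_Max[symmetric]) (auto simp: full_SetCompr_eq)
    then show ?thesis using that by (simp add: Max_less_iff)
  qed
  have sq: "4 - a * a > 0" if "\<bar>a\<bar> < 2" for a :: real
    using abs_mult_less[OF that that] by simp
  have Dpos: "D z > 0" if "z \<in> Q" for z
    using that unfolding D_def Q_def parabolic_cube_def
    by (auto intro!: mult_pos_pos prod_pos sq comp)
  have Q_box: "z \<in> Q" if "z \<in> box" "D z \<noteq> 0" for z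
  proof -
    have "4 - fst z $ i * fst z $ i \<noteq> 0" for i using that(2) by (auto simp: D_def)
    moreover have "\<bar>fst z $ i\<bar> \<le> 2" for i
      using component_le_infnorm_cart[of "fst z" i] that(1) by (simp add: box_def)
    ultimately have "\<bar>fst z $ i\<bar> < 2" for i
      by (metis abs_mult_self_eq diff_self less_le mult_2 numeral_Bit0 numeral_times_numeral semiring_norm(13) semiring_norm(11))
    then have "infnorm (fst z) < 2" by (rule inf_lt)
    moreover have "snd z \<noteq> - 4" using that(2) by (auto simp: D_def)
    ultimately show ?thesis using that(1) by (cases z) (auto simp: Q_def parabolic_cube_def box_def)
  qed
  have coord: "fst z $ i = (axis i 1, 0) \<bullet> z" "snd z = (0, 1) \<bullet> z" for z :: "(real ^ 'n) \<times> real" and i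
    by (cases z; simp add: inner_axis')+
  have DC2: "C2_on S D" for S
    unfolding D_def coord by (intro C2_on_mult C2_on_prod C2_on_diff C2_on_add C2_on_const C2_on_inner) auto
  then have Dcont: "continuous_on UNIV D"
    unfolding C2_on_iff using C2_deriv_continuous(1) by blast
  have "compact box"
    unfolding box_def by (rule compact_closed_cylinder)
  \<comment> \<open>For positive \<open>y\<close> this is the set where
    \<open>D \<ge> 1 / y\<close>. It is compact because \<open>D\<close> vanishes at the points of
    \<open>box\<close> outside the cube.\<close>
  define K where "K y = {z \<in> Q. 1 \<le> y * D z}" for y
  have "Q \<subseteq> box" by (auto simp: box_def Q_def parabolic_cube_def)
  then have Keq: "K y = box \<inter> {z. 1 \<le> y * D z}" for y
    using Q_box unfolding K_def by force
  have "compact (K y)" if "y \<ge> 0" for y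
    unfolding Keq using \<open>compact box\<close>
    by (intro compact_Int_closed closed_Collect_le continuous_intros Dcont)
  then have bdd: "bdd_above ((\<lambda>z. \<bar>u z\<bar>) ` K y)" if "y \<ge> 0" for y
    using that u by (intro bounded_imp_bdd_above compact_imp_bounded compact_continuous_image
        continuous_on_rabs) (auto simp: K_def intro: continuous_on_subset)
  \<comment> \<open>The inserted \<open>0\<close> keeps the supremum meaningful when
    \<open>K y\<close> is empty, as for small \<open>y\<close>.\<close>
  define \<Omega> where "\<Omega> y = Sup (insert 0 ((\<lambda>z. \<bar>u z\<bar>) ` K y))" for y
  have "mono_on {0..} \<Omega>"
  proof (rule mono_onI)
    fix y y' :: real assume y: "y \<in> {0..}" "y' \<in> {0..}" "y \<le> y'"
    have "K y \<subseteq> K y'"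
    proof
      fix z assume "z \<in> K y"
      then have "z \<in> Q" "1 \<le> y * D z" by (auto simp: K_def)
      moreover have "y * D z \<le> y' * D z" using y Dpos[OF \<open>z \<in> Q\<close>] by (intro mult_right_mono) auto
      ultimately show "z \<in> K y'" by (simp add: K_def)
    qed
    then show "\<Omega> y \<le> \<Omega> y'"
      unfolding \<Omega>_def using bdd[of y'] y by (intro cSup_subset_mono) auto
  qed
  then obtain F F1 F2 where F: "\<And>y. y > 0 \<Longrightarrow> DERIV F y :> F1 y" "\<And>y. y > 0 \<Longrightarrow> DERIV F1 y :> F2 y"
    "continuous_on {0<..} F2" "\<And>y. y > 0 \<Longrightarrow> \<Omega> y \<le> F y"
    using mono_C2_majorant by metis
  have inv: "C2_on Q (\<lambda>z. inverse (D z))"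
  proof (rule C2_on_comp[where h = inverse and g = D and h' = "\<lambda>y. - (inverse y ^ 2)"
        and h'' = "\<lambda>y. 2 * inverse y ^ 3"])
    show "C2_on Q D" by (rule DC2)
    fix y assume "y \<in> D ` Q"
    then have y: "y \<noteq> 0" using Dpos by force
    show "(inverse has_real_derivative - (inverse y)\<^sup>2) (at y)"
      using DERIV_inverse[OF y] by (simp add: numeral_2_eq_2)
    show "((\<lambda>y. - (inverse y)\<^sup>2) has_real_derivative 2 * inverse y ^ 3) (at y)"
      using y by (auto intro!: derivative_eq_intros simp: power2_eq_square power3_eq_cube)
  next
    show "continuous_on (D ` Q) (\<lambda>y. 2 * inverse y ^ 3)"
      using Dpos by (intro continuous_intros) force
  qed
  have pos: "inverse (D z) > 0" if "z \<in> Q" for z using Dpos[OF that] by simp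
  show thesis
  proof (rule that[of "\<lambda>z. F (inverse (D z))"])
    show "C2_on Q (\<lambda>z. F (inverse (D z)))"
      by (rule C2_on_comp[OF inv, where h = F and h' = F1 and h'' = F2])
        (use F pos in \<open>auto intro: continuous_on_subset\<close>)
    fix z assume z: "z \<in> Q"
    have "z \<in> K (inverse (D z))" using z Dpos[OF z] by (simp add: K_def)
    then have "\<bar>u z\<bar> \<le> \<Omega> (inverse (D z))"
      unfolding \<Omega>_def using bdd[of "inverse (D z)"] pos[OF z] by (intro cSup_upper) auto
    also have "\<dots> \<le> F (inverse (D z))" using F(4) pos[OF z] by blast
    finally show "\<bar>u z\<bar> \<le> F (inverse (D z))" .
  qed
qed

section \<open>A twice differentiable cutoff\<close>

lemma DERIV_pos_part_power:
  fixes s :: real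
  assumes "n \<ge> 2"
  shows "DERIV (\<lambda>s. (max 0 s) ^ n) s :> real n * (max 0 s) ^ (n - 1)"
proof -
  consider "s < 0" | "s > 0" | "s = 0" by linarith
  then show ?thesis
  proof cases
    case 1
    have "DERIV (\<lambda>_. 0 :: real) s :> 0" by simp
    then have "DERIV (\<lambda>s. (max 0 s) ^ n) s :> 0"
      by (rule has_field_derivative_transform_within_open[of _ _ _ "{..<0}"]) (use 1 assms in auto)
    then show ?thesis using 1 assms by (simp add: power_0_left)
  next
    case 2
    have "DERIV (\<lambda>s. s ^ n) s :> real n * s ^ (n - 1)" using DERIV_pow[of n s] by simp
    then have "DERIV (\<lambda>s. (max 0 s) ^ n) s :> real n * s ^ (n - 1)"
      by (rule has_field_derivative_transform_within_open[of _ _ _ "{0<..}"]) (use 2 in auto)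
    then show ?thesis using 2 by simp
  next
    case 3
    have "((\<lambda>h :: real. (max 0 h) ^ n / h) \<longlongrightarrow> 0) (at 0)"
    proof (rule Lim_null_comparison)
      have "norm ((max 0 h) ^ n / h) \<le> \<bar>h\<bar> ^ (n - 1)" for h :: real
      proof -
        obtain m where "n = Suc m" using assms by (cases n) auto
        then show ?thesis by (cases "h > 0") (simp_all add: max_def)
      qed
      then show "\<forall>\<^sub>F h in at 0. norm ((max 0 h) ^ n / h) \<le> \<bar>h\<bar> ^ (n - 1)" by simp
      have "((\<lambda>h. \<bar>h\<bar> ^ (n - 1)) \<longlongrightarrow> \<bar>0 :: real\<bar> ^ (n - 1)) (at 0)" by (intro tendsto_intros)
      then show "((\<lambda>h. \<bar>h :: real\<bar> ^ (n - 1)) \<longlongrightarrow> 0) (at 0)" using assms by (simp add: power_0_left)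
    qed
    then show ?thesis using 3 assms by (simp add: DERIV_def power_0_left)
  qed
qed

text \<open>The third power is the lowest one that is twice continuously differentiable across
  \<open>y = 1\<close>. The argument will be a squared distance, so that \<open>y * y\<close> is of
  fourth order at the centre.\<close>

definition bump :: "real \<Rightarrow> real" where "bump y = (max 0 (1 - y * y)) ^ 3"
definition bump1 :: "real \<Rightarrow> real" where "bump1 y = - 6 * y * (max 0 (1 - y * y)) ^ 2"
definition bump2 :: "real \<Rightarrow> real" where
  "bump2 y = - 6 * (max 0 (1 - y * y)) ^ 2 + 24 * (y * y) * max 0 (1 - y * y)"

lemma DERIV_bump: "DERIV bump y :> bump1 y" "DERIV bump1 y :> bump2 y"
proof -
  have q: "DERIV (\<lambda>y. 1 - y * y) y :> - 2 * y" by (auto intro!: derivative_eq_intros)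
  have p: "DERIV (\<lambda>y. (max 0 (1 - y * y)) ^ n) y :> real n * (max 0 (1 - y * y)) ^ (n - 1) * (- 2 * y)"
    if "n \<ge> 2" for n
    by (rule DERIV_chain2[OF DERIV_pos_part_power[OF that] q])
  show "DERIV bump y :> bump1 y"
    unfolding bump_def[abs_def] bump1_def using p[of 3] by (simp add: mult_ac)
  have "DERIV (\<lambda>y. - 6 * y * (max 0 (1 - y * y)) ^ 2) y :>
      - 6 * y * (real 2 * (max 0 (1 - y * y)) ^ (2 - 1) * (- 2 * y)) + - 6 * (max 0 (1 - y * y)) ^ 2"
    using DERIV_mult'[OF DERIV_cmult_Id[of "- 6"] p[of 2]] by simp
  then show "DERIV bump1 y :> bump2 y"
    unfolding bump1_def[abs_def] bump2_def by (simp add: algebra_simps)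
qed

lemma bump_range: "0 \<le> bump y" "bump y \<le> 1"
proof -
  show "0 \<le> bump y" by (simp add: bump_def)
  have "max 0 (1 - y * y) ^ 3 \<le> 1 ^ 3" by (intro power_mono) auto
  then show "bump y \<le> 1" by (simp add: bump_def)
qed

lemma bump_outside: "1 \<le> y \<Longrightarrow> bump y = 0 \<and> bump1 y = 0 \<and> bump2 y = 0"
  using mult_mono[of 1 y 1 y] by (auto simp: bump_def bump1_def bump2_def max_def)

lemma C2_deriv_sqdist:
  fixes z :: "'a::euclidean_space"
  shows "C2_deriv S (\<lambda>w. (w - z) \<bullet> (w - z)) (\<lambda>w. 2 *\<^sub>R blinfun_inner_right (w - z))
    (\<lambda>_. 2 *\<^sub>R Blinfun blinfun_inner_right)"
  unfolding C2_deriv_def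
proof (intro conjI ballI)
  fix w assume "w \<in> S"
  show "((\<lambda>w. (w - z) \<bullet> (w - z)) has_derivative (2 *\<^sub>R blinfun_inner_right (w - z))) (at w within S)"
    by (rule has_derivative_eq_rhs, (rule derivative_intros)+)
      (simp add: fun_eq_iff blinfun.scaleR_left inner_commute)
  have "((\<lambda>w. blinfun_inner_right (w - z)) has_derivative blinfun_inner_right) (at w within S)"
    by (rule has_derivative_eq_rhs, rule bounded_linear.has_derivative[OF bounded_linear_blinfun_inner_right],
        (rule derivative_intros)+) simp
  from has_derivative_scaleR_right[OF this, of 2]
  show "((\<lambda>w. 2 *\<^sub>R blinfun_inner_right (w - z)) has_derivative (2 *\<^sub>R Blinfun blinfun_inner_right)) (at w within S)"
    by (rule has_derivative_eq_rhs)
      (simp add: fun_eq_iff blinfun.scaleR_left bounded_linear_Blinfun_apply[OF bounded_linear_blinfun_inner_right])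
qed (rule continuous_on_const)

text \<open>The bump function is flat to third order at its centre, so that multiplying with it does
  not change the jet there.\<close>

lemma C2_bump:
  fixes z :: "'a::euclidean_space"
  assumes "\<delta> > 0"
  obtains k k' k'' where "\<And>S. C2_deriv S k k' k''" "\<And>w. 0 \<le> k w" "\<And>w. k w \<le> 1"
    "k z = 1" "k' z = 0" "k'' z = 0"
    "\<And>w. w \<notin> ball z \<delta> \<Longrightarrow> k w = 0 \<and> k' w = 0 \<and> k'' w = 0"
proof -
  let ?d = "\<lambda>w. 1 / \<delta>\<^sup>2 * ((w - z) \<bullet> (w - z))"
  let ?d' = "\<lambda>w. (1 / \<delta>\<^sup>2) *\<^sub>R (2 *\<^sub>R blinfun_inner_right (w - z))"
  let ?d'' = "\<lambda>w :: 'a. (1 / \<delta>\<^sup>2) *\<^sub>R (2 *\<^sub>R Blinfun blinfun_inner_right) :: 'a \<Rightarrow>\<^sub>L 'a \<Rightarrow>\<^sub>L real"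
  have d: "C2_deriv S ?d ?d' ?d''" for S by (rule C2_deriv_cmult[OF C2_deriv_sqdist])
  have c: "continuous_on X bump2" for X unfolding bump2_def[abs_def] by (intro continuous_intros)
  note k = C2_deriv_comp[OF d DERIV_bump c]
  have out: "1 \<le> ?d w" if "w \<notin> ball z \<delta>" for w
  proof -
    have "\<delta>\<^sup>2 \<le> (dist w z)\<^sup>2" using that assms by (intro power_mono) (auto simp: dist_commute)
    then show ?thesis using assms by (simp add: dist_norm power2_norm_eq_inner field_simps)
  qed
  have z0: "blinfun_inner_right (z - z) = 0" by (rule blinfun_eqI) simp
  show thesis
  proof (rule that[OF k])
    show "bump1 (?d z) *\<^sub>R ?d' z = 0" unfolding z0 by simp
    show "bump1 (?d z) *\<^sub>R ?d'' z + bump2 (?d z) *\<^sub>R (blinfun_scaleR_left (?d' z) o\<^sub>L ?d' z) = 0"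
      unfolding z0 by (auto simp: bump1_def intro!: blinfun_eqI)
    show "bump (?d w) = 0 \<and> bump1 (?d w) *\<^sub>R ?d' w = 0 \<and>
        bump1 (?d w) *\<^sub>R ?d'' w + bump2 (?d w) *\<^sub>R (blinfun_scaleR_left (?d' w) o\<^sub>L ?d' w) = 0"
      if "w \<notin> ball z \<delta>" for w
      using bump_outside[OF out[OF that]] by simp
  qed (auto simp: bump_range, simp add: bump_def)
qed

text \<open>A local notion: test functions live on an open neighbourhood of the touching point,
  hence touch both before and after it in time. This form restricts to subsets and transforms
  directly under rescaling, whereas in \<open>viscosity_supersolution\<close> the test functions are
  tied to the whole cube.\<close>

definition interior_supersolution ::
  "real \<Rightarrow> real \<Rightarrow> (real \<Rightarrow> real) \<Rightarrow> ((real ^ 'n) \<times> real) set \<Rightarrow> ((real ^ 'n) \<times> real \<Rightarrow> real) \<Rightarrow> bool" where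
  "interior_supersolution l L \<phi> U u \<longleftrightarrow> (\<forall>z\<in>U. \<forall>B \<psi> \<psi>' \<psi>''.
     open B \<and> z \<in> B \<and> B \<subseteq> U \<and> C2_deriv B \<psi> \<psi>' \<psi>'' \<and> (\<forall>w\<in>B. \<psi> w \<le> u w) \<and> \<psi> z = u z \<longrightarrow>
       pucci_minus l L (jet_hessian (\<psi>'' z)) - blinfun_apply (\<psi>' z) (0, 1) \<le> \<phi> (norm (jet_grad (\<psi>' z))))"

lemma interior_supersolutionD:
  assumes u: "interior_supersolution l L \<phi> U u" and B: "open B" "z \<in> B" "B \<subseteq> U"
    and \<psi>: "C2_deriv B \<psi> \<psi>' \<psi>''" "\<And>w. w \<in> B \<Longrightarrow> \<psi> w \<le> u w" "\<psi> z = u z"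
  shows "pucci_minus l L (jet_hessian (\<psi>'' z)) - blinfun_apply (\<psi>' z) (0, 1) \<le> \<phi> (norm (jet_grad (\<psi>' z)))"
proof -
  have z: "z \<in> U" using B by blast
  have c: "open B \<and> z \<in> B \<and> B \<subseteq> U \<and> C2_deriv B \<psi> \<psi>' \<psi>'' \<and> (\<forall>w\<in>B. \<psi> w \<le> u w) \<and> \<psi> z = u z"
    using B \<psi> by simp
  show ?thesis
    by (rule bspec[OF u[unfolded interior_supersolution_def] z, THEN spec, THEN spec, THEN spec, THEN spec, THEN mp, OF c])
qed

text \<open>The local test function is extended by interpolation with \<open>- G0\<close>, where
  \<open>G0\<close> majorizes \<open>\<bar>u\<bar>\<close>; a constant would not do, as
  \<open>u\<close> may be unbounded near the parabolic boundary. Both functions lie below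
  \<open>u\<close>, hence so does the interpolation, and the flat cutoff keeps the jet at
  \<open>z\<close>.\<close>

lemma viscosity_supersolution_interior:
  fixes u :: "(real ^ 'n) \<times> real \<Rightarrow> real"
  defines "Q \<equiv> parabolic_cube 2 0 0"
  assumes u: "viscosity_supersolution l L \<phi> Q u" "continuous_on Q u" and U: "U \<subseteq> Q"
  shows "interior_supersolution l L \<phi> U u"
  unfolding interior_supersolution_def
proof (intro ballI allI impI, elim conjE)
  fix z B \<psi> \<psi>' \<psi>''
  assume B: "open B" "z \<in> B" "B \<subseteq> U" and \<psi>: "C2_deriv B \<psi> \<psi>' \<psi>''" and le: "\<forall>w\<in>B. \<psi> w \<le> u w" and eq: "\<psi> z = u z"
  obtain G0 where "C2_on Q G0" and G: "\<And>w. w \<in> Q \<Longrightarrow> \<bar>u w\<bar> \<le> G0 w"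
    using parabolic_cube_C2_majorant[OF u(2)[unfolded Q_def]] unfolding Q_def by blast
  then obtain G' G'' where GC: "C2_deriv Q G0 G' G''" unfolding C2_on_iff by blast
  have BQ: "B \<subseteq> Q" using B U by simp
  obtain \<delta> where \<delta>: "\<delta> > 0" "cball z \<delta> \<subseteq> B" using B open_contains_cball by blast
  obtain k k' k'' where chi: "\<And>S. C2_deriv S k k' k''" "\<And>w. 0 \<le> k w" "\<And>w. k w \<le> 1"
    "k z = 1" "k' z = 0" "k'' z = 0"
    "\<And>w. w \<notin> ball z \<delta> \<Longrightarrow> k w = 0 \<and> k' w = 0 \<and> k'' w = 0"
    using C2_bump[OF \<delta>(1), of z] by metis
  note in1 = C2_deriv_mult[OF chi(1) \<psi>]
  note in2 = C2_deriv_mult[OF C2_deriv_diff[OF C2_deriv_const[of B 1] chi(1)] C2_deriv_subset[OF GC BQ]]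
  have QB: "Q \<inter> B = B" using BQ by blast
  note glue = C2_deriv_glue[where S = Q and U = B and V = "- cball z \<delta>", unfolded QB,
      OF C2_deriv_diff[OF in1 in2] C2_deriv_uminus[OF C2_deriv_subset[OF GC Int_lower1]]]
  define \<Psi> where "\<Psi> w = (if w \<in> B then k w * \<psi> w - (1 - k w) * G0 w else - G0 w)" for w
  let ?f1 = "\<lambda>w. k w *\<^sub>R \<psi>' w + \<psi> w *\<^sub>R k' w - ((1 - k w) *\<^sub>R G' w + G0 w *\<^sub>R (0 - k' w))"
  let ?f2 = "\<lambda>w. k w *\<^sub>R \<psi>'' w + \<psi> w *\<^sub>R k'' w + (blinfun_scaleR_left (\<psi>' w) o\<^sub>L k' w)
      + (blinfun_scaleR_left (k' w) o\<^sub>L \<psi>' w)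
      - ((1 - k w) *\<^sub>R G'' w + G0 w *\<^sub>R (0 - k'' w) + (blinfun_scaleR_left (G' w) o\<^sub>L (0 - k' w))
      + (blinfun_scaleR_left (0 - k' w) o\<^sub>L G' w))"
  obtain \<Psi>' \<Psi>'' where \<Psi>: "C2_deriv Q \<Psi> \<Psi>' \<Psi>''" "\<Psi>' z = \<psi>' z" "\<Psi>'' z = \<psi>'' z"
  proof (rule that)
    show "C2_deriv Q \<Psi>
      (\<lambda>w. if w \<in> B then ?f1 w else - G' w)
      (\<lambda>w. if w \<in> B then ?f2 w else - G'' w)"
      unfolding \<Psi>_def[abs_def]
    \<comment> \<open>The two open sets overlap only outside the closed ball, where the cutoff
      vanishes with its derivatives and both formulas give \<open>- G0\<close>.\<close>
    proof (rule glue)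
      show "open B" by (rule B(1))
      show "open (- cball z \<delta>)" by auto
      show "Q \<subseteq> B \<union> - cball z \<delta>" using \<delta> by auto
      fix w assume "w \<in> B \<inter> - cball z \<delta>"
      then have "w \<notin> ball z \<delta>" by auto
      from chi(7)[OF this] show "k w * \<psi> w - (1 - k w) * G0 w = - G0 w \<and>
         ?f1 w = - G' w \<and>
         ?f2 w = - G'' w"
        by (auto intro!: blinfun_eqI simp: blinfun.minus_left)
    qed
  next
    show "(if z \<in> B then ?f1 z else - G' z) = \<psi>' z"
      using B chi by simp
    show "(if z \<in> B then ?f2 z else - G'' z) = \<psi>'' z"
      using B chi by (auto intro!: blinfun_eqI)
  qed
  have "\<Psi> w \<le> u w" if w: "w \<in> Q" for w
  proof (cases "w \<in> B")
    case True
    have "k w * \<psi> w + (1 - k w) * (- G0 w) \<le> k w * u w + (1 - k w) * u w"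
      using True le chi(2,3)[of w] G[OF w] by (intro add_mono mult_left_mono) auto
    then show ?thesis using True by (simp add: \<Psi>_def algebra_simps)
  qed (use G[OF w] in \<open>auto simp: \<Psi>_def\<close>)
  moreover have "\<Psi> z = u z" using B eq chi(4) by (simp add: \<Psi>_def)
  moreover have "z \<in> Q" using B BQ by blast
  ultimately show "pucci_minus l L (jet_hessian (\<psi>'' z)) - blinfun_apply (\<psi>' z) (0, 1) \<le> \<phi> (norm (jet_grad (\<psi>' z)))"
    using u(1) \<Psi> unfolding Q_def viscosity_supersolution_iff by metis
qed

text \<open>The parabolic rescaling multiplies the Hessian and the time derivative by \<open>\<mu> / r\<^sup>2\<close> and the
  gradient by \<open>\<mu> / r\<close>; the factor that (P3) produces is absorbed by the smallness of \<open>r \<eta>(\<mu> / r)\<close>.\<close>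

lemma interior_supersolution_scale:
  fixes u :: "(real ^ 'n) \<times> real \<Rightarrow> real"
  assumes u: "interior_supersolution l L \<phi> U u" and V: "\<And>y s. (y, s) \<in> V \<Longrightarrow> (x1 + r *\<^sub>R y, t1 + r\<^sup>2 * s) \<in> U"
    and r: "r > 0" and \<mu>: "\<mu> > 0"
    and \<phi>: "\<And>t. t \<ge> 0 \<Longrightarrow> \<phi> t = \<eta> t * t" and ge1: "\<And>t. t > 0 \<Longrightarrow> 1 \<le> \<eta> t"
    and P3: "\<And>s t. s > 0 \<Longrightarrow> t > 0 \<Longrightarrow> \<eta> (s * t) \<le> \<Lambda> * \<eta> s * \<eta> t"
    and small: "r * \<Lambda> * \<eta> (\<mu> / r) \<le> 1"
  shows "interior_supersolution l L \<phi> V (\<lambda>(y, s). u (x1 + r *\<^sub>R y, t1 + r\<^sup>2 * s) / \<mu> + \<delta>)"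
  unfolding interior_supersolution_def
proof (intro ballI allI impI, elim conjE)
  fix z B \<psi> \<psi>' \<psi>''
  assume B: "open B" "z \<in> B" "B \<subseteq> V" and \<psi>: "C2_deriv B \<psi> \<psi>' \<psi>''"
    and le: "\<forall>w\<in>B. \<psi> w \<le> (case w of (y, s) \<Rightarrow> u (x1 + r *\<^sub>R y, t1 + r\<^sup>2 * s) / \<mu> + \<delta>)"
    and eq: "\<psi> z = (case z of (y, s) \<Rightarrow> u (x1 + r *\<^sub>R y, t1 + r\<^sup>2 * s) / \<mu> + \<delta>)"
  \<comment> \<open>The linear part of the inverse rescaling: \<open>\<lambda>p. A p + b\<close>
    inverts \<open>T\<close> and carries a test function for the rescaled function back to one for
    \<open>u\<close>.\<close>
  define A :: "((real ^ 'n) \<times> real) \<Rightarrow>\<^sub>L ((real ^ 'n) \<times> real)" where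
    "A = Blinfun (\<lambda>p. ((1 / r) *\<^sub>R fst p, (1 / r\<^sup>2) *\<^sub>R snd p))"
  have A: "blinfun_apply A p = ((1 / r) *\<^sub>R fst p, (1 / r\<^sup>2) *\<^sub>R snd p)" for p
    unfolding A_def
    by (subst bounded_linear_Blinfun_apply)
      (intro bounded_linear_Pair bounded_linear_compose[OF bounded_linear_scaleR_right bounded_linear_fst]
        bounded_linear_compose[OF bounded_linear_scaleR_right bounded_linear_snd] refl)+
  define b where "b = ((- 1 / r) *\<^sub>R x1, - t1 / r\<^sup>2)"
  define T where "T = (\<lambda>(y, s). (x1 + r *\<^sub>R y, t1 + r\<^sup>2 * s))"
  have AT: "A (T q) + b = q" for q
    using r by (cases q) (simp add: A T_def b_def scaleR_right_distrib field_simps)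
  have TA: "T (A p + b) = p" for p
    using r by (cases p) (simp add: A T_def b_def scaleR_right_distrib field_simps)
  define B' where "B' = (\<lambda>p. A p + b) -` B"
  have B'T: "B' = T ` B"
  proof
    show "B' \<subseteq> T ` B" unfolding B'_def using TA by (metis image_eqI subsetI vimageD)
    show "T ` B \<subseteq> B'" unfolding B'_def by (auto simp: AT)
  qed
  have "open B'" unfolding B'_def by (intro open_vimage B continuous_intros)
  have B'U: "B' \<subseteq> U" unfolding B'T T_def using V B(3) by auto
  have sub: "(\<lambda>p. A p + b) ` B' \<subseteq> B" by (auto simp: B'_def)
  obtain f2 where f2: "C2_deriv B' (\<lambda>p. \<psi> (A p + b)) (\<lambda>p. \<psi>' (A p + b) o\<^sub>L A) f2"
    "\<And>p v w. f2 p v w = \<psi>'' (A p + b) (A v) (A w)"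
    using C2_deriv_affine[OF \<psi> sub] by metis
  define \<Psi> where "\<Psi> p = \<mu> * (\<psi> (A p + b) - \<delta>)" for p
  have \<Psi>: "C2_deriv B' \<Psi> (\<lambda>p. \<mu> *\<^sub>R ((\<psi>' (A p + b) o\<^sub>L A) - 0)) (\<lambda>p. \<mu> *\<^sub>R (f2 p - 0))"
    unfolding \<Psi>_def[abs_def] by (intro C2_deriv_cmult C2_deriv_diff f2 C2_deriv_const)
  have "\<Psi> p \<le> u p" if p: "p \<in> B'" for p
  proof -
    obtain q where q: "q \<in> B" "p = T q" using p B'T by blast
    have "\<mu> * (\<psi> q - \<delta>) \<le> \<mu> * (u p / \<mu>)"
      using le q \<mu> by (intro mult_left_mono) (auto simp: T_def split: prod.splits)
    then show ?thesis using \<mu> q AT by (simp add: \<Psi>_def)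
  qed
  moreover have "\<Psi> (T z) = u (T z)"
  proof -
    have "\<Psi> (T z) = \<mu> * (\<psi> z - \<delta>)" by (simp add: \<Psi>_def AT)
    also have "\<dots> = u (T z)" using eq \<mu> by (cases z) (simp add: T_def)
    finally show ?thesis .
  qed
  moreover have "T z \<in> B'" using B'T B by blast
  ultimately have main: "pucci_minus l L (jet_hessian (\<mu> *\<^sub>R (f2 (T z) - 0))) -
      blinfun_apply (\<mu> *\<^sub>R ((\<psi>' (A (T z) + b) o\<^sub>L A) - 0)) (0, 1)
      \<le> \<phi> (norm (jet_grad (\<mu> *\<^sub>R ((\<psi>' (A (T z) + b) o\<^sub>L A) - 0))))"
    by (intro interior_supersolutionD[OF u \<open>open B'\<close> _ B'U \<Psi>]) blast+
  let ?c = "\<mu> / r\<^sup>2"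
  have A1: "A (axis i 1, 0) = (1 / r) *\<^sub>R (axis i 1, 0)" for i by (simp add: A)
  have A2: "A (0, 1) = (1 / r\<^sup>2) *\<^sub>R (0, 1)" by (simp add: A)
  have e2: "f2 (T z) (axis i 1, 0) (axis j 1, 0) = (1 / r) * ((1 / r) * \<psi>'' z (axis i 1, 0) (axis j 1, 0))" for i j
    by (simp only: f2(2) AT A1 blinfun.scaleR_left blinfun.scaleR_right real_scaleR_def)
  have e1: "(\<psi>' (A (T z) + b) o\<^sub>L A) (axis i 1, 0) = (1 / r) * \<psi>' z (axis i 1, 0)" for i
    by (simp only: AT A1 blinfun_apply_blinfun_compose blinfun.scaleR_right real_scaleR_def)
  have e0: "(\<psi>' (A (T z) + b) o\<^sub>L A) (0, 1) = (1 / r\<^sup>2) * \<psi>' z (0, 1)"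
    by (simp only: AT A2 blinfun_apply_blinfun_compose blinfun.scaleR_right real_scaleR_def)
  have h: "jet_hessian (\<mu> *\<^sub>R (f2 (T z) - 0)) = ?c *\<^sub>R jet_hessian (\<psi>'' z)"
    by (simp add: jet_hessian_def vec_eq_iff blinfun.scaleR_left e2 power2_eq_square)
  have t: "blinfun_apply (\<mu> *\<^sub>R ((\<psi>' (A (T z) + b) o\<^sub>L A) - 0)) (0, 1) = ?c * \<psi>' z (0, 1)"
    by (simp add: blinfun.scaleR_left e0 del: blinfun_apply_blinfun_compose)
  have g: "jet_grad (\<mu> *\<^sub>R ((\<psi>' (A (T z) + b) o\<^sub>L A) - 0)) = (\<mu> / r) *\<^sub>R jet_grad (\<psi>' z)"
    by (simp add: jet_grad_def vec_eq_iff blinfun.scaleR_left e1 del: blinfun_apply_blinfun_compose)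
  have c: "?c > 0" using r \<mu> by simp
  define q where "q = norm (jet_grad (\<psi>' z))"
  have "?c * (pucci_minus l L (jet_hessian (\<psi>'' z)) - \<psi>' z (0, 1)) \<le> \<phi> (\<mu> / r * q)"
    using main r \<mu> unfolding h t g pucci_minus_scale[OF c] q_def by (simp add: right_diff_distrib)
  also have "\<dots> \<le> ?c * \<phi> q"
  \<comment> \<open>(P3) concerns positive arguments only; for a vanishing gradient both sides are
    \<open>0\<close>, since \<open>\<phi> 0 = \<eta> 0 * 0\<close>.\<close>
  proof (cases "q = 0")
    case True
    then show ?thesis using \<phi>[of 0] by simp
  next
    case False
    then have q: "q > 0" by (simp add: q_def)
    have "\<phi> (\<mu> / r * q) = \<eta> (\<mu> / r * q) * (\<mu> / r * q)" using q r \<mu> by (intro \<phi>) auto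
    also have "\<dots> \<le> (\<Lambda> * \<eta> (\<mu> / r) * \<eta> q) * (\<mu> / r * q)"
      using q r \<mu> by (intro mult_right_mono P3) auto
    also have "\<dots> = (r * \<Lambda> * \<eta> (\<mu> / r)) * (?c * (\<eta> q * q))"
      using r by (simp add: field_simps power2_eq_square)
    also have "\<dots> \<le> 1 * (?c * (\<eta> q * q))"
      using c q ge1[OF q] by (intro mult_right_mono small mult_nonneg_nonneg) auto
    also have "\<dots> = ?c * \<phi> q" using \<phi>[of q] q by simp
    finally show ?thesis .
  qed
  finally have "pucci_minus l L (jet_hessian (\<psi>'' z)) - \<psi>' z (0, 1) \<le> \<phi> q"
    using c by (simp only: mult_le_cancel_left_pos)
  then show "pucci_minus l L (jet_hessian (\<psi>'' z)) - blinfun_apply (\<psi>' z) (0, 1) \<le> \<phi> (norm (jet_grad (\<psi>' z)))"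
    by (simp add: q_def)
qed

section \<open>A double obstacle problem\<close>

text \<open>An explicit difference scheme for the heat equation: with \<open>n = CARD('n)\<close>,
  the average over the \<open>2 * n\<close> spatial neighbours one time step earlier. The spacing
  \<open>sqrt (2 * n * h)\<close> makes the average equal to the value at the centre plus
  \<open>h\<close> times the Laplacian to leading order. Its monotonicity in \<open>V\<close> is
  what viscosity arguments need.\<close>

definition neighbour_avg :: "real \<Rightarrow> ((real ^ 'n) \<times> real \<Rightarrow> real) \<Rightarrow> (real ^ 'n) \<times> real \<Rightarrow> real" where
  "neighbour_avg h V p = (\<Sum>i\<in>UNIV. V (fst p + sqrt (2 * real CARD('n) * h) *\<^sub>R axis i 1, snd p - h) +
      V (fst p - sqrt (2 * real CARD('n) * h) *\<^sub>R axis i 1, snd p - h)) / (2 * real CARD('n))"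

lemma neighbour_avg_mono:
  fixes p :: "(real ^ 'n) \<times> real"
  assumes "\<And>x. V (x, snd p - h) \<le> V' (x, snd p - h)"
  shows "neighbour_avg h V p \<le> neighbour_avg h V' p"
  unfolding neighbour_avg_def
  by (intro divide_right_mono sum_mono add_mono assms) auto

lemma neighbour_avg_cong:
  fixes p :: "(real ^ 'n) \<times> real"
  assumes "\<And>x. V (x, snd p - h) = V' (x, snd p - h)"
  shows "neighbour_avg h V p = neighbour_avg h V' p"
  unfolding neighbour_avg_def using assms by simp

lemma neighbour_avg_add_const:
  "neighbour_avg h (\<lambda>q. V q + c) p = neighbour_avg h V p + c"
  unfolding neighbour_avg_def by (simp add: sum.distrib field_simps)

lemma neighbour_avg_const: "neighbour_avg h (\<lambda>_. c) p = c"
  unfolding neighbour_avg_def by (simp add: field_simps)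

lemma neighbour_avg_uminus: "neighbour_avg h (\<lambda>q. - V q) p = - neighbour_avg h V p"
  unfolding neighbour_avg_def
  by (simp add: sum_negf sum_subtractf sum.distrib add_divide_distrib diff_divide_distrib)

lemma neighbour_avg_diff:
  fixes V V' :: "(real ^ 'n) \<times> real \<Rightarrow> real"
  assumes "\<And>q. \<bar>V q - V' q\<bar> \<le> e"
  shows "\<bar>neighbour_avg h V p - neighbour_avg h V' p\<bar> \<le> e"
proof -
  have "V q \<le> V' q + e" "V' q \<le> V q + e" for q using assms[of q] by linarith+
  then have "neighbour_avg h V p \<le> neighbour_avg h (\<lambda>q. V' q + e) p"
    "neighbour_avg h V' p \<le> neighbour_avg h (\<lambda>q. V q + e) p"
    by (intro neighbour_avg_mono; blast)+
  then show ?thesis by (simp add: neighbour_avg_add_const)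
qed

text \<open>For \<open>b = 2 * n * K\<close>, \<open>n = CARD('n)\<close>, the right-hand side is
  the averaged function at \<open>p\<close> itself: this solution of the heat equation is reproduced
  exactly and can serve as a discrete barrier.\<close>

lemma neighbour_avg_paraboloid:
  fixes p :: "(real ^ 'n) \<times> real"
  assumes "h \<ge> 0"
  shows "neighbour_avg h (\<lambda>q. c + K * (fst q \<bullet> fst q) + b * snd q) p =
    c + K * (fst p \<bullet> fst p) + 2 * real CARD('n) * K * h + b * (snd p - h)"
proof -
  let ?n = "real CARD('n)"
  let ?s = "sqrt (2 * ?n * h)"
  have s: "?s * ?s = 2 * ?n * h" using assms by simp
  have "(fst p + ?s *\<^sub>R axis i 1) \<bullet> (fst p + ?s *\<^sub>R axis i 1) + (fst p - ?s *\<^sub>R axis i 1) \<bullet> (fst p - ?s *\<^sub>R axis i 1)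
     = 2 * (fst p \<bullet> fst p) + 4 * ?n * h" for i :: 'n
  proof -
    have "(x + t *\<^sub>R a) \<bullet> (x + t *\<^sub>R a) + (x - t *\<^sub>R a) \<bullet> (x - t *\<^sub>R a) = 2 * (x \<bullet> x) + 2 * (t * t)"
      if "a \<bullet> a = 1" for x a :: "real ^ 'n" and t :: real
      using that by (simp add: inner_add_left inner_add_right inner_diff_left inner_diff_right inner_commute)
    from this[of "axis i 1" "fst p" ?s] show ?thesis unfolding s by (simp add: inner_axis_axis)
  qed
  moreover have "(c + K * X + b * t) + (c + K * Y + b * t) = 2 * (c + K * Z + 2 * ?n * K * h + b * t)"
    if "X + Y = 2 * Z + 4 * ?n * h" for X Y Z t :: real
  proof -
    have "K * (X + Y) = K * (2 * Z + 4 * ?n * h)" using that by simp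
    then show ?thesis by (simp add: algebra_simps)
  qed
  ultimately have E: "(c + K * ((fst p + ?s *\<^sub>R axis i 1) \<bullet> (fst p + ?s *\<^sub>R axis i 1)) + b * (snd p - h)) +
     (c + K * ((fst p - ?s *\<^sub>R axis i 1) \<bullet> (fst p - ?s *\<^sub>R axis i 1)) + b * (snd p - h)) =
     2 * (c + K * (fst p \<bullet> fst p) + 2 * ?n * K * h + b * (snd p - h))" for i :: 'n
    by blast
  have "neighbour_avg h (\<lambda>q. c + K * (fst q \<bullet> fst q) + b * snd q) p =
     (?n * (2 * (c + K * (fst p \<bullet> fst p) + 2 * ?n * K * h + b * (snd p - h)))) / (2 * ?n)"
    unfolding neighbour_avg_def fst_conv snd_conv E by simp
  then show ?thesis by simp
qed

lemma clamp_diff: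
  fixes a b c :: real
  assumes "\<bar>a - a'\<bar> \<le> e" "\<bar>b - b'\<bar> \<le> e" "\<bar>c - c'\<bar> \<le> e"
  shows "\<bar>max a (min b c) - max a' (min b' c')\<bar> \<le> e"
  using assms by (auto simp: max_def min_def)

text \<open>The recursion counts sweeps over all of space-time instead of levels of a time grid.
  Every sweep then commutes with translations, and the iterates are functions of a continuous time
  variable.\<close>

fun obstacle_scheme :: "real \<Rightarrow> ((real ^ 'n) \<times> real \<Rightarrow> real) \<Rightarrow> ((real ^ 'n) \<times> real \<Rightarrow> real) \<Rightarrow>
    ((real ^ 'n) \<times> real \<Rightarrow> real) \<Rightarrow> nat \<Rightarrow> (real ^ 'n) \<times> real \<Rightarrow> real" where
  "obstacle_scheme h w lo hi 0 p = w p"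
| "obstacle_scheme h w lo hi (Suc k) p =
     max (lo p) (min (hi p) (neighbour_avg h (obstacle_scheme h w lo hi k) p))"

lemma obstacle_scheme_between:
  assumes "\<And>p. lo p \<le> w p" "\<And>p. w p \<le> hi p"
  shows "lo p \<le> obstacle_scheme h w lo hi k p" "obstacle_scheme h w lo hi k p \<le> hi p"
  using assms(1,2)[of p] by (cases k; auto simp: max_def min_def)+

lemma obstacle_scheme_bounds:
  assumes "\<And>p. m \<le> w p" "\<And>p. w p \<le> M" "\<And>p. m \<le> hi p" "\<And>p. lo p \<le> M"
  shows "m \<le> obstacle_scheme h w lo hi k p \<and> obstacle_scheme h w lo hi k p \<le> M"
proof (induction k arbitrary: p)
  case (Suc k)
  have "neighbour_avg h (\<lambda>_. m) p \<le> neighbour_avg h (obstacle_scheme h w lo hi k) p"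
    "neighbour_avg h (obstacle_scheme h w lo hi k) p \<le> neighbour_avg h (\<lambda>_. M) p"
    by (intro neighbour_avg_mono; use Suc in blast)+
  then show ?case using assms(3,4)[of p] by (auto simp: neighbour_avg_const max_def min_def)
qed (use assms in auto)

text \<open>Averaging commutes with translations, and neither averaging nor clamping increases sup
  distances. The modulus of continuity of the data is therefore kept, uniformly in \<open>h\<close>
  and \<open>k\<close>.\<close>

lemma obstacle_scheme_equicontinuous:
  assumes "\<And>p. \<bar>w (p + \<xi>) - w p\<bar> \<le> e" "\<And>p. \<bar>lo (p + \<xi>) - lo p\<bar> \<le> e" "\<And>p. \<bar>hi (p + \<xi>) - hi p\<bar> \<le> e"
  shows "\<bar>obstacle_scheme h w lo hi k (p + \<xi>) - obstacle_scheme h w lo hi k p\<bar> \<le> e"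
proof (induction k arbitrary: p)
  case (Suc k)
  let ?V = "obstacle_scheme h w lo hi k"
  have "neighbour_avg h ?V (p + \<xi>) = neighbour_avg h (\<lambda>q. ?V (q + \<xi>)) p"
    unfolding neighbour_avg_def by (cases \<xi>) (simp add: algebra_simps)
  then have "\<bar>neighbour_avg h ?V (p + \<xi>) - neighbour_avg h ?V p\<bar> \<le> e"
    using neighbour_avg_diff[of "\<lambda>q. ?V (q + \<xi>)" ?V e h p] Suc by simp
  then show ?case using assms by (simp add: clamp_diff)
qed (use assms in simp)

text \<open>Up to time \<open>- \<tau>\<close> the coinciding obstacles leave no freedom, and an
  average looks back by exactly \<open>h\<close>. So each sweep settles one more time slab of length
  \<open>h\<close>.\<close>

lemma obstacle_scheme_stable:
  assumes obst: "\<And>p. lo p \<le> w p" "\<And>p. w p \<le> hi p" and past: "\<And>p. snd p \<le> - \<tau> \<Longrightarrow> lo p = hi p"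
  shows "snd p \<le> - \<tau> + real k * h \<Longrightarrow> obstacle_scheme h w lo hi (Suc k) p = obstacle_scheme h w lo hi k p"
proof (induction k arbitrary: p)
  case 0
  then have "lo p = hi p" using past by simp
  moreover have "lo p \<le> obstacle_scheme h w lo hi k p" "obstacle_scheme h w lo hi k p \<le> hi p" for k
    by (rule obstacle_scheme_between; fact)+
  ultimately show ?case by (metis order_antisym)
next
  case (Suc k)
  have "neighbour_avg h (obstacle_scheme h w lo hi (Suc k)) p = neighbour_avg h (obstacle_scheme h w lo hi k) p"
    by (rule neighbour_avg_cong) (use Suc in \<open>simp add: algebra_simps\<close>)
  then show ?case by simp
qed

text \<open>Comparison with a paraboloid that the scheme reproduces exactly. The bound starts at
  time \<open>- \<tau> - h\<close> because averages taken just after \<open>- \<tau>\<close> sample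
  that far back.\<close>

lemma obstacle_scheme_upper_barrier:
  fixes w :: "(real ^ 'n) \<times> real \<Rightarrow> real"
  assumes obst: "\<And>p. lo p \<le> w p" "\<And>p. w p \<le> hi p" and past: "\<And>p. snd p \<le> - \<tau> \<Longrightarrow> lo p = hi p"
    and w: "\<And>p. - \<tau> - h \<le> snd p \<Longrightarrow> snd p \<le> 0 \<Longrightarrow> w p \<le> c + K * (fst p \<bullet> fst p)"
    and h: "h > 0" and K: "K \<ge> 0"
  shows "- \<tau> - h \<le> snd p \<Longrightarrow> snd p \<le> 0 \<Longrightarrow> obstacle_scheme h w lo hi k p \<le>
      c + K * (fst p \<bullet> fst p) + 2 * real CARD('n) * K * (snd p + \<tau> + h)"
proof (induction k arbitrary: p)
  case 0
  then have "0 \<le> 2 * real CARD('n) * K * (snd p + \<tau> + h)" using K by simp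
  then show ?case using w[OF 0] by (simp only: obstacle_scheme.simps)
next
  case (Suc k)
  let ?V = "obstacle_scheme h w lo hi"
  let ?n = "real CARD('n)"
  have pos: "0 \<le> 2 * ?n * K * (snd p + \<tau> + h)" using K Suc.prems by simp
  show ?case
  proof (cases "snd p \<le> - \<tau>")
    case True
    then have "?V (Suc k) p = w p"
      using past[of p] obst[of p] obstacle_scheme_between[of lo w hi, OF obst, where h = h and k = "Suc k" and p = p] by linarith
    then show ?thesis using w[OF Suc.prems] pos by linarith
  next
    case False
    have "neighbour_avg h (?V k) p \<le>
      neighbour_avg h (\<lambda>q. c + 2 * ?n * K * (\<tau> + h) + K * (fst q \<bullet> fst q) + 2 * ?n * K * snd q) p"
    proof (rule neighbour_avg_mono)
      fix x
      have "?V k (x, snd p - h) \<le> c + K * (x \<bullet> x) + 2 * ?n * K * (snd p - h + \<tau> + h)"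
        using Suc.IH[of "(x, snd p - h)"] Suc.prems False h by simp
      then show "?V k (x, snd p - h) \<le>
         c + 2 * ?n * K * (\<tau> + h) + K * (fst (x, snd p - h) \<bullet> fst (x, snd p - h)) + 2 * ?n * K * snd (x, snd p - h)"
        by (simp add: algebra_simps)
    qed
    also have "\<dots> = c + K * (fst p \<bullet> fst p) + 2 * ?n * K * (snd p + \<tau> + h)"
      using neighbour_avg_paraboloid[of h "c + 2 * ?n * K * (\<tau> + h)" K "2 * ?n * K" p] h
      by (simp add: algebra_simps)
    finally have "neighbour_avg h (?V k) p \<le> c + K * (fst p \<bullet> fst p) + 2 * ?n * K * (snd p + \<tau> + h)" .
    moreover have "lo p \<le> c + K * (fst p \<bullet> fst p) + 2 * ?n * K * (snd p + \<tau> + h)"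
      using w[OF Suc.prems] obst(1)[of p] pos by linarith
    ultimately show ?thesis by (simp add: min_le_iff_disj)
  qed
qed

section \<open>Passage to the limit in the scheme\<close>

lemma second_difference_ge:
  fixes g :: "real \<Rightarrow> real"
  assumes g: "\<And>t. t \<in> {- r<..<r} \<Longrightarrow> DERIV g t :> g1 t" "\<And>t. t \<in> {- r<..<r} \<Longrightarrow> DERIV g1 t :> g2 t"
    and c: "\<And>t. t \<in> {- r<..<r} \<Longrightarrow> c \<le> g2 t" and s: "0 \<le> s" "s < r"
  shows "2 * g 0 + c * s\<^sup>2 \<le> g s + g (- s)"
proof -
  \<comment> \<open>Subtracting the parabola with second derivative \<open>c\<close> leaves a convex
    function, and midpoint convexity at \<open>0\<close> is the claim.\<close>
  define G where "G t = g t - c * t\<^sup>2 / 2" for t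
  have "convex_on {- r<..<r} G"
  proof (rule f''_ge0_imp_convex[where f' = "\<lambda>t. g1 t - c * t" and f'' = "\<lambda>t. g2 t - c"])
    fix t assume t: "t \<in> {- r<..<r}"
    show "DERIV G t :> g1 t - c * t"
      unfolding G_def[abs_def] by (rule derivative_eq_intros g(1)[OF t] refl | simp)+
    show "DERIV (\<lambda>t. g1 t - c * t) t :> g2 t - c"
      by (rule derivative_eq_intros g(2)[OF t] refl | simp)+
    show "0 \<le> g2 t - c" using c[OF t] by simp
  qed simp
  from convex_onD[OF this, of "1/2" s "- s"] have "G 0 \<le> (G s + G (- s)) / 2"
    using s by simp
  then show ?thesis by (simp add: G_def)
qed

lemma C2_deriv_line:
  assumes f: "C2_deriv S f f' f''" and I: "\<And>t. t \<in> I \<Longrightarrow> p + t *\<^sub>R v \<in> S" and t: "t \<in> I"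
  shows "((\<lambda>t. f (p + t *\<^sub>R v)) has_real_derivative f' (p + t *\<^sub>R v) v) (at t within I)"
    and "((\<lambda>t. f' (p + t *\<^sub>R v) v) has_real_derivative f'' (p + t *\<^sub>R v) v v) (at t within I)"
proof -
  have line: "((\<lambda>t. p + t *\<^sub>R v) has_derivative (\<lambda>k. k *\<^sub>R v)) (at t within I)"
    by (auto intro!: derivative_eq_intros)
  have sub: "(\<lambda>t. p + t *\<^sub>R v) ` I \<subseteq> S" using I by blast
  note d = C2_derivD[OF f I[OF t]]
  have "((\<lambda>t. f (p + t *\<^sub>R v)) has_derivative (\<lambda>k. f' (p + t *\<^sub>R v) (k *\<^sub>R v))) (at t within I)"
    using has_derivative_in_compose[OF line has_derivative_subset[OF d(1) sub]] .
  then show "((\<lambda>t. f (p + t *\<^sub>R v)) has_real_derivative f' (p + t *\<^sub>R v) v) (at t within I)"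
    unfolding has_field_derivative_def by (rule has_derivative_eq_rhs) (simp add: fun_eq_iff blinfun.scaleR_right)
  have "((\<lambda>t. f' (p + t *\<^sub>R v)) has_derivative (\<lambda>k. f'' (p + t *\<^sub>R v) (k *\<^sub>R v))) (at t within I)"
    using has_derivative_in_compose[OF line has_derivative_subset[OF d(2) sub]] .
  from bounded_linear.has_derivative[OF blinfun.bounded_linear_left this]
  have "((\<lambda>t. f' (p + t *\<^sub>R v) v) has_derivative (\<lambda>k. f'' (p + t *\<^sub>R v) (k *\<^sub>R v) v)) (at t within I)" .
  then show "((\<lambda>t. f' (p + t *\<^sub>R v) v) has_real_derivative f'' (p + t *\<^sub>R v) v v) (at t within I)"
    unfolding has_field_derivative_def
    by (rule has_derivative_eq_rhs) (simp add: fun_eq_iff blinfun.scaleR_right blinfun.scaleR_left)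
qed

lemma C2_deriv_strict:
  fixes z :: "'a::euclidean_space"
  assumes f: "C2_deriv S f f' f''"
  obtains f1 f2 where "C2_deriv S (\<lambda>w. f w - (norm (w - z)) ^ 4) f1 f2" "f1 z = f' z" "f2 z = f'' z"
proof -
  note sq = C2_deriv_mult[OF C2_deriv_sqdist C2_deriv_sqdist, of S z z]
  have "(w - z) \<bullet> (w - z) * ((w - z) \<bullet> (w - z)) = (norm (w - z)) ^ 4" for w
    by (simp add: power2_norm_eq_inner[symmetric] power4_eq_xxxx power2_eq_square)
  note d = C2_deriv_diff[OF f sq, unfolded this]
  have z0: "blinfun_inner_right (0 :: 'a) = 0" by (rule blinfun_eqI) simp
  show thesis
    by (rule that[OF d]) (auto simp: z0 intro!: blinfun_eqI)
qed

text \<open>After subtracting \<open>|w - z|\<^sup>4\<close>, which does not affect the jet at \<open>z\<close>, the test function touches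
  \<open>W\<close> strictly; so translates of it touch the approximations \<open>F n\<close> near \<open>z\<close>, where the monotonicity
  of the averages contradicts the second-order expansion.\<close>

lemma scheme_limit_supersolution:
  fixes W :: "(real ^ 'n) \<times> real \<Rightarrow> real" and F :: "nat \<Rightarrow> (real ^ 'n) \<times> real \<Rightarrow> real"
  defines "Q \<equiv> parabolic_cube 2 0 0 :: ((real ^ 'n) \<times> real) set"
  assumes W: "continuous_on Q W" and hi: "continuous_on Q hi" and F: "\<And>n. continuous_on Q (F n)"
    and lim: "\<And>e. e > 0 \<Longrightarrow> \<forall>\<^sub>F n in sequentially. \<forall>p\<in>Q. \<bar>F n p - W p\<bar> < e"
    and h: "\<And>n. h n > 0" "h \<longlonglongrightarrow> 0"
    and scheme: "\<And>n p. snd p \<le> 0 \<Longrightarrow> F n p < hi p \<Longrightarrow> neighbour_avg (h n) (F n) p \<le> F n p"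
    and z: "z \<in> Q" "W z < hi z"
    and \<psi>: "C2_deriv Q \<psi> \<psi>' \<psi>''" "\<And>w. w \<in> Q \<Longrightarrow> \<psi> w \<le> W w" "\<psi> z = W z"
  shows "trace (jet_hessian (\<psi>'' z)) \<le> \<psi>' z (0, 1)"
proof (rule ccontr)
  let ?n = "real CARD('n)"
  let ?e = "\<lambda>i :: 'n. (axis i 1, 0) :: (real ^ 'n) \<times> real"
  assume "\<not> trace (jet_hessian (\<psi>'' z)) \<le> \<psi>' z (0, 1)"
  then have gap: "\<psi>' z (0, 1) < (\<Sum>i\<in>UNIV. \<psi>'' z (?e i) (?e i))"
    by (simp add: trace_def jet_hessian_def)
  obtain f1 f2 where f: "C2_deriv Q (\<lambda>w. \<psi> w - (norm (w - z)) ^ 4) f1 f2" "f1 z = \<psi>' z" "f2 z = \<psi>'' z"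
    using C2_deriv_strict[OF \<psi>(1)] .
  define f where "f w = \<psi> w - (norm (w - z)) ^ 4" for w
  note f = f[folded f_def]
  \<comment> \<open>The gap is cut into \<open>n + 2\<close> parts, \<open>n = CARD('n)\<close>: one
    to lower each second derivative, one to raise the time derivative, and one that remains as a
    strict inequality.\<close>
  define \<epsilon> where "\<epsilon> = ((\<Sum>i\<in>UNIV. \<psi>'' z (?e i) (?e i)) - \<psi>' z (0, 1)) / (?n + 2)"
  have \<epsilon>: "\<epsilon> > 0" using gap by (auto simp: \<epsilon>_def intro!: divide_pos_pos)
  define c where "c i = \<psi>'' z (?e i) (?e i) - \<epsilon>" for i
  define A where "A = \<psi>' z (0, 1) + \<epsilon>"
  have "(\<Sum>i\<in>UNIV. \<psi>'' z (?e i) (?e i)) - \<psi>' z (0, 1) = \<epsilon> * (?n + 2)"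
    by (simp add: \<epsilon>_def add_nonneg_pos less_imp_neq[symmetric])
  then have cA: "A < (\<Sum>i\<in>UNIV. c i)"
    using \<epsilon> by (simp add: c_def A_def sum_subtractf algebra_simps)
  have "((\<lambda>p. f2 p (?e i) (?e i)) \<longlongrightarrow> f2 z (?e i) (?e i)) (at z within Q)" for i
    using C2_deriv_continuous(3)[OF f(1)] z(1)
    by (intro tendsto_intros) (auto simp: continuous_on_def)
  then have ev1: "\<forall>\<^sub>F p in at z within Q. c i < f2 p (?e i) (?e i)" for i
    by (rule order_tendstoD) (use f(3) \<epsilon> in \<open>simp add: c_def\<close>)
  have "((\<lambda>p. f1 p (0, 1)) \<longlongrightarrow> f1 z (0, 1)) (at z within Q)"
    using C2_deriv_continuous(2)[OF f(1)] z(1)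
    by (intro tendsto_intros) (auto simp: continuous_on_def)
  then have ev2: "\<forall>\<^sub>F p in at z within Q. f1 p (0, 1) < A"
    by (rule order_tendstoD) (use f(2) \<epsilon> in \<open>simp add: A_def\<close>)
  have ev3: "\<forall>\<^sub>F p in at z within Q. (hi z - W z) / 2 < hi p - W p"
    by (rule order_tendstoD(1)[OF tendsto_diff]) (use W hi z in \<open>auto simp: continuous_on_def\<close>)
  have "\<forall>\<^sub>F p in at z within Q. (\<forall>i. c i < f2 p (?e i) (?e i)) \<and> f1 p (0, 1) < A \<and> (hi z - W z) / 2 < hi p - W p"
    by (intro eventually_conj eventually_all_finite ev1 ev2 ev3)
  then obtain d1 where d1: "d1 > 0"
    and near: "\<And>p. p \<in> Q \<Longrightarrow> p \<noteq> z \<Longrightarrow> dist p z < d1 \<Longrightarrow>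
      (\<forall>i. c i < f2 p (?e i) (?e i)) \<and> f1 p (0, 1) < A \<and> (hi z - W z) / 2 < hi p - W p"
    unfolding eventually_at by blast
  have near: "c i < f2 p (?e i) (?e i)" "f1 p (0, 1) < A" "(hi z - W z) / 2 < hi p - W p"
    if "p \<in> Q" "dist p z < d1" for p i
    using near[OF that(1) _ that(2)] z(2) f(2,3) \<epsilon>
    by (cases "p = z"; auto simp: c_def A_def)+
  obtain d2 where d2: "d2 > 0" "ball z d2 \<subseteq> {(x, t). infnorm (x - 0) < 2 \<and> 0 - 2\<^sup>2 < t}"
    using z(1) open_infnorm_slab[of "0 :: real ^ 'n" 2 "0 - 2\<^sup>2"]
    unfolding Q_def parabolic_cube_eq open_contains_ball by blast
  define d where "d = min d1 d2 / 2"
  have d: "d > 0" "d < d1" "d < d2" using d1 d2 by (auto simp: d_def)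
  have inQ: "p \<in> Q" if "dist p z \<le> d" "snd p \<le> 0" for p
  proof -
    have "p \<in> ball z d2" using that(1) d by (simp add: dist_commute)
    then show ?thesis using d2(2) that(2) unfolding Q_def parabolic_cube_eq by blast
  qed
  define N where "N = cball z d \<inter> {p. snd p \<le> 0}"
  have NQ: "N \<subseteq> Q" using inQ by (auto simp: N_def dist_commute)
  have "compact N"
    unfolding N_def by (intro compact_Int_closed compact_cball closed_Collect_le continuous_intros)
  have zN: "z \<in> N" using d z(1) by (auto simp: N_def Q_def parabolic_cube_def)
  \<comment> \<open>The first bound keeps \<open>F n\<close> below \<open>hi\<close> at the minimum
    point \<open>p\<close> of \<open>F n - f\<close>; the second forces \<open>p\<close> into the
    half-size ball, since \<open>(norm (p - z)) ^ 4 < 2 * e\<close>.\<close>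
  define e where "e = min ((hi z - W z) / 2) ((d / 2) ^ 4 / 2)"
  have e: "e > 0" using z d by (simp add: e_def)
  have "e \<le> (hi z - W z) / 2" "e \<le> (d / 2) ^ 4 / 2"
    unfolding e_def by (rule min.cobounded1, rule min.cobounded2)
  then have e_le: "e \<le> (hi z - W z) / 2" "2 * e \<le> (d / 2) ^ 4" by simp_all
  have "\<forall>\<^sub>F n in sequentially. sqrt (2 * ?n * h n) + h n < d / 2"
  proof (rule order_tendstoD)
    show "(\<lambda>n. sqrt (2 * ?n * h n) + h n) \<longlonglongrightarrow> sqrt (2 * ?n * 0) + 0"
      by (intro tendsto_intros h)
  qed (use d in simp)
  with lim[OF e] have "\<forall>\<^sub>F n in sequentially. (\<forall>p\<in>Q. \<bar>F n p - W p\<bar> < e) \<and> sqrt (2 * ?n * h n) + h n < d / 2"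
    by (rule eventually_conj)
  then obtain n where n: "\<And>p. p \<in> Q \<Longrightarrow> \<bar>F n p - W p\<bar> < e" "sqrt (2 * ?n * h n) + h n < d / 2"
    unfolding eventually_sequentially by blast
  define \<sigma> where "\<sigma> = sqrt (2 * ?n * h n)"
  define k where "k = h n"
  have k: "k > 0" using h by (simp add: k_def)
  have \<sigma>: "\<sigma> \<ge> 0" "\<sigma>\<^sup>2 = 2 * ?n * k" "\<sigma> + k < d / 2" using n(2) h(1)[of n] by (auto simp: \<sigma>_def k_def)
  have "continuous_on N (\<lambda>p. F n p - f p)"
    using NQ F C2_deriv_continuous(1)[OF f(1)] by (intro continuous_on_diff) (blast intro: continuous_on_subset)+
  from continuous_attains_inf[OF \<open>compact N\<close> _ this] zN
  obtain p where p: "p \<in> N" and pmin: "\<And>q. q \<in> N \<Longrightarrow> F n p - f p \<le> F n q - f q"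
    by blast
  have pQ: "p \<in> Q" using p NQ by blast
  have "F n p - f p \<le> F n z - f z" by (rule pmin[OF zN])
  moreover have "F n z - f z < e" using n(1)[OF z(1)] \<psi>(3) by (simp add: f_def)
  moreover have "(norm (p - z)) ^ 4 - e < F n p - f p"
    using n(1)[OF pQ] \<psi>(2)[OF pQ] by (simp add: f_def)
  ultimately have "(norm (p - z)) ^ 4 < (d / 2) ^ 4" using e_le by linarith
  then have pz: "dist p z < d / 2"
    unfolding dist_norm by (rule power_less_imp_less_base) (use d in simp)
  have "F n p < hi p"
    using n(1)[OF pQ] near(3)[OF pQ] pz d e_le by linarith
  then have "neighbour_avg k (F n) p \<le> F n p"
    using scheme[of p n] p by (simp add: N_def k_def)
  define \<mu> where "\<mu> = F n p - f p"
  define q where "q = (fst p, snd p - k)"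
  have close: "q + t *\<^sub>R ?e i \<in> N" if "\<bar>t\<bar> \<le> d / 2 - k" for t i
  proof -
    have "q + t *\<^sub>R ?e i = p + (t *\<^sub>R axis i 1, - k)" by (simp add: q_def prod_eq_iff)
    then have "dist (q + t *\<^sub>R ?e i) z \<le> dist p z + norm (t *\<^sub>R axis i (1 :: real), - k)"
      using norm_triangle_ineq[of "p - z" "(t *\<^sub>R axis i 1, - k)"] by (simp add: dist_norm add_diff_eq algebra_simps)
    also have "\<dots> \<le> dist p z + (\<bar>t\<bar> + k)"
      using norm_Pair_le[of "t *\<^sub>R axis i (1 :: real)" "- k"] k by (simp add: norm_axis_1)
    also have "\<dots> \<le> d" using pz that by simp
    finally show ?thesis using p k by (simp add: N_def q_def dist_commute)
  qed
  \<comment> \<open>On \<open>N\<close> the function \<open>F n\<close> lies above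
    \<open>f + \<mu>\<close>, with equality at \<open>p\<close>, and all neighbours of
    \<open>p\<close> in the average lie in \<open>N\<close>. Monotonicity thus transfers the scheme
    inequality to \<open>f\<close>.\<close>
  have avg_f: "neighbour_avg k f p \<le> f p"
  proof -
    have "f (fst p + s *\<^sub>R axis i 1, snd p - k) + \<mu> \<le> F n (fst p + s *\<^sub>R axis i 1, snd p - k)"
      if "\<bar>s\<bar> \<le> \<sigma>" for s i
      using pmin[OF close[of s i]] that \<sigma>(3) by (simp add: q_def \<mu>_def)
    from this[of \<sigma>] this[of "- \<sigma>"]
    have "neighbour_avg k (\<lambda>w. f w + \<mu>) p \<le> neighbour_avg k (F n) p"
      unfolding neighbour_avg_def k_def[symmetric] using \<sigma>(1)
      by (intro divide_right_mono sum_mono add_mono) (auto simp: \<sigma>_def k_def)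
    then show ?thesis
      using \<open>neighbour_avg k (F n) p \<le> F n p\<close> by (simp add: neighbour_avg_add_const \<mu>_def)
  qed
  have space: "2 * f q + c i * \<sigma>\<^sup>2 \<le> f (q + \<sigma> *\<^sub>R ?e i) + f (q + (- \<sigma>) *\<^sub>R ?e i)" for i
  proof -
    define r where "r = d / 2 - k"
    have mem: "q + t *\<^sub>R ?e i \<in> N" if "t \<in> {- r<..<r}" for t
      using that by (intro close) (auto simp: r_def)
    have der: "DERIV (\<lambda>t. f (q + t *\<^sub>R ?e i)) t :> f1 (q + t *\<^sub>R ?e i) (?e i)"
      "DERIV (\<lambda>t. f1 (q + t *\<^sub>R ?e i) (?e i)) t :> f2 (q + t *\<^sub>R ?e i) (?e i) (?e i)" if "t \<in> {- r<..<r}" for t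
      using C2_deriv_line[OF f(1) _ that, of q "?e i"] mem NQ that by (auto simp: at_within_open[OF that])
    have "2 * f (q + 0 *\<^sub>R ?e i) + c i * \<sigma>\<^sup>2 \<le> f (q + \<sigma> *\<^sub>R ?e i) + f (q + (- \<sigma>) *\<^sub>R ?e i)"
    proof (rule second_difference_ge[OF der])
      fix t assume t: "t \<in> {- r<..<r}"
      have "dist (q + t *\<^sub>R ?e i) z < d1" using mem[OF t] d by (simp add: N_def dist_commute)
      moreover have "q + t *\<^sub>R ?e i \<in> Q" using mem[OF t] NQ by blast
      ultimately show "c i \<le> f2 (q + t *\<^sub>R ?e i) (?e i) (?e i)"
        by (intro less_imp_le near(1))
    qed (use \<sigma> in \<open>auto simp: r_def\<close>)
    then show ?thesis by (simp only: scaleR_zero_left add_0_right)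
  qed
  have time: "f p - f q \<le> A * k"
  proof -
    have mem: "q + t *\<^sub>R (0, 1) \<in> N" if "t \<in> {0..k}" for t
    proof -
      have "q + t *\<^sub>R (0, 1) = p + (0, t - k)" by (simp add: q_def prod_eq_iff)
      then have "dist (q + t *\<^sub>R (0, 1)) z \<le> dist p z + norm (0 :: real ^ 'n, t - k)"
        using norm_triangle_ineq[of "p - z" "(0, t - k)"] by (simp add: dist_norm algebra_simps)
      also have "\<dots> \<le> d" using that pz \<sigma> by (simp add: norm_Pair)
      finally show ?thesis using p that by (simp add: N_def q_def dist_commute)
    qed
    have "((\<lambda>t. f (q + t *\<^sub>R (0, 1))) has_derivative (\<lambda>s. f1 (q + t *\<^sub>R (0, 1)) (0, 1) * s)) (at t within {0..k})"
      if "t \<in> {0..k}" for t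
      using C2_deriv_line(1)[OF f(1) _ that, of q "(0, 1)"] mem NQ by (auto simp: has_field_derivative_def)
    then have "\<exists>t\<in>{0<..<k}. f (q + k *\<^sub>R (0, 1)) - f (q + 0 *\<^sub>R (0, 1)) = f1 (q + t *\<^sub>R (0, 1)) (0, 1) * (k - 0)"
      using k by (intro mvt_simple) auto
    moreover have "q + k *\<^sub>R (0, 1) = p" by (simp add: q_def prod_eq_iff)
    ultimately obtain t where t: "t \<in> {0<..<k}" "f p - f q = f1 (q + t *\<^sub>R (0, 1)) (0, 1) * k"
      unfolding scaleR_zero_left add_0_right diff_0_right by metis
    have "q + t *\<^sub>R (0, 1) \<in> N" using t by (intro mem) auto
    then have "f1 (q + t *\<^sub>R (0, 1)) (0, 1) < A"
      using near(2)[of "q + t *\<^sub>R (0, 1)"] NQ d by (auto simp: N_def dist_commute)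
    then show ?thesis using t(2) k by simp
  qed
  \<comment> \<open>Everything is compared with \<open>q\<close>, one time step below
    \<open>p\<close>: the average of \<open>f\<close> exceeds \<open>f q\<close> by at least
    \<open>k\<close> times the sum of the \<open>c i\<close>, while \<open>f p\<close> exceeds it by
    at most \<open>A * k\<close>.\<close>
  have "f q + k * (\<Sum>i\<in>UNIV. c i) = (\<Sum>i\<in>UNIV. 2 * f q + c i * \<sigma>\<^sup>2) / (2 * ?n)"
  proof -
    have "(\<Sum>i\<in>UNIV. 2 * f q + c i * \<sigma>\<^sup>2) = 2 * ?n * f q + (\<Sum>i\<in>UNIV. c i) * \<sigma>\<^sup>2"
      by (simp add: sum.distrib sum_distrib_right)
    then show ?thesis unfolding \<sigma>(2) by (simp add: field_simps)
  qed
  also have "\<dots> \<le> (\<Sum>i\<in>UNIV. f (q + \<sigma> *\<^sub>R ?e i) + f (q + (- \<sigma>) *\<^sub>R ?e i)) / (2 * ?n)"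
    by (intro divide_right_mono sum_mono space) simp
  also have "\<dots> = neighbour_avg k f p"
    unfolding neighbour_avg_def by (simp add: q_def \<sigma>_def k_def)
  finally have "k * (\<Sum>i\<in>UNIV. c i) \<le> A * k" using avg_f time by simp
  then show False using cA k by (simp add: mult.commute[of A])
qed

text \<open>Subtracting \<open>b\<close> from the test function gives one for \<open>w\<close> with
  the same gradient and Hessian. Its time derivative is smaller by \<open>b1\<close>, and as
  \<open>b1\<close> is nonnegative, the inequality for \<open>w\<close> is stronger than the one
  claimed.\<close>

lemma obstacle_contact:
  fixes w :: "(real ^ 'n) \<times> real \<Rightarrow> real"
  assumes w: "interior_supersolution l L \<phi> V w" and V: "open V" "z \<in> V"
    and \<psi>: "C2_deriv V \<psi> \<psi>' \<psi>''" "\<And>p. p \<in> V \<Longrightarrow> \<psi> p \<le> w p + b (snd p)" "\<psi> z = w z + b (snd z)"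
    and b: "\<And>s. DERIV b s :> b1 s" "\<And>s. DERIV b1 s :> b2 s" "continuous_on UNIV b2" "\<And>s. 0 \<le> b1 s"
    and ell: "l' \<le> l" "L \<le> L'"
  shows "pucci_minus l' L' (jet_hessian (\<psi>'' z)) - \<psi>' z (0, 1) \<le> \<phi> (norm (jet_grad (\<psi>' z)))"
proof -
  let ?t = "(0 :: real ^ 'n, 1 :: real)"
  have snd: "?t \<bullet> p = snd p" for p by (cases p) simp
  have "continuous_on X b2" for X using b(3) continuous_on_subset by blast
  note \<beta> = C2_deriv_comp[OF C2_deriv_inner[of V ?t] b(1,2) this]
  note d = C2_deriv_diff[OF \<psi>(1) \<beta>]
  have "pucci_minus l L (jet_hessian (\<psi>'' z - (b1 (?t \<bullet> z) *\<^sub>R 0 + b2 (?t \<bullet> z) *\<^sub>R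
        (blinfun_scaleR_left (blinfun_inner_right ?t) o\<^sub>L blinfun_inner_right ?t))))
      - blinfun_apply (\<psi>' z - b1 (?t \<bullet> z) *\<^sub>R blinfun_inner_right ?t) (0, 1)
      \<le> \<phi> (norm (jet_grad (\<psi>' z - b1 (?t \<bullet> z) *\<^sub>R blinfun_inner_right ?t)))"
    by (rule interior_supersolutionD[OF w V order_refl d]) (use \<psi>(2,3) in \<open>simp_all add: snd algebra_simps\<close>)
  moreover have "jet_hessian (\<psi>'' z - (b1 (?t \<bullet> z) *\<^sub>R 0 + b2 (?t \<bullet> z) *\<^sub>R
        (blinfun_scaleR_left (blinfun_inner_right ?t) o\<^sub>L blinfun_inner_right ?t))) = jet_hessian (\<psi>'' z)"
    by (simp add: jet_hessian_def vec_eq_iff blinfun.diff_left blinfun.scaleR_left)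
  moreover have "jet_grad (\<psi>' z - b1 (?t \<bullet> z) *\<^sub>R blinfun_inner_right ?t) = jet_grad (\<psi>' z)"
    by (simp add: jet_grad_def vec_eq_iff blinfun.diff_left blinfun.scaleR_left)
  moreover have "blinfun_apply (\<psi>' z - b1 (?t \<bullet> z) *\<^sub>R blinfun_inner_right ?t) (0, 1) = \<psi>' z (0, 1) - b1 (snd z)"
    by (simp add: blinfun.diff_left blinfun.scaleR_left snd)
  ultimately have "pucci_minus l L (jet_hessian (\<psi>'' z)) - \<psi>' z (0, 1) \<le> \<phi> (norm (jet_grad (\<psi>' z)))"
    using b(4)[of "snd z"] by simp
  then show ?thesis using pucci_minus_mono[OF ell, of "jet_hessian (\<psi>'' z)"] by simp
qed

text \<open>At contact with the upper obstacle the inequality comes from \<open>w\<close>; there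
  \<open>top\<close> leaves room for a full neighbourhood in time. Elsewhere it comes from the heat
  equation. Contact with the lower obstacle needs no separate case, since clamping from below only
  raises the value above the average.\<close>

lemma obstacle_limit_supersolution:
  fixes W :: "(real ^ 'n) \<times> real \<Rightarrow> real" and F :: "nat \<Rightarrow> (real ^ 'n) \<times> real \<Rightarrow> real"
  defines "Q \<equiv> parabolic_cube 2 0 0 :: ((real ^ 'n) \<times> real) set"
  assumes W: "continuous_on Q W" and hi: "continuous_on Q hi" and F: "\<And>n. continuous_on Q (F n)"
    and lim: "\<And>e. e > 0 \<Longrightarrow> \<forall>\<^sub>F n in sequentially. \<forall>p\<in>Q. \<bar>F n p - W p\<bar> < e"
    and h: "\<And>n. h n > 0" "h \<longlonglongrightarrow> 0"
    and scheme: "\<And>n p. snd p \<le> 0 \<Longrightarrow> F n p < hi p \<Longrightarrow> neighbour_avg (h n) (F n) p \<le> F n p"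
    and le: "\<And>p. p \<in> Q \<Longrightarrow> W p \<le> hi p" and top: "\<And>p. p \<in> Q \<Longrightarrow> W p = hi p \<Longrightarrow> snd p < 0"
    and hiw: "\<And>p. p \<in> Q \<Longrightarrow> hi p = w p + b (snd p)"
    and w: "interior_supersolution l L \<phi> {p. infnorm (fst p) < 2 \<and> - 4 < snd p \<and> snd p < 0} w"
    and b: "\<And>s. DERIV b s :> b1 s" "\<And>s. DERIV b1 s :> b2 s" "continuous_on UNIV b2" "\<And>s. 0 \<le> b1 s"
    and ell: "l' \<le> l" "l' \<le> 1" "L \<le> L'" "1 \<le> L'" and \<phi>: "\<And>t. 0 \<le> t \<Longrightarrow> 0 \<le> \<phi> t"
  shows "viscosity_supersolution l' L' \<phi> Q W"
  unfolding Q_def viscosity_supersolution_iff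
  unfolding Q_def[symmetric]
proof (intro conjI ballI allI impI; (elim conjE)?)
  show "lower_semicont_on Q W"
    unfolding lower_semicont_on_def
    using W by (auto simp: continuous_on_def intro: order_tendstoD)
  fix z \<psi> \<psi>' \<psi>''
  assume z: "z \<in> Q" and \<psi>: "C2_deriv Q \<psi> \<psi>' \<psi>''" "\<forall>w\<in>Q. \<psi> w \<le> W w" "\<psi> z = W z"
  let ?V = "{p. infnorm (fst p) < 2 \<and> - 4 < snd p \<and> snd p < 0} :: ((real ^ 'n) \<times> real) set"
  have VQ: "?V \<subseteq> Q" by (auto simp: Q_def parabolic_cube_def)
  show "pucci_minus l' L' (jet_hessian (\<psi>'' z)) - blinfun_apply (\<psi>' z) (0, 1) \<le> \<phi> (norm (jet_grad (\<psi>' z)))"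
  proof (cases "W z = hi z")
    case True
    show ?thesis
    proof (rule obstacle_contact[OF w _ _ C2_deriv_subset[OF \<psi>(1) VQ] _ _ b ell(1,3)])
      show "open ?V"
        by (intro open_Collect_conj open_Collect_less continuous_intros)
      show "z \<in> ?V" using z top[OF z True] by (auto simp: Q_def parabolic_cube_def)
      show "\<psi> z = w z + b (snd z)" using \<psi>(3) True hiw[OF z] by simp
      fix p assume "p \<in> ?V"
      then have p: "p \<in> Q" using VQ by blast
      show "\<psi> p \<le> w p + b (snd p)" using \<psi>(2) le[OF p] hiw[OF p] p by fastforce
    qed
  next
    case False
    then have lt: "W z < hi z" using le[OF z] by simp
    have "trace (jet_hessian (\<psi>'' z)) \<le> \<psi>' z (0, 1)"
    proof (rule scheme_limit_supersolution[where W = W and hi = hi and F = F and h = h and \<psi> = \<psi>, folded Q_def])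
      show "\<psi> w \<le> W w" if "w \<in> Q" for w using \<psi>(2) that by blast
    qed (fact W hi F lim h scheme z lt \<psi>)+
    moreover have "pucci_minus l' L' (jet_hessian (\<psi>'' z)) \<le> trace (jet_hessian (\<psi>'' z))"
      using jet_hessian_symmetric[OF \<psi>(1)[unfolded Q_def] z[unfolded Q_def]] ell by (intro pucci_minus_le_trace)
    moreover have "0 \<le> \<phi> (norm (jet_grad (\<psi>' z)))" by (rule \<phi>) simp
    ultimately show ?thesis by linarith
  qed
qed

text \<open>Near the top, \<open>w\<close> is replaced by the solution of a double obstacle problem for the heat
  equation. The obstacles \<open>w \<plusminus> b\<close> are separated by a function \<open>b\<close> of time that is so steep that
  they are not touched at the top, whence \<open>W\<close> is a viscosity solution up to the top.\<close>

lemma regularization_at_top: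
  fixes w :: "(real ^ 'n) \<times> real \<Rightarrow> real"
  defines "Qc \<equiv> {p. infnorm (fst p) \<le> 2 \<and> - 4 \<le> snd p \<and> snd p \<le> 0} :: ((real ^ 'n) \<times> real) set"
    and "V \<equiv> {p. infnorm (fst p) < 2 \<and> - 4 < snd p \<and> snd p < 0} :: ((real ^ 'n) \<times> real) set"
    and "Q \<equiv> parabolic_cube 2 0 0 :: ((real ^ 'n) \<times> real) set"
  assumes cont: "continuous_on Qc w" and m: "\<And>p. p \<in> Qc \<Longrightarrow> m \<le> w p"
    and super: "interior_supersolution l L \<phi> V w" and sub: "interior_supersolution l L \<phi> V (\<lambda>p. - w p)"
    and \<tau>0: "0 < \<tau>0" "\<tau>0 \<le> 1" and \<gamma>: "\<gamma> > 0"
    and ell: "l' \<le> l" "l' \<le> 1" "L \<le> L'" "1 \<le> L'" and \<phi>: "\<And>t. 0 \<le> t \<Longrightarrow> 0 \<le> \<phi> t"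
  obtains W where "continuous_on Qc W" "\<And>p. p \<in> Qc \<Longrightarrow> snd p \<le> - \<tau>0 \<Longrightarrow> W p = w p"
    "\<And>p. p \<in> Qc \<Longrightarrow> m \<le> W p" "W 0 \<le> w 0 + \<gamma>"
    "viscosity_supersolution l' L' \<phi> Q W" "viscosity_subsolution l' L' \<phi> Q W"
proof -
  let ?n = "real CARD('n)"
  let ?X = "{x :: real ^ 'n. infnorm x \<le> 2}"
  have Xclosed: "closed ?X" by (intro closed_Collect_le continuous_intros)
  have Xconvex: "convex ?X"
  proof (rule convexI)
    fix x y :: "real ^ 'n" and u v :: real
    assume *: "x \<in> ?X" "y \<in> ?X" "0 \<le> u" "0 \<le> v" "u + v = 1"
    have "infnorm (u *\<^sub>R x + v *\<^sub>R y) \<le> u * infnorm x + v * infnorm y"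
      using infnorm_triangle[of "u *\<^sub>R x" "v *\<^sub>R y"] * by (simp add: infnorm_mul)
    also have "\<dots> \<le> u * 2 + v * 2" using * by (intro add_mono mult_left_mono) auto
    also have "\<dots> = 2" using * by (simp flip: distrib_right)
    finally show "u *\<^sub>R x + v *\<^sub>R y \<in> ?X" by simp
  qed
  have X0: "?X \<noteq> {}" using infnorm_0[where 'a = "real ^ 'n"] by (auto intro: exI[of _ 0])
  have Qc_eq: "Qc = ?X \<times> {-4..0}" by (auto simp: Qc_def)
  have Qcc: "compact Qc"
    unfolding Qc_def by (rule compact_closed_cylinder)
  have QB: "Q \<subseteq> Qc" by (auto simp: Q_def parabolic_cube_def Qc_def)
  have zero: "0 \<in> Qc" by (simp add: Qc_def infnorm_0)
  \<comment> \<open>A nonexpansive retraction onto \<open>Qc\<close>. Composed with it, the data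
    extend to all of space-time, where the averages may sample them, without loss of
    continuity.\<close>
  define E where "E p = (closest_point ?X (fst p), max (- 4) (min 0 (snd p)))" for p :: "(real ^ 'n) \<times> real"
  have EQc: "E p \<in> Qc" for p
    using closest_point_in_set[OF Xclosed X0] by (auto simp: E_def Qc_eq)
  have Eid: "E p = p" if "p \<in> Qc" for p
    using that by (cases p) (auto simp: E_def Qc_eq closest_point_self)
  have Edist: "dist (E p) (E q) \<le> dist p q" for p q
  proof -
    have "dist (closest_point ?X (fst p)) (closest_point ?X (fst q)) \<le> dist (fst p) (fst q)"
      by (rule closest_point_lipschitz[OF Xconvex Xclosed X0])
    moreover have "dist (max (- 4) (min 0 (snd p))) (max (- 4) (min 0 (snd q))) \<le> dist (snd p) (snd q)"
      by (auto simp: dist_real_def max_def min_def)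
    ultimately show ?thesis
      unfolding E_def dist_prod_def by (auto intro!: real_sqrt_le_mono add_mono power_mono)
  qed
  have unif: "\<exists>d>0. \<forall>p q. dist p q < d \<longrightarrow> \<bar>f (E p) - f (E q)\<bar> < e"
    if f: "continuous_on Qc f" and e: "e > 0" for f :: "(real ^ 'n) \<times> real \<Rightarrow> real" and e
  proof -
    obtain d where d: "d > 0" "\<And>p q. p \<in> Qc \<Longrightarrow> q \<in> Qc \<Longrightarrow> dist q p < d \<Longrightarrow> dist (f q) (f p) < e"
      using compact_uniformly_continuous[OF f Qcc] e unfolding uniformly_continuous_on_def by blast
    have "\<bar>f (E p) - f (E q)\<bar> < e" if pq: "dist p q < d" for p q
      using d(2)[OF EQc EQc, of p q] Edist[of p q] pq by (simp add: dist_real_def)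
    then show ?thesis using d(1) by blast
  qed
  obtain M where M: "M > 0" "\<And>p. p \<in> Qc \<Longrightarrow> \<bar>w p\<bar> \<le> M"
    using compact_imp_bounded[OF compact_continuous_image[OF cont Qcc]] unfolding bounded_pos by auto
  obtain d where d: "d > 0" "\<And>p q. dist p q < d \<Longrightarrow> \<bar>w (E p) - w (E q)\<bar> < \<gamma> / 2"
    using unif[OF cont, of "\<gamma> / 2"] \<gamma> by auto
  \<comment> \<open>Chosen so that \<open>K * (d / 2)\<^sup>2 = 2 * M\<close>: outside the ball in
    which \<open>w\<close> varies by less than \<open>\<gamma> / 2\<close>, the paraboloid exceeds
    the oscillation of \<open>w\<close>.\<close>
  define K where "K = 8 * M / d\<^sup>2"
  have K: "K > 0" using M d by (simp add: K_def)
  \<comment> \<open>The second entry keeps the depth \<open>2 * \<tau>\<close> of the barrier's time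
    slab below \<open>d / 2\<close>; the third keeps the growth of the barrier at most
    \<open>\<gamma> / 2\<close>.\<close>
  define \<tau> where "\<tau> = min \<tau>0 (min (d / 5) (\<gamma> / (8 * ?n * K + 1)))"
  have nK: "8 * ?n * K + 1 > 0" using K by (simp add: add_nonneg_pos)
  have \<tau>: "\<tau> > 0" using \<tau>0 d \<gamma> nK by (simp add: \<tau>_def)
  have \<tau>_le: "\<tau> \<le> \<tau>0" "5 * \<tau> \<le> d" "8 * ?n * K * \<tau> \<le> \<gamma>"
  proof -
    show "\<tau> \<le> \<tau>0" by (simp add: \<tau>_def)
    have "\<tau> \<le> d / 5" unfolding \<tau>_def by linarith
    then show "5 * \<tau> \<le> d" by simp
    have "\<tau> \<le> \<gamma> / (8 * ?n * K + 1)" unfolding \<tau>_def by linarith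
    then have "\<tau> * (8 * ?n * K + 1) \<le> \<gamma>" using nK by (simp add: pos_le_divide_eq)
    then show "8 * ?n * K * \<tau> \<le> \<gamma>" using \<tau> by (simp add: algebra_simps)
  qed
  \<comment> \<open>This gives \<open>b 0 = 3 * M\<close>. Since \<open>W\<close> and
    \<open>w\<close> take values between \<open>- M\<close> and \<open>M\<close>, the obstacles
    cannot be touched at the top.\<close>
  define B where "B = 3 * M / \<tau> ^ 3"
  have B: "B > 0" using M \<tau> by (simp add: B_def)
  define b where "b s = B * (max 0 (s + \<tau>)) ^ 3" for s
  define b1 where "b1 s = B * (3 * (max 0 (s + \<tau>)) ^ 2)" for s
  define b2 where "b2 s = B * (3 * (2 * (max 0 (s + \<tau>)) ^ 1))" for s
  have shift: "DERIV (\<lambda>s. (max 0 (s + \<tau>)) ^ k) s :> real k * (max 0 (s + \<tau>)) ^ (k - 1)" if "k \<ge> 2" for k s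
    using DERIV_shift[of "\<lambda>s. (max 0 s) ^ k" _ s \<tau>] DERIV_pos_part_power[OF that, of "s + \<tau>"] by blast
  have b: "DERIV b s :> b1 s" "DERIV b1 s :> b2 s" "continuous_on UNIV b2" "0 \<le> b1 s" for s
  proof -
    show "DERIV b s :> b1 s" unfolding b_def[abs_def] b1_def using shift[of 3 s] by (intro DERIV_cmult) simp
    show "DERIV b1 s :> b2 s" unfolding b1_def[abs_def] b2_def using shift[of 2 s] by (intro DERIV_cmult) simp
    show "continuous_on UNIV b2" unfolding b2_def[abs_def] by (intro continuous_intros)
    show "0 \<le> b1 s" using B by (simp add: b1_def)
  qed
  have b0: "0 \<le> b s" "s \<le> - \<tau> \<Longrightarrow> b s = 0" for s using B by (auto simp: b_def max_def)
  have btop: "b 0 = 3 * M" using \<tau> by (simp add: b_def B_def)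
  define wt where "wt p = w (E p)" for p
  define lo where "lo p = w (E p) - b (snd (E p))" for p
  define hi where "hi p = w (E p) + b (snd (E p))" for p
  have obst: "lo p \<le> wt p" "wt p \<le> hi p" for p using b0(1) by (auto simp: wt_def lo_def hi_def)
  have past: "lo p = hi p" if "snd p \<le> - \<tau>" for p
  proof -
    have "snd (E p) \<le> - \<tau>" using that \<tau>_le(1) \<tau>0(2) \<tau> by (simp add: E_def)
    then show ?thesis using b0(2) by (simp add: lo_def hi_def)
  qed
  have wtM: "- M \<le> wt p" "wt p \<le> M" for p using M(2)[OF EQc[of p]] by (auto simp: wt_def)
  have bcont: "continuous_on Qc (\<lambda>p. b (snd p))"
    unfolding b_def by (intro continuous_intros)
  \<comment> \<open>\<open>Suc j\<close> steps of this length fill the layer exactly, so that the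
    iterate \<open>S j\<close> with \<open>Suc j\<close> sweeps is stationary up to time
    \<open>0\<close>.\<close>
  define h where "h j = \<tau> / real (Suc j)" for j
  have h: "h j > 0" "h j \<le> \<tau>" for j using \<tau> by (auto simp: h_def field_simps)
  have hlim: "h \<longlonglongrightarrow> 0"
    unfolding h_def[abs_def] using tendsto_mult_right_zero[OF LIMSEQ_inverse_real_of_nat, of \<tau>]
    by (simp add: divide_inverse)
  define S where "S j = obstacle_scheme (h j) wt lo hi (Suc j)" for j
  have between: "lo p \<le> S j p" "S j p \<le> hi p" for j p
    unfolding S_def by (rule obstacle_scheme_between; fact obst)+
  have bounds: "m \<le> S j p \<and> S j p \<le> M" for j p
    unfolding S_def
  proof (rule obstacle_scheme_bounds)
    show m1: "m \<le> wt p" for p using m[OF EQc[of p]] by (simp add: wt_def)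
    show "wt p \<le> M" for p by (rule wtM)
    show "m \<le> hi p" "lo p \<le> M" for p using m1[of p] wtM[of p] obst[of p] by linarith+
  qed
  have bounds': "- M \<le> S j p" for j p
  proof -
    have "- M \<le> S j p \<and> S j p \<le> M"
      unfolding S_def
    proof (rule obstacle_scheme_bounds)
      show "- M \<le> wt p" "wt p \<le> M" "- M \<le> hi p" "lo p \<le> M" for p using wtM[of p] obst[of p] by linarith+
    qed
    then show ?thesis by simp
  qed
  have step: "S j p = max (lo p) (min (hi p) (neighbour_avg (h j) (S j) p))" if "snd p \<le> 0" for j p
  proof -
    have "- \<tau> + real (Suc j) * h j = 0" by (simp add: h_def)
    then have "obstacle_scheme (h j) wt lo hi (Suc (Suc j)) p = obstacle_scheme (h j) wt lo hi (Suc j) p"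
      using that by (intro obstacle_scheme_stable[of lo wt hi \<tau>] obst past) auto
    then show ?thesis unfolding S_def by (simp only: obstacle_scheme.simps)
  qed
  have up: "neighbour_avg (h j) (S j) p \<le> S j p" if "snd p \<le> 0" "S j p < hi p" for j p
    using step[OF that(1), of j] that(2) by linarith
  have down: "S j p \<le> neighbour_avg (h j) (S j) p" if "snd p \<le> 0" "lo p < S j p" for j p
    using step[OF that(1), of j] that(2) by linarith
  have equi: "\<exists>r>0. \<forall>j p q. dist p q < r \<longrightarrow> \<bar>S j q - S j p\<bar> < e" if e: "e > 0" for e
  proof -
    obtain r1 where r1: "r1 > 0" "\<And>p q. dist p q < r1 \<Longrightarrow> \<bar>w (E p) - w (E q)\<bar> < e / 4"
      using unif[OF cont, of "e / 4"] e by auto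
    obtain r2 where r2: "r2 > 0" "\<And>p q. dist p q < r2 \<Longrightarrow> \<bar>b (snd (E p)) - b (snd (E q))\<bar> < e / 4"
      using unif[OF bcont, of "e / 4"] e by auto
    have "\<bar>S j q - S j p\<bar> < e" if pq: "dist p q < min r1 r2" for j p q
    proof -
      have *: "\<bar>w (E (x + (q - p))) - w (E x)\<bar> < e / 4" "\<bar>b (snd (E (x + (q - p)))) - b (snd (E x))\<bar> < e / 4" for x
        using r1(2)[of "x + (q - p)" x] r2(2)[of "x + (q - p)" x] pq by (auto simp: dist_norm norm_minus_commute)
      have "\<bar>S j (p + (q - p)) - S j p\<bar> \<le> e / 2"
        unfolding S_def
      proof (rule obstacle_scheme_equicontinuous)
        fix x
        show "\<bar>wt (x + (q - p)) - wt x\<bar> \<le> e / 2" "\<bar>lo (x + (q - p)) - lo x\<bar> \<le> e / 2" "\<bar>hi (x + (q - p)) - hi x\<bar> \<le> e / 2"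
          using *[of x] e unfolding wt_def lo_def hi_def by linarith+
      qed
      then show ?thesis using e by simp
    qed
    then show ?thesis using r1(1) r2(1) by (intro exI[of _ "min r1 r2"]) auto
  qed
  obtain W k where W: "continuous_on Qc W" and k: "strict_mono (k :: nat \<Rightarrow> nat)"
    and lim: "\<And>e. 0 < e \<Longrightarrow> \<exists>N. \<forall>n x. n \<ge> N \<and> x \<in> Qc \<longrightarrow> norm (S (k n) x - W x) < e"
  proof (rule Arzela_Ascoli[OF Qcc, of S M])
    show "norm (S n x) \<le> M" for n x using bounds[of n x] bounds'[of n x] by auto
    show "\<exists>d>0. \<forall>n y. y \<in> Qc \<and> norm (x - y) < d \<longrightarrow> norm (S n x - S n y) < e" if "0 < e" for x e
    proof -
      obtain r where "r > 0" "\<And>j p q. dist p q < r \<Longrightarrow> \<bar>S j q - S j p\<bar> < e" using equi[OF \<open>0 < e\<close>] by blast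
      then show ?thesis by (intro exI[of _ r]) (auto simp: dist_norm abs_minus_commute)
    qed
  qed blast
  define F where "F n = S (k n)" for n
  have lim: "\<forall>\<^sub>F n in sequentially. \<forall>p\<in>Qc. \<bar>F n p - W p\<bar> < e" if "e > 0" for e
    using lim[OF that] unfolding eventually_sequentially F_def real_norm_def by blast
  have ptw: "(\<lambda>n. F n p) \<longlonglongrightarrow> W p" if p: "p \<in> Qc" for p
    unfolding tendsto_iff dist_real_def
  proof (intro allI impI)
    fix e :: real assume "e > 0"
    from lim[OF this] show "\<forall>\<^sub>F n in sequentially. \<bar>F n p - W p\<bar> < e"
      by (rule eventually_mono) (use p in blast)
  qed
  have Wle: "W p \<le> a" if "p \<in> Qc" "\<And>j. S j p \<le> a" for p a
    by (rule LIMSEQ_le_const2[OF ptw[OF that(1)]]) (use that(2) in \<open>auto simp: F_def\<close>)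
  have Wge: "a \<le> W p" if "p \<in> Qc" "\<And>j. a \<le> S j p" for p a
    by (rule LIMSEQ_le_const[OF ptw[OF that(1)]]) (use that(2) in \<open>auto simp: F_def\<close>)
  have on_Qc: "lo p = w p - b (snd p)" "hi p = w p + b (snd p)" "wt p = w p" if "p \<in> Qc" for p
    using Eid[OF that] by (auto simp: lo_def hi_def wt_def)
  have hk: "\<And>n. h (k n) > 0" "(\<lambda>n. h (k n)) \<longlonglongrightarrow> 0"
    using h(1) LIMSEQ_subseq_LIMSEQ[OF hlim k] by (auto simp: o_def)
  have Fcont: "continuous_on Qc (F n)" for n
    unfolding continuous_on_iff dist_real_def F_def
  proof (intro ballI allI impI)
    fix x :: "(real ^ 'n) \<times> real" and e :: real assume "e > 0"
    obtain r where "r > 0" "\<And>j p q. dist p q < r \<Longrightarrow> \<bar>S j q - S j p\<bar> < e" using equi[OF \<open>0 < e\<close>] by blast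
    then show "\<exists>d>0. \<forall>x'\<in>Qc. dist x' x < d \<longrightarrow> \<bar>S (k n) x' - S (k n) x\<bar> < e"
      by (intro exI[of _ r]) (auto simp: dist_commute)
  qed
  have WM: "- M \<le> W p" "W p \<le> M" if "p \<in> Qc" for p
    using Wle[OF that, of M] Wge[OF that, of "- M"] bounds bounds' by blast+
  have top: "snd p < 0" if p: "p \<in> Q" and c: "W p = hi p \<or> W p = lo p" for p
  proof (rule ccontr)
    assume "\<not> snd p < 0"
    then have "snd p = 0" using p by (auto simp: Q_def parabolic_cube_def)
    moreover have pb: "p \<in> Qc" using p QB by blast
    ultimately have "W p = w p + 3 * M \<or> W p = w p - 3 * M"
      using c on_Qc[OF pb] btop by simp
    then show False using WM[OF pb] M(1) M(2)[OF pb] by linarith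
  qed
  have contQ: "continuous_on Q f" if "continuous_on Qc f" for f :: "(real ^ 'n) \<times> real \<Rightarrow> real"
    using that QB continuous_on_subset by blast
  have hicont: "continuous_on Qc hi"
    using continuous_on_add[OF cont bcont] by (rule continuous_on_eq) (simp add: on_Qc)
  have locont: "continuous_on Qc lo"
    using continuous_on_diff[OF cont bcont] by (rule continuous_on_eq) (simp add: on_Qc)
  have W0: "W 0 \<le> w 0 + \<gamma>"
  proof (rule Wle[OF zero])
    fix j
    have "S j 0 \<le> w 0 + \<gamma> / 2 + K * (fst (0 :: (real ^ 'n) \<times> real) \<bullet> fst (0 :: (real ^ 'n) \<times> real))
        + 2 * ?n * K * (snd (0 :: (real ^ 'n) \<times> real) + \<tau> + h j)"
      unfolding S_def
    proof (rule obstacle_scheme_upper_barrier)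
      fix p :: "(real ^ 'n) \<times> real"
      assume p: "- \<tau> - h j \<le> snd p" "snd p \<le> 0"
      show "wt p \<le> w 0 + \<gamma> / 2 + K * (fst p \<bullet> fst p)"
      proof (cases "dist p 0 < d")
        case True
        have "\<bar>w (E p) - w 0\<bar> < \<gamma> / 2" using d(2)[OF True] unfolding Eid[OF zero] .
        then have "wt p < w 0 + \<gamma> / 2" unfolding wt_def by linarith
        moreover have "0 \<le> K * (fst p \<bullet> fst p)" using K by simp
        ultimately show ?thesis by linarith
      next
        case False
        have "norm p \<le> norm (fst p) + norm (snd p)" using norm_Pair_le[of "fst p" "snd p"] by simp
        then have "d \<le> norm (fst p) + 2 * \<tau>" using False p h(2)[of j] by simp
        then have "d / 2 \<le> norm (fst p)" using \<tau>_le(2) d(1) by simp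
        then have "(d / 2)\<^sup>2 \<le> (norm (fst p))\<^sup>2" using d(1) by (intro power_mono) auto
        then have "K * (d / 2)\<^sup>2 \<le> K * (fst p \<bullet> fst p)" using K by (simp add: power2_norm_eq_inner)
        moreover have "K * (d / 2)\<^sup>2 = 2 * M" using d(1) by (simp add: K_def power2_eq_square)
        moreover have "wt p \<le> M" "- M \<le> w 0" using wtM[of p] M(2)[OF zero] by auto
        ultimately show ?thesis using \<gamma> by linarith
      qed
    qed (use obst past h(1)[of j] K \<tau> in \<open>auto simp: less_imp_le\<close>)
    then have "S j 0 \<le> w 0 + \<gamma> / 2 + 2 * ?n * K * (\<tau> + h j)" by simp
    moreover have "2 * ?n * K * (\<tau> + h j) \<le> 2 * ?n * K * (2 * \<tau>)"
      using h(2)[of j] K by (intro mult_left_mono) auto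
    ultimately show "S j 0 \<le> w 0 + \<gamma>" using \<tau>_le(3) by linarith
  qed
  have visc_super: "viscosity_supersolution l' L' \<phi> Q W"
  proof (rule obstacle_limit_supersolution[OF _ _ _ _ _ _ _ _ _ _ _ b(1,2,3,4) ell \<phi>,
        where F = F and h = "\<lambda>n. h (k n)" and hi = hi and w = w, folded Q_def])
    show "continuous_on Q W" "continuous_on Q hi" "continuous_on Q (F n)" for n
      using W hicont Fcont contQ by blast+
    show "\<forall>\<^sub>F n in sequentially. \<forall>p\<in>Q. \<bar>F n p - W p\<bar> < e" if "e > 0" for e
      using lim[OF that] by (rule eventually_mono) (use QB in blast)
    show "neighbour_avg (h (k n)) (F n) p \<le> F n p" if "snd p \<le> 0" "F n p < hi p" for n p
      using up[of p "k n"] that by (simp add: F_def)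
    show "W p \<le> hi p" if "p \<in> Q" for p using between(2) QB that by (intro Wle) blast+
    show "snd p < 0" if "p \<in> Q" "W p = hi p" for p using top[OF that(1)] that(2) by simp
    show "hi p = w p + b (snd p)" if "p \<in> Q" for p using on_Qc QB that by blast
    show "interior_supersolution l L \<phi> {p. infnorm (fst p) < 2 \<and> - 4 < snd p \<and> snd p < 0} w"
      using super by (simp add: V_def)
  qed (fact hk)+
  \<comment> \<open>The same argument after a change of sign: the lower obstacle of \<open>W\<close>
    becomes the upper obstacle \<open>- w + b\<close> of \<open>- W\<close>.\<close>
  have "viscosity_supersolution l' L' \<phi> Q (\<lambda>p. - W p)"
  proof (rule obstacle_limit_supersolution[OF _ _ _ _ _ _ _ _ _ _ _ b(1,2,3,4) ell \<phi>,
        where F = "\<lambda>n p. - F n p" and h = "\<lambda>n. h (k n)" and hi = "\<lambda>p. - lo p"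
        and w = "\<lambda>p. - w p", folded Q_def])
    show "continuous_on Q (\<lambda>p. - W p)" "continuous_on Q (\<lambda>p. - lo p)" "continuous_on Q (\<lambda>p. - F n p)" for n
      using W locont Fcont contQ continuous_on_minus by blast+
    show "\<forall>\<^sub>F n in sequentially. \<forall>p\<in>Q. \<bar>- F n p - - W p\<bar> < e" if "e > 0" for e
      using lim[OF that] by (rule eventually_mono) (use QB in force)
    show "neighbour_avg (h (k n)) (\<lambda>p. - F n p) p \<le> - F n p" if "snd p \<le> 0" "- F n p < - lo p" for n p
      using down[of p "k n"] that by (simp add: F_def neighbour_avg_uminus)
    show "- W p \<le> - lo p" if p: "p \<in> Q" for p
      using Wge[of p "lo p"] between(1) QB p by auto
    show "- lo p = - w p + b (snd p)" if "p \<in> Q" for p using on_Qc(1)[of p] QB that by auto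
    show "interior_supersolution l L \<phi> {p. infnorm (fst p) < 2 \<and> - 4 < snd p \<and> snd p < 0} (\<lambda>p. - w p)"
      using sub by (simp add: V_def)
    show "snd p < 0" if "p \<in> Q" "- W p = - lo p" for p using top[OF that(1)] that(2) by simp
  qed (fact hk)+
  then have visc_sub: "viscosity_subsolution l' L' \<phi> Q W"
    unfolding Q_def viscosity_subsolution_iff .
  show thesis
  proof (rule that[OF W _ _ W0 visc_super visc_sub])
    fix p assume p: "p \<in> Qc"
    show "m \<le> W p" using bounds by (intro Wge[OF p]) blast
    assume "snd p \<le> - \<tau>0"
    then have "lo p = hi p" using past[of p] \<tau>_le by simp
    moreover have "lo p \<le> W p" "W p \<le> hi p"
      by (rule Wge[OF p between(1)], rule Wle[OF p between(2)])
    ultimately show "W p = w p" using obst[of p] on_Qc(3)[OF p] by linarith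
  qed
qed

section \<open>The forward inequality\<close>

text \<open>The claim is immediate if \<open>u (x1, t1) \<ge> \<mu>\<close>. Otherwise the
  normalized value at the later point lies between \<open>1 / (4 * C')\<close> and \<open>2\<close>,
  where \<open>\<eta>\<close> is at most \<open>H\<close>; hence the fixed \<open>a\<close> is
  admissible and the backward inequality applies with the later point as its base.\<close>

lemma intrinsic_harnack_step:
  fixes u :: "(real ^ 'n) \<times> real \<Rightarrow> real"
  defines "Q \<equiv> parabolic_cube 2 0 0 :: ((real ^ 'n) \<times> real) set"
  assumes bh: "\<And>(v :: (real ^ 'n) \<times> real \<Rightarrow> real) a. continuous_on Q v \<Longrightarrow> (\<And>z. z \<in> Q \<Longrightarrow> v z > 0) \<Longrightarrow>
      viscosity_supersolution l' L' \<phi> Q v \<Longrightarrow> viscosity_subsolution l' L' \<phi> Q v \<Longrightarrow>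
      0 < a \<Longrightarrow> a \<le> v (0, 0) / (C' * (\<phi> (v (0, 0)) + v (0, 0))) \<Longrightarrow>
      (SUP (x, t) \<in> A_minus_1 c. v (a *\<^sub>R x, a\<^sup>2 * t)) \<le> C' * v (0, 0)"
    and C': "C' \<ge> 1" and c: "0 < c" "c \<le> 1"
    and ell: "l' \<le> l" "l' \<le> 1" "L \<le> L'" "1 \<le> L'"
    and eta: "\<And>t. t \<ge> 0 \<Longrightarrow> \<phi> t = \<eta> t * t" and ge1: "\<And>t. t > 0 \<Longrightarrow> 1 \<le> \<eta> t"
    and P3: "\<And>s t. s > 0 \<Longrightarrow> t > 0 \<Longrightarrow> \<eta> (s * t) \<le> \<Lambda> * \<eta> s * \<eta> t"
    and H: "\<And>v. 1 / (4 * C') \<le> v \<Longrightarrow> v \<le> 2 \<Longrightarrow> \<eta> v \<le> H"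
    and u: "continuous_on Q u" "\<And>z. z \<in> Q \<Longrightarrow> 0 \<le> u z"
      "viscosity_supersolution l L \<phi> Q u" "viscosity_subsolution l L \<phi> Q u"
    and r: "r > 0" and \<mu>: "\<mu> > 0" and small: "r * \<Lambda> * \<eta> (\<mu> / r) \<le> 1"
    and inQ: "\<And>y s. infnorm y \<le> 2 \<Longrightarrow> - 4 \<le> s \<Longrightarrow> s \<le> 0 \<Longrightarrow> (x1 + r *\<^sub>R y, t1 + r\<^sup>2 * s) \<in> Q"
    and a: "0 < a" "a \<le> 1" "a \<le> 1 / (C' * (H + 1))"
    and y: "(y, s) \<in> A_minus_1 c" and big: "\<mu> \<le> u (x1 + r *\<^sub>R a *\<^sub>R y, t1 + r\<^sup>2 * (a\<^sup>2 * s))"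
  shows "\<mu> / (2 * C') \<le> u (x1, t1)"
proof (cases "\<mu> \<le> u (x1, t1)")
  case True
  have "\<mu> / (2 * C') \<le> \<mu> / 1" using C' \<mu> by (intro divide_left_mono) auto
  then show ?thesis using True by simp
next
  case False
  \<comment> \<open>The shift makes the function positive and its value at the base point bounded
    below. It enters the final estimate, together with the regularization error
    \<open>\<delta> / 2\<close>, only as \<open>3 / 2 * (C' * \<delta>) = 3 / 8\<close>.\<close>
  define \<delta> where "\<delta> = 1 / (4 * C')"
  have \<delta>: "\<delta> > 0" "\<delta> \<le> 1 / 4" "C' * \<delta> = 1 / 4" using C' by (auto simp: \<delta>_def field_simps)
  define w where "w = (\<lambda>(y, s). u (x1 + r *\<^sub>R y, t1 + r\<^sup>2 * s) / \<mu> + \<delta>)"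
  let ?B = "{p. infnorm (fst p) \<le> 2 \<and> - 4 \<le> snd p \<and> snd p \<le> 0} :: ((real ^ 'n) \<times> real) set"
  let ?V = "{p. infnorm (fst p) < 2 \<and> - 4 < snd p \<and> snd p < 0} :: ((real ^ 'n) \<times> real) set"
  have VQ: "(x1 + r *\<^sub>R y, t1 + r\<^sup>2 * s) \<in> Q" if "(y, s) \<in> ?V" for y s
    using that by (intro inQ) auto
  have "viscosity_supersolution l L \<phi> Q (\<lambda>z. - u z)"
    using u(4) unfolding Q_def viscosity_subsolution_iff .
  then have su: "interior_supersolution l L \<phi> Q u" "interior_supersolution l L \<phi> Q (\<lambda>z. - u z)"
    using u(1,3) viscosity_supersolution_interior[of l L \<phi> _ Q] continuous_on_minus[OF u(1)]
    unfolding Q_def by blast+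
  have w_super: "interior_supersolution l L \<phi> ?V w"
    unfolding w_def by (rule interior_supersolution_scale[OF su(1) VQ r \<mu> eta ge1 P3 small])
  have "interior_supersolution l L \<phi> ?V (\<lambda>(y, s). - u (x1 + r *\<^sub>R y, t1 + r\<^sup>2 * s) / \<mu> + (- \<delta>))"
    by (rule interior_supersolution_scale[OF su(2) VQ r \<mu> eta ge1 P3 small])
  moreover have "(\<lambda>(y, s). - u (x1 + r *\<^sub>R y, t1 + r\<^sup>2 * s) / \<mu> + (- \<delta>)) = (\<lambda>p. - w p)"
    by (auto simp: w_def fun_eq_iff)
  ultimately have w_sub: "interior_supersolution l L \<phi> ?V (\<lambda>p. - w p)" by simp
  have w_cont: "continuous_on ?B w"
  proof -
    have "continuous_on ?B (\<lambda>p. u (x1 + r *\<^sub>R fst p, t1 + r\<^sup>2 * snd p))"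
      by (rule continuous_on_compose2[OF u(1)]) (auto intro!: continuous_intros inQ)
    then show ?thesis
      unfolding w_def split_beta using \<mu> by (intro continuous_intros) auto
  qed
  have w_ge: "\<delta> \<le> w p" if "p \<in> ?B" for p
    using u(2)[OF inQ, of "fst p" "snd p"] that \<mu> by (auto simp: w_def split_beta)
  \<comment> \<open>Since \<open>c \<le> 1\<close>, the times in \<open>A_minus_1 c\<close> are at
    most \<open>- 1 / 2\<close>; scaled by \<open>a\<^sup>2\<close> they precede
    \<open>- (a\<^sup>2 / 2)\<close>, before which the regularization leaves \<open>w\<close>
    unchanged.\<close>
  have a2: "0 < a\<^sup>2 / 2" "a\<^sup>2 / 2 \<le> 1" using a power_le_one[of a 2] by auto
  have \<phi>0: "0 \<le> \<phi> t" if "0 \<le> t" for t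
    using eta[OF that] ge1[of t] that by (cases "t = 0") auto
  obtain W where W: "continuous_on ?B W" "\<And>p. p \<in> ?B \<Longrightarrow> snd p \<le> - (a\<^sup>2 / 2) \<Longrightarrow> W p = w p"
    "\<And>p. p \<in> ?B \<Longrightarrow> \<delta> \<le> W p" "W 0 \<le> w 0 + \<delta> / 2"
    "viscosity_supersolution l' L' \<phi> Q W" "viscosity_subsolution l' L' \<phi> Q W"
    using regularization_at_top[OF w_cont w_ge w_super w_sub a2 _ ell \<phi>0, of "\<delta> / 2"] \<delta>(1)
    unfolding Q_def by auto
  have QB: "Q \<subseteq> ?B" by (auto simp: Q_def parabolic_cube_def)
  have zero: "(0, 0) \<in> ?B" by (simp add: infnorm_0)
  define W0 where "W0 = W (0, 0)"
  have W0: "\<delta> \<le> W0" "W0 \<le> u (x1, t1) / \<mu> + \<delta> + \<delta> / 2"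
    using W(3)[OF zero] W(4) by (auto simp: W0_def w_def zero_prod_def)
  have "u (x1, t1) / \<mu> \<le> 1" using False \<mu> by simp
  then have W0': "W0 \<le> 2" "W0 > 0" using W0 \<delta> by auto
  have le: "C' * (\<eta> W0 + 1) \<le> C' * (H + 1)" using H[of W0] W0 W0' C' by (intro mult_left_mono) (auto simp: \<delta>_def)
  have pos: "0 < C' * (\<eta> W0 + 1)" using C' ge1[OF W0'(2)] by (intro mult_pos_pos) auto
  have "1 / (C' * (H + 1)) \<le> 1 / (C' * (\<eta> W0 + 1))"
    by (rule divide_left_mono[OF le zero_le_one mult_pos_pos[OF less_le_trans[OF pos le] pos]])
  also have "\<dots> = W0 / (W0 * (C' * (\<eta> W0 + 1)))" using W0'(2) by simp
  also have "W0 * (C' * (\<eta> W0 + 1)) = C' * (\<phi> W0 + W0)"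
    using eta[of W0] W0'(2) by (simp add: algebra_simps)
  finally have aW: "a \<le> W0 / (C' * (\<phi> W0 + W0))" using a(3) by simp
  have A: "(a *\<^sub>R x, a\<^sup>2 * t) \<in> ?B \<and> a\<^sup>2 * t \<le> - (a\<^sup>2 / 2)" if "(x, t) \<in> A_minus_1 c" for x t
  proof -
    have t: "infnorm x \<le> c / 2" "- 1 + c\<^sup>2 / 4 \<le> t" "t \<le> - 1 + c\<^sup>2 / 2" using that by (auto simp: A_minus_1_def)
    have "c\<^sup>2 \<le> 1" using c by (simp add: power_le_one)
    then have t': "- 1 \<le> t" "t \<le> - 1 / 2" using t zero_le_power2[of c] by linarith+
    have "a * infnorm x \<le> 1 * (c / 2)" using a t by (intro mult_mono) (auto simp: infnorm_pos_le)
    then have "infnorm (a *\<^sub>R x) \<le> 2" using a c by (simp add: infnorm_mul)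
    moreover have "a\<^sup>2 * t \<le> a\<^sup>2 * (- 1 / 2)" using t' by (intro mult_left_mono) auto
    moreover have "a\<^sup>2 * (- 1) \<le> a\<^sup>2 * t" using t' by (intro mult_left_mono) auto
    moreover have "a\<^sup>2 \<le> 1" using a2 a power_le_one[of a 2] by simp
    ultimately show ?thesis by auto
  qed
  \<comment> \<open>A supremum of reals bounds its members only if the set is bounded above;
    continuity on the closed cylinder provides this.\<close>
  have "bdd_above (W ` ?B)"
    by (intro bounded_imp_bdd_above compact_imp_bounded compact_continuous_image W(1)
        compact_closed_cylinder)
  then have bdd: "bdd_above ((\<lambda>(x, t). W (a *\<^sub>R x, a\<^sup>2 * t)) ` A_minus_1 c)"
    by (rule bdd_above_mono) (use A in auto)
  have ay: "(a *\<^sub>R y, a\<^sup>2 * s) \<in> ?B" "a\<^sup>2 * s \<le> - (a\<^sup>2 / 2)" using A[OF y] by auto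
  have "1 + \<delta> \<le> w (a *\<^sub>R y, a\<^sup>2 * s)" using big \<mu> by (simp add: w_def)
  also have "\<dots> = W (a *\<^sub>R y, a\<^sup>2 * s)" using W(2)[OF ay(1)] ay(2) by simp
  also have "\<dots> \<le> (SUP (x, t) \<in> A_minus_1 c. W (a *\<^sub>R x, a\<^sup>2 * t))"
    using cSUP_upper[OF y bdd] by simp
  also have "\<dots> \<le> C' * W0"
    unfolding W0_def
  proof (rule bh)
    show "continuous_on Q W" using W(1) QB continuous_on_subset by blast
    show "W z > 0" if "z \<in> Q" for z using W(3)[of z] that QB \<delta>(1) by fastforce
    show "a \<le> W (0, 0) / (C' * (\<phi> (W (0, 0)) + W (0, 0)))" using aW by (simp add: W0_def)
  qed (fact W a)+
  also have "\<dots> \<le> C' * (u (x1, t1) / \<mu> + \<delta> + \<delta> / 2)" using W0 C' by (intro mult_left_mono) auto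
  also have "\<dots> = C' * (u (x1, t1) / \<mu>) + 3 / 2 * (C' * \<delta>)" by (simp add: algebra_simps)
  finally have "1 / 2 \<le> C' * (u (x1, t1) / \<mu>)" using \<delta> by simp
  then show ?thesis using C' \<mu> by (simp add: field_simps)
qed

theorem theorem1p2:
  fixes c l L :: real and \<phi> :: "real \<Rightarrow> real"
  assumes "backward_harnack_const TYPE('n::finite) c"
    and "0 < l" and "l \<le> L"
    and "nonlinearity \<phi>"
  shows "\<exists>C>0. \<forall>(u :: (real ^ 'n) \<times> real \<Rightarrow> real) x0 t0 \<rho>.
    continuous_on (parabolic_cube 2 0 0) u \<and>
    (\<forall>z \<in> parabolic_cube 2 0 0. 0 \<le> u z) \<and>
    viscosity_supersolution l L \<phi> (parabolic_cube 2 0 0) u \<and>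
    viscosity_subsolution l L \<phi> (parabolic_cube 2 0 0) u \<and>
    (x0, t0) \<in> parabolic_cube 2 0 0 \<and> 0 < u (x0, t0) \<and>
    0 < \<rho> \<and> parabolic_cube (2 * \<rho>) x0 t0 \<union> A_plus c \<rho> x0 t0 \<subseteq> parabolic_cube 2 0 0 \<and>
    \<rho> \<le> u (x0, t0) / (C * (\<phi> (u (x0, t0)) + u (x0, t0))) \<longrightarrow>
    u (x0, t0) \<le> C * (INF z \<in> A_plus c \<rho> x0 t0. u z)"
proof -
  let ?Q = "parabolic_cube 2 0 0 :: ((real ^ 'n) \<times> real) set"
  obtain \<eta> \<Lambda> T where eta: "\<And>t. t \<ge> 0 \<Longrightarrow> \<phi> t = \<eta> t * t" and ge1: "\<And>t. t > 0 \<Longrightarrow> 1 \<le> \<eta> t"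
    and anti: "antimono_on {0<..<1} \<eta>" and mon: "mono_on {1..} \<eta>"
    and L: "\<Lambda> \<ge> 1" "\<And>s t. s > 0 \<Longrightarrow> t > 0 \<Longrightarrow> \<eta> (s * t) \<le> \<Lambda> * \<eta> s * \<eta> t"
    and T: "T \<ge> 1" "\<And>s t. T \<le> s \<Longrightarrow> s \<le> t \<Longrightarrow> (ln (\<eta> t))\<^sup>2 - (ln (\<eta> s))\<^sup>2 \<le> 2 * (ln t - ln s)"
    using nonlinearity_growth[OF assms(4)] by metis
  \<comment> \<open>Widening the ellipticity range to contain \<open>1\<close> admits the heat
    equation used near the top.\<close>
  define l' where "l' = min l 1"
  define L' where "L' = max L 1"
  have ell: "0 < l'" "l' \<le> L'" "l' \<le> l" "l' \<le> 1" "L \<le> L'" "1 \<le> L'" using assms(2,3) by (auto simp: l'_def L'_def)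
  have c: "0 < c" "c \<le> 1" using assms(1) by (auto simp: backward_harnack_const_def)
  obtain C0 where C0: "C0 > 0" and bh0: "\<forall>u :: (real ^ 'n) \<times> real \<Rightarrow> real.
          continuous_on ?Q u \<and> (\<forall>z \<in> ?Q. u z > 0) \<and>
          viscosity_supersolution l' L' \<phi> ?Q u \<and> viscosity_subsolution l' L' \<phi> ?Q u \<longrightarrow>
          (\<forall>a0. 0 < a0 \<and> a0 \<le> u (0, 0) / (C0 * (\<phi> (u (0, 0)) + u (0, 0))) \<longrightarrow>
             (SUP (x, t) \<in> A_minus_1 c. u (a0 *\<^sub>R x, a0\<^sup>2 * t)) \<le> C0 * u (0, 0))"
    using assms(1)[unfolded backward_harnack_const_def, THEN conjunct2, THEN conjunct2, rule_format, of l' L' \<phi>]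
      ell(1,2) assms(4) by blast
  define C' where "C' = max C0 1"
  have C': "C' \<ge> 1" "C0 \<le> C'" by (auto simp: C'_def)
  have bh: "(SUP (x, t) \<in> A_minus_1 c. v (a *\<^sub>R x, a\<^sup>2 * t)) \<le> C' * v (0, 0)"
    if v: "continuous_on ?Q v" "\<And>z. z \<in> ?Q \<Longrightarrow> v z > 0"
      "viscosity_supersolution l' L' \<phi> ?Q v" "viscosity_subsolution l' L' \<phi> ?Q v"
      and a: "0 < a" "a \<le> v (0, 0) / (C' * (\<phi> (v (0, 0)) + v (0, 0)))"
    for v :: "(real ^ 'n) \<times> real \<Rightarrow> real" and a
  proof -
    have "(0, 0) \<in> ?Q" by (simp add: parabolic_cube_def infnorm_0)
    then have v0: "v (0, 0) > 0" by (rule v(2))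
    have "0 < \<phi> (v (0, 0)) + v (0, 0)" using eta[of "v (0, 0)"] ge1[OF v0] v0 by (simp add: add_pos_pos)
    then have "v (0, 0) / (C' * (\<phi> (v (0, 0)) + v (0, 0))) \<le> v (0, 0) / (C0 * (\<phi> (v (0, 0)) + v (0, 0)))"
      using C0 C' v0 by (intro divide_left_mono mult_right_mono mult_pos_pos) auto
    then have "a \<le> v (0, 0) / (C0 * (\<phi> (v (0, 0)) + v (0, 0)))" using a(2) by simp
    then have "(SUP (x, t) \<in> A_minus_1 c. v (a *\<^sub>R x, a\<^sup>2 * t)) \<le> C0 * v (0, 0)"
      using bh0[rule_format, of v a] v a(1) by blast
    also have "\<dots> \<le> C' * v (0, 0)" using C'(2) v0 by (intro mult_right_mono) auto
    finally show ?thesis .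
  qed
  define \<theta> where "\<theta> = 1 / (2 * C')"
  have \<theta>: "\<theta> > 0" using C' by (simp add: \<theta>_def)
  \<comment> \<open>\<open>\<eta>\<close> decreases below \<open>1\<close> and increases from
    \<open>1\<close> on, so on the interval from \<open>1 / (4 * C')\<close> to \<open>2\<close> it
    is bounded by its values at the ends.\<close>
  define H where "H = max (\<eta> (1 / (4 * C'))) (\<eta> 2)"
  have H: "\<eta> v \<le> H" if "1 / (4 * C') \<le> v" "v \<le> 2" for v
  proof (cases "v < 1")
    case True
    have "0 < 1 / (4 * C')" using C' by simp
    then have "1 / (4 * C') \<in> {0<..<1}" "v \<in> {0<..<1}"
      using that True unfolding greaterThanLessThan_iff by linarith+
    then have "\<eta> v \<le> \<eta> (1 / (4 * C'))" using anti that(1) unfolding monotone_on_def by blast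
    then show ?thesis by (simp add: H_def)
  next
    case False
    then have "\<eta> v \<le> \<eta> 2" using mon that by (auto simp: mono_on_def)
    then show ?thesis by (simp add: H_def)
  qed
  have H1: "H \<ge> 1" using ge1[of 2] by (simp add: H_def le_max_iff_disj)
  \<comment> \<open>The first summand yields \<open>a = 2 / s \<le> 1 / (C' * (H + 1))\<close>, and
    the summand \<open>4\<close> yields \<open>a \<le> 1\<close>.\<close>
  define n where "n = nat \<lceil>(2 * (C' * (H + 1)))\<^sup>2\<rceil> + 4"
  define s where "s = sqrt (real n)"
  have n0: "n > 0" by (simp add: n_def)
  have CH: "0 < C' * (H + 1)" using C' H1 by (intro mult_pos_pos) auto
  have "(2 * (C' * (H + 1)))\<^sup>2 \<le> real n" unfolding n_def by linarith
  then have s1: "2 * (C' * (H + 1)) \<le> s" unfolding s_def by (rule real_le_rsqrt)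
  have "4 \<le> n" unfolding n_def by (rule le_add2)
  then have "2\<^sup>2 \<le> real n" by simp
  then have s2: "2 \<le> s" unfolding s_def by (rule real_le_rsqrt)
  have ss: "s * s = real n" by (simp add: s_def)
  define a where "a = 2 / s"
  have a: "0 < a" "a \<le> 1" "a \<le> 1 / (C' * (H + 1))"
    using s2 s1 CH by (auto simp: a_def field_simps)
  \<comment> \<open>Along the chain the lower bound decays like \<open>u0 * \<theta> ^ k\<close>.
    (P3) reduces the smallness condition at these heights to the one at \<open>u0\<close>, at the
    cost of a factor \<open>\<Lambda> * \<eta> (\<theta> ^ k)\<close>; \<open>\<epsilon>\<close>
    absorbs it together with the \<open>\<Lambda>\<close> of the scaling condition.\<close>
  define G where "G = Max ((\<lambda>k. \<eta> (\<theta> ^ k)) ` {..n})"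
  have G: "\<eta> (\<theta> ^ k) \<le> G" if "k \<le> n" for k unfolding G_def using that by (intro Max_ge) auto
  have G1: "G \<ge> 1" using G[of 0] ge1[of 1] by simp
  define \<epsilon> where "\<epsilon> = 1 / (\<Lambda> * \<Lambda> * G)"
  have \<epsilon>: "\<epsilon> > 0" "\<Lambda> * \<Lambda> * \<epsilon> * G = 1" using L(1) G1 by (auto simp: \<epsilon>_def)
  obtain C1 where C1: "C1 > 0" "\<And>m r. m > 0 \<Longrightarrow> r > 0 \<Longrightarrow> r \<le> 1 / (C1 * (\<eta> m + 1)) \<Longrightarrow> r * \<eta> (m / r) \<le> \<epsilon>"
    using nonlinearity_small_scale[OF ge1 anti mon L T \<epsilon>(1)] by metis
  define C where "C = max C1 ((2 * C') ^ n)"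
  have C: "C > 0" "C1 \<le> C" "(2 * C') ^ n \<le> C" using C1 by (auto simp: C_def)
  show ?thesis
  proof (intro exI[of _ C] conjI allI impI C(1); elim conjE)
    fix u :: "(real ^ 'n) \<times> real \<Rightarrow> real" and x0 t0 \<rho>
    assume u: "continuous_on ?Q u" "\<forall>z\<in>?Q. 0 \<le> u z" "viscosity_supersolution l L \<phi> ?Q u"
      "viscosity_subsolution l L \<phi> ?Q u" and x0: "(x0, t0) \<in> ?Q" "0 < u (x0, t0)"
      and \<rho>: "0 < \<rho>" and sub: "parabolic_cube (2 * \<rho>) x0 t0 \<union> A_plus c \<rho> x0 t0 \<subseteq> ?Q"
      and \<rho>_le: "\<rho> \<le> u (x0, t0) / (C * (\<phi> (u (x0, t0)) + u (x0, t0)))"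
    define u0 where "u0 = u (x0, t0)"
    have u0: "u0 > 0" using x0 by (simp add: u0_def)
    \<comment> \<open>Cubes of radius \<open>2 * r = \<rho>\<close> around points of the segment
      still have spatial distance less than \<open>2 * \<rho>\<close> from \<open>x0\<close>, as
      \<open>c \<le> 1\<close>.\<close>
    define r where "r = \<rho> / 2"
    have r: "r > 0" using \<rho> by (simp add: r_def)
    have e0: "\<eta> u0 \<ge> 1" by (rule ge1[OF u0])
    have eq: "C * (\<phi> u0 + u0) = u0 * (C * (\<eta> u0 + 1))" using eta[of u0] u0 by (simp add: algebra_simps)
    have "\<rho> \<le> u0 / (u0 * (C * (\<eta> u0 + 1)))" using \<rho>_le[folded u0_def] by (simp only: eq)
    also have "\<dots> = 1 / (C * (\<eta> u0 + 1))" using u0 by simp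
    also have "\<dots> \<le> 1 / (C1 * (\<eta> u0 + 1))"
      using C C1(1) e0 by (intro divide_left_mono mult_right_mono mult_pos_pos) auto
    finally have "r * \<eta> (u0 / r) \<le> \<epsilon>" using \<rho> by (intro C1(2) u0 r) (simp add: r_def)
    have nonneg: "0 \<le> r * \<eta> (u0 / r)" using r u0 ge1[of "u0 / r"] by (intro mult_nonneg_nonneg) auto
    have small: "r * \<Lambda> * \<eta> (u0 * \<theta> ^ k / r) \<le> 1" if "k \<le> n" for k
    proof -
      have "\<eta> (u0 * \<theta> ^ k / r) = \<eta> (u0 / r * \<theta> ^ k)" by simp
      also have "\<dots> \<le> \<Lambda> * \<eta> (u0 / r) * \<eta> (\<theta> ^ k)" using u0 r \<theta> by (intro L(2)) auto
      finally have "r * \<Lambda> * \<eta> (u0 * \<theta> ^ k / r) \<le> r * \<Lambda> * (\<Lambda> * \<eta> (u0 / r) * \<eta> (\<theta> ^ k))"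
        using r L(1) by (intro mult_left_mono) auto
      also have "\<dots> = \<Lambda> * \<Lambda> * (r * \<eta> (u0 / r)) * \<eta> (\<theta> ^ k)" by simp
      also have "\<dots> \<le> \<Lambda> * \<Lambda> * \<epsilon> * G"
        using G[OF that] L(1) \<epsilon>(1) \<open>r * \<eta> (u0 / r) \<le> \<epsilon>\<close> nonneg ge1[of "\<theta> ^ k"] \<theta>
        by (intro mult_mono) auto
      finally show ?thesis using \<epsilon>(2) by simp
    qed
    have key: "u0 \<le> C * u z" if z: "z \<in> A_plus c \<rho> x0 t0" for z
    proof -
      obtain x1 t1 where z_eq: "z = (x1, t1)" by (cases z)
      have z1: "infnorm (x1 - x0) < \<rho> * c / 2" "\<rho>\<^sup>2 - (\<rho> * c)\<^sup>2 / 2 < t1 - t0" "t1 - t0 \<le> \<rho>\<^sup>2 - (\<rho> * c)\<^sup>2 / 4"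
        using z by (auto simp: A_plus_def z_eq)
      have "z \<in> ?Q" using z sub by blast
      then have t1: "t1 \<le> 0" by (simp add: z_eq parabolic_cube_def)
      have "c\<^sup>2 \<le> 1" using c by (simp add: power_le_one)
      then have "(\<rho> * c)\<^sup>2 \<le> \<rho>\<^sup>2" by (simp add: power_mult_distrib mult_left_le)
      then have t01: "t0 \<le> t1" using z1(2) zero_le_power2[of \<rho>] by linarith
      \<comment> \<open>A step has radius \<open>r * a = \<rho> / s\<close> with
        \<open>s * s = n\<close>, so \<open>y\<close> and \<open>\<tau>\<close> are the
        displacements \<open>(x0 - x1) / n\<close> and \<open>(t0 - t1) / n\<close> in units of this
        radius and of its square.\<close>
      define y where "y = (1 / (s * \<rho>)) *\<^sub>R (x0 - x1)"
      define \<tau> where "\<tau> = (t0 - t1) / \<rho>\<^sup>2"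
      have A: "(y, \<tau>) \<in> A_minus_1 c"
      proof -
        have "infnorm y = infnorm (x1 - x0) / (s * \<rho>)"
          using s2 \<rho> by (simp add: y_def infnorm_mul infnorm_sub[of x0])
        also have "\<dots> \<le> (\<rho> * c / 2) / (1 * \<rho>)"
          using z1(1) s2 \<rho> c by (intro frac_le mult_right_mono mult_pos_pos) auto
        also have "\<dots> = c / 2" using \<rho> by simp
        finally have "infnorm y \<le> c / 2" .
        moreover have "- 1 + c\<^sup>2 / 4 \<le> \<tau>" "\<tau> \<le> - 1 + c\<^sup>2 / 2"
          using z1(2,3) \<rho> by (simp_all add: \<tau>_def field_simps power_mult_distrib)
        ultimately show ?thesis by (simp add: A_minus_1_def)
      qed
      define X where "X j = x1 + (real j / real n) *\<^sub>R (x0 - x1)" for j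
      define S where "S j = t1 + real j / real n * (t0 - t1)" for j
      have step_x: "X j + r *\<^sub>R a *\<^sub>R y = X (Suc j)" for j
      proof -
        have "r * (a * (1 / (s * \<rho>))) = 1 / real n" using \<rho> s2 n0 by (simp add: r_def a_def ss[symmetric])
        then have "r *\<^sub>R a *\<^sub>R y = (1 / real n) *\<^sub>R (x0 - x1)" by (simp add: y_def)
        moreover have "real (Suc j) / real n = real j / real n + 1 / real n" by (simp add: add_divide_distrib)
        ultimately show ?thesis unfolding X_def by (simp only: scaleR_left_distrib add.assoc)
      qed
      have step_t: "S j + r\<^sup>2 * (a\<^sup>2 * \<tau>) = S (Suc j)" for j
      proof -
        have "r\<^sup>2 * a\<^sup>2 / \<rho>\<^sup>2 = 1 / real n"
          using \<rho> s2 by (simp add: r_def a_def ss[symmetric] power2_eq_square)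
        moreover have "r\<^sup>2 * (a\<^sup>2 * \<tau>) = (r\<^sup>2 * a\<^sup>2 / \<rho>\<^sup>2) * (t0 - t1)" by (simp add: \<tau>_def)
        ultimately have "r\<^sup>2 * (a\<^sup>2 * \<tau>) = (t0 - t1) / real n" by simp
        then show ?thesis unfolding S_def by (simp add: add_divide_distrib distrib_right)
      qed
      have inQ: "(X j + r *\<^sub>R y', S j + r\<^sup>2 * s') \<in> ?Q"
        if j: "j \<le> n" and y': "infnorm y' \<le> 2" "- 4 \<le> s'" "s' \<le> 0" for j y' s'
      proof -
        define q where "q = 1 - real j / real n"
        have q: "0 \<le> q" "q \<le> 1" using j n0 by (auto simp: q_def)
        have eq: "X j + r *\<^sub>R y' - x0 = q *\<^sub>R (x1 - x0) + r *\<^sub>R y'"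
          by (simp add: X_def q_def algebra_simps)
        have "infnorm (X j + r *\<^sub>R y' - x0) \<le> q * infnorm (x1 - x0) + r * infnorm y'"
          unfolding eq using infnorm_triangle[of "q *\<^sub>R (x1 - x0)" "r *\<^sub>R y'"] q r by (simp add: infnorm_mul)
        also have "\<dots> \<le> 1 * (\<rho> * c / 2) + r * 2"
          using q z1(1) r y' by (intro add_mono mult_mono) (auto simp: infnorm_pos_le)
        also have "\<dots> < 2 * \<rho>" using \<rho> c mult_left_le[of c \<rho>] by (simp add: r_def)
        finally have near: "infnorm (X j + r *\<^sub>R y' - x0) < 2 * \<rho>" .
        have "t1 + k * (t0 - t1) = t0 + (1 - k) * (t1 - t0)" for k by (simp add: algebra_simps)
        then have Sj: "S j = t0 + q * (t1 - t0)" unfolding S_def q_def .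
        have "0 \<le> q * (t1 - t0)" "q * (t1 - t0) \<le> 1 * (t1 - t0)"
          using q t01 mult_right_mono[OF q(2), of "t1 - t0"] by simp_all
        then have S: "t0 \<le> S j" "S j \<le> t1" unfolding Sj by simp_all
        have "r\<^sup>2 * (- 4) \<le> r\<^sup>2 * s'" using y' by (intro mult_left_mono) auto
        then have lo: "- \<rho>\<^sup>2 \<le> r\<^sup>2 * s'" by (simp add: r_def power2_eq_square)
        have hi: "r\<^sup>2 * s' \<le> 0" using y' by (simp add: mult_nonneg_nonpos)
        have \<rho>2: "\<rho>\<^sup>2 < (2 * \<rho>)\<^sup>2" using \<rho> by (simp add: power_mult_distrib)
        show ?thesis
        proof (cases "S j + r\<^sup>2 * s' \<le> t0")
          case True
          moreover have "t0 - (2 * \<rho>)\<^sup>2 < S j + r\<^sup>2 * s'" using S(1) lo \<rho>2 by linarith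
          ultimately have "(X j + r *\<^sub>R y', S j + r\<^sup>2 * s') \<in> parabolic_cube (2 * \<rho>) x0 t0"
            using near by (simp add: parabolic_cube_def)
          then show ?thesis using sub by blast
        next
          \<comment> \<open>Times after \<open>t0\<close> are outside the small cube. But the
            spatial point is admissible at time \<open>t0\<close>, and the time lies between
            \<open>t0\<close> and \<open>t1 \<le> 0\<close>, so the product structure of the large
            cube suffices.\<close>
          case False
          have "(X j + r *\<^sub>R y', t0) \<in> parabolic_cube (2 * \<rho>) x0 t0"
            using near \<rho> by (simp add: parabolic_cube_def)
          then have "(X j + r *\<^sub>R y', t0) \<in> ?Q" using sub by blast
          then show ?thesis using False S hi t1 by (simp add: parabolic_cube_def)
        qed
      qed
      \<comment> \<open>Index \<open>n\<close> is the early point \<open>(x0, t0)\<close> and index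
        \<open>0\<close> is \<open>z\<close>. Each step is based at the later point
        \<open>(X j, S j)\<close> and uses the bound at the earlier one, of index
        \<open>Suc j\<close>.\<close>
      have chain: "i \<le> n \<Longrightarrow> u0 * \<theta> ^ i \<le> u (X (n - i), S (n - i))" for i
      proof (induction i)
        case 0
        have "X n = x0" "S n = t0" using n0 by (simp_all add: X_def S_def)
        then show ?case by (simp add: u0_def)
      next
        case (Suc i)
        define j where "j = n - Suc i"
        have j: "n - i = Suc j" "j \<le> n" using Suc.prems by (auto simp: j_def)
        have "(u0 * \<theta> ^ i) / (2 * C') \<le> u (X j, S j)"
        proof (rule intrinsic_harnack_step[where a = a and y = y and s = \<tau> and u = u and r = r and c = c
              and l' = l' and L' = L' and l = l and L = L and \<phi> = \<phi> and \<eta> = \<eta> and \<Lambda> = \<Lambda> and H = H])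
          show "u0 * \<theta> ^ i \<le> u (X j + r *\<^sub>R a *\<^sub>R y, S j + r\<^sup>2 * (a\<^sup>2 * \<tau>))"
            using Suc j unfolding step_x step_t by simp
          show "r * \<Lambda> * \<eta> (u0 * \<theta> ^ i / r) \<le> 1" using Suc.prems by (intro small) simp
          show "0 < u0 * \<theta> ^ i" using u0 \<theta> by simp
          show "0 \<le> u z" if "z \<in> ?Q" for z using u(2) that by blast
          show "(X j + r *\<^sub>R y', S j + r\<^sup>2 * s') \<in> ?Q" if "infnorm y' \<le> 2" "- 4 \<le> s'" "s' \<le> 0" for y' s'
            by (rule inQ[OF j(2) that])
        qed (fact bh C' c ell eta ge1 L H u r a A)+
        then show ?case by (simp add: \<theta>_def j_def)
      qed
      have uz: "0 \<le> u z" using u(2) \<open>z \<in> ?Q\<close> by blast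
      have "u0 * \<theta> ^ n \<le> u z" using chain[of n] by (simp add: X_def S_def z_eq)
      then have "u0 \<le> (2 * C') ^ n * u z"
        using C' by (simp add: \<theta>_def power_divide field_simps)
      also have "\<dots> \<le> C * u z" using C(3) uz by (rule mult_right_mono)
      finally show ?thesis .
    qed
    have "A_plus c \<rho> x0 t0 \<noteq> {}"
    proof -
      have "(x0, t0 + (\<rho>\<^sup>2 - (\<rho> * c)\<^sup>2 / 4)) \<in> A_plus c \<rho> x0 t0"
        using \<rho> c by (simp add: A_plus_def infnorm_0)
      then show ?thesis by blast
    qed
    then have "u0 / C \<le> (INF z \<in> A_plus c \<rho> x0 t0. u z)"
      by (rule cINF_greatest) (use key C(1) in \<open>simp add: pos_divide_le_eq mult.commute\<close>)
    then show "u (x0, t0) \<le> C * (INF z \<in> A_plus c \<rho> x0 t0. u z)"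
      using C(1) by (simp add: u0_def pos_divide_le_eq mult.commute)
  qed
qed

end
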